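(* Let $N$ be a closed (not necessarily compact) submanifold of a Finsler manifold $(M,F)$ (no completeness is assumed). Then the cut time map $\rho : S(\nu(N)) \to [0,\infty]$ is always positive. Moreover, for any $\mathbf{n} \in S(\nu)$ there exist some $\epsilon > 0$ and a neighborhood $V$ of $\mathbf{n}$ in $S(\nu)$ such that $\rho(\mathbf{v}) \ge \epsilon$ for all $\mathbf{v} \in V$.
   Context: All manifolds are smooth, connected and without boundary. A closed submanifold is a topologically closed, not necessarily compact, embedded submanifold. A Finsler metric on $M$ is a continuous function $F : TM \to \mathbb{R}$, smooth on $TM$ minus the zero section, such that for each $p \in M$ the restriction $F_p = F|_{T_pM}$ satisfies $F_p(\lambda \mathbf{v}) = \lambda F_p(\mathbf{v})$ for all $\lambda > 0$ and $\mathbf{v} \ne 0$, and for each $\mathbf{v} \in T_pM \setminus \{0\}$ the fundamental tensor $g_{\mathbf{v}}(\mathbf{v}_1, \mathbf{v}_2) = \frac12 \frac{\partial^2}{\partial s_1 \partial s_2}\big|_{s_1=s_2=0} F_p(\mathbf{v} + s_1\mathbf{v}_1 + s_2\mathbf{v}_2)^2$ is positive definite. $F$ need not be reversible. The length of a piecewise smooth curve is $L(\gamma) = \int F(\dot\gamma)\,dt$; $d(N,q)$ is the infimum of lengths of piecewise smooth curves starting at a point of $N$ and ending at $q$. Geodesics are critical points of the energy $\frac12\int F(\dot\gamma)^2 dt$. $\exp : \mathcal{O} \subset TM \to M$, $\exp(\mathbf{v}) = \gamma_{\mathbf{v}}(1)$, where $\gamma_{\mathbf{v}}$ is the geodesic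 with initial velocity $\mathbf{v}$ and $\mathcal{O}$ is the maximal open neighborhood of the zero section where this is defined. Geodesics are considered only where they are defined. For $p \in N$ the normal cone is $\nu_p = \{\mathbf{v} \in T_pM \setminus \{0\} : g_{\mathbf{v}}(\mathbf{v},\mathbf{w}) = 0 \ \forall \mathbf{w} \in T_pN\} \cup \{0\}$; $\nu = \nu(N) = \bigcup_{p \in N} \nu_p$, and $S(\nu) = \{\mathbf{v} \in \nu : F(\mathbf{v}) = 1\}$ with the topology induced from $TM$. The normal exponential map $\exp^\nu$ is the restriction of $\exp$ to $\nu$ (where defined). For $\mathbf{v} \in S(\nu)$, put $\gamma_{\mathbf{v}}(t) = \exp^\nu(t\mathbf{v})$; the cut time of $\mathbf{v}$ is $\rho(\mathbf{v}) = \sup\{t : d(N,\gamma_{\mathbf{v}}(t)) = t\} \in [0,\infty]$.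
   Formalization: The Finsler metric F is assumed nonnegative on TM; with real values allowed, F = dθ on the circle meets all other conditions, but lengths are unbounded below, d(N,·) = −∞ and ρ is not positive. Only sign-changing metrics on one-dimensional manifolds are excluded. *)

theory Defs
  imports "HOL-Analysis.Analysis"
begin

section \<open>Smooth functions between normed spaces\<close>

text \<open>Both predicates are only used for open sets.\<close>

primrec Ck_on :: "nat \<Rightarrow> ('a::real_normed_vector \<Rightarrow> 'b::real_normed_vector) \<Rightarrow> 'a set \<Rightarrow> bool"
  where
    "Ck_on 0 f S \<longleftrightarrow> continuous_on S f"
  | "Ck_on (Suc k) f S \<longleftrightarrow> (\<forall>x\<in>S. f differentiable (at x)) \<and>
       (\<forall>v. Ck_on k (\<lambda>x. frechet_derivative f (at x) v) S)"

definition smooth_on :: "('a::real_normed_vector \<Rightarrow> 'b::real_normed_vector) \<Rightarrow> 'a set \<Rightarrow> bool"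
  where "smooth_on f S \<longleftrightarrow> (\<forall>k. Ck_on k f S)"


section \<open>Smooth manifolds\<close>

text \<open>
  The underlying space of the manifold is a type \<open>'m\<close> that is Hausdorff and second countable;
  the model space is the Euclidean space \<open>'e\<close>. A chart is a pair of its domain and its
  coordinate map; the values of the map outside the domain are irrelevant.
\<close>

type_synonym ('m, 'e) chart = "'m set \<times> ('m \<Rightarrow> 'e)"

definition is_chart :: "('m::topological_space, 'e::euclidean_space) chart \<Rightarrow> bool"
  where "is_chart c \<longleftrightarrow> open (fst c) \<and> open (snd c ` fst c) \<and>
    homeomorphism (fst c) (snd c ` fst c) (snd c) (inv_into (fst c) (snd c))"

text \<open>Coordinate change from \<open>c\<close> to \<open>d\<close>, meaningful on \<open>snd c ` (fst c \<inter> fst d)\<close>.\<close>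

definition transition :: "('m, 'e) chart \<Rightarrow> ('m, 'e) chart \<Rightarrow> 'e \<Rightarrow> 'e"
  where "transition c d = snd d \<circ> inv_into (fst c) (snd c)"

definition compatible ::
    "('m::topological_space, 'e::euclidean_space) chart \<Rightarrow> ('m, 'e) chart \<Rightarrow> bool"
  where "compatible c d \<longleftrightarrow>
    smooth_on (transition c d) (snd c ` (fst c \<inter> fst d)) \<and>
    smooth_on (transition d c) (snd d ` (fst c \<inter> fst d))"

text \<open>A smooth structure is a maximal smooth atlas.\<close>

definition smooth_structure :: "('m::topological_space, 'e::euclidean_space) chart set \<Rightarrow> bool"
  where "smooth_structure A \<longleftrightarrow>
    (\<forall>c\<in>A. is_chart c) \<and> (\<Union>c\<in>A. fst c) = UNIV \<and>
    (\<forall>c\<in>A. \<forall>d\<in>A. compatible c d) \<and>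
    (\<forall>c. is_chart c \<and> (\<forall>d\<in>A. compatible c d) \<longrightarrow> c \<in> A)"

definition smooth_manifold ::
    "('m::{t2_space,second_countable_topology}, 'e::euclidean_space) chart set \<Rightarrow> bool"
  where "smooth_manifold A \<longleftrightarrow> smooth_structure A \<and> connected (UNIV :: 'm set)"

text \<open>Smoothness of a map from an open set \<open>W\<close> of a normed space into the manifold.\<close>

definition smooth_into ::
    "('m::topological_space, 'e::euclidean_space) chart set \<Rightarrow> 'a::real_normed_vector set
      \<Rightarrow> ('a \<Rightarrow> 'm) \<Rightarrow> bool"
  where "smooth_into A W f \<longleftrightarrow> continuous_on W f \<and>
    (\<forall>c\<in>A. smooth_on (snd c \<circ> f) {x\<in>W. f x \<in> fst c})"

text \<open>Closed, connected, embedded submanifolds, by means of slice charts.\<close>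

definition closed_submanifold ::
    "('m::topological_space, 'e::euclidean_space) chart set \<Rightarrow> 'm set \<Rightarrow> bool"
  where "closed_submanifold A N \<longleftrightarrow> closed N \<and> connected N \<and>
    (\<exists>k. \<forall>p\<in>N. \<exists>c\<in>A. \<exists>S. p \<in> fst c \<and> subspace S \<and> dim S = k \<and>
      snd c ` (fst c \<inter> N) = snd c ` fst c \<inter> S)"


section \<open>The tangent bundle\<close>

text \<open>
  A tangent vector is a base point together with the family of its coordinate representations in
  all charts around that point, which transform by the derivatives of the coordinate changes.
  At indices that are not charts around the base point the family is set to zero.
\<close>

type_synonym ('m, 'e) tvec = "'m \<times> (('m, 'e) chart \<Rightarrow> 'e)"

definition tangent_space ::
    "('m::topological_space, 'e::euclidean_space) chart set \<Rightarrow> 'm \<Rightarrow> ('m, 'e) tvec set"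
  where "tangent_space A p = {v. fst v = p \<and>
    (\<forall>c. c \<notin> A \<or> p \<notin> fst c \<longrightarrow> snd v c = 0) \<and>
    (\<forall>c\<in>A. \<forall>d\<in>A. p \<in> fst c \<inter> fst d \<longrightarrow>
       snd v d = frechet_derivative (transition c d) (at (snd c p)) (snd v c))}"

definition tangent_bundle ::
    "('m::topological_space, 'e::euclidean_space) chart set \<Rightarrow> ('m, 'e) tvec set"
  where "tangent_bundle A = (\<Union>p. tangent_space A p)"

definition tzero :: "'m \<Rightarrow> ('m, 'e::real_vector) tvec"
  where "tzero p = (p, \<lambda>c. 0)"

text \<open>Fibrewise operations; \<open>tadd\<close> is only used for vectors with the same base point.\<close>

definition tadd :: "('m, 'e::real_vector) tvec \<Rightarrow> ('m, 'e) tvec \<Rightarrow> ('m, 'e) tvec"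
  where "tadd v w = (fst v, \<lambda>c. snd v c + snd w c)"

definition tscale :: "real \<Rightarrow> ('m, 'e::real_vector) tvec \<Rightarrow> ('m, 'e) tvec"
  where "tscale r v = (fst v, \<lambda>c. r *\<^sub>R snd v c)"

definition bundle_over ::
    "('m::topological_space, 'e::euclidean_space) chart set \<Rightarrow> ('m, 'e) chart \<Rightarrow> ('m, 'e) tvec set"
  where "bundle_over A c = {v \<in> tangent_bundle A. fst v \<in> fst c}"

text \<open>
  The bundle chart over \<open>c\<close> maps \<open>bundle_over A c\<close> bijectively to \<open>snd c ` fst c \<times> UNIV\<close>.
\<close>

definition bundle_chart :: "('m, 'e) chart \<Rightarrow> ('m, 'e) tvec \<Rightarrow> 'e \<times> 'e"
  where "bundle_chart c v = (snd c (fst v), snd v c)"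

definition bundle_topology ::
    "('m::topological_space, 'e::euclidean_space) chart set \<Rightarrow> ('m, 'e) tvec topology"
  where "bundle_topology A = topology_generated_by
    {{v \<in> bundle_over A c. bundle_chart c v \<in> W} | c W. c \<in> A \<and> open W}"

definition velocity ::
    "('m::topological_space, 'e::euclidean_space) chart set \<Rightarrow> (real \<Rightarrow> 'm) \<Rightarrow> real \<Rightarrow> ('m, 'e) tvec"
  where "velocity A \<gamma> t = (\<gamma> t, \<lambda>c. if c \<in> A \<and> \<gamma> t \<in> fst c
    then vector_derivative (snd c \<circ> \<gamma>) (at t) else 0)"

text \<open>\<open>T\<^sub>pN\<close>, as a subspace of \<open>T\<^sub>pM\<close>, consists of the velocities of smooth curves lying in \<open>N\<close>.\<close>

definition submanifold_tangent_space ::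
    "('m::topological_space, 'e::euclidean_space) chart set \<Rightarrow> 'm set \<Rightarrow> 'm \<Rightarrow> ('m, 'e) tvec set"
  where "submanifold_tangent_space A N p = {velocity A \<gamma> 0 | \<gamma> \<delta>. \<delta> > 0 \<and>
    smooth_into A {-\<delta><..<\<delta>} \<gamma> \<and> \<gamma> ` {-\<delta><..<\<delta>} \<subseteq> N \<and> \<gamma> 0 = p}"


section \<open>Finsler metrics\<close>

definition fundamental_tensor ::
    "(('m, 'e::real_vector) tvec \<Rightarrow> real) \<Rightarrow> ('m, 'e) tvec \<Rightarrow> ('m, 'e) tvec \<Rightarrow> ('m, 'e) tvec \<Rightarrow> real"
  where "fundamental_tensor F v v1 v2 = (1/2) *
    deriv (\<lambda>s1. deriv (\<lambda>s2. (F (tadd (tadd v (tscale s1 v1)) (tscale s2 v2)))\<^sup>2) 0) 0"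

text \<open>
  Nonnegativity is the usual convention. It has to be stated: on a one-dimensional manifold a
  nowhere vanishing closed one-form, such as \<open>d\<theta>\<close> on the circle, satisfies all the other
  conditions, although its length functional is negative on some curves. The values of \<open>F\<close>
  outside the tangent bundle are irrelevant.
\<close>

definition finsler_metric ::
    "('m::topological_space, 'e::euclidean_space) chart set \<Rightarrow> (('m, 'e) tvec \<Rightarrow> real) \<Rightarrow> bool"
  where "finsler_metric A F \<longleftrightarrow>
    (\<forall>v\<in>tangent_bundle A. 0 \<le> F v) \<and>
    continuous_map (bundle_topology A) euclideanreal F \<and>
    (\<forall>c\<in>A. smooth_on (F \<circ> inv_into (bundle_over A c) (bundle_chart c))
       ((snd c ` fst c) \<times> (- {0}))) \<and>
    (\<forall>p. \<forall>v \<in> tangent_space A p - {tzero p}.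
       (\<forall>r>0. F (tscale r v) = r * F v) \<and>
       (\<forall>w \<in> tangent_space A p - {tzero p}. fundamental_tensor F v w w > 0))"

definition finsler_manifold ::
    "('m::{t2_space,second_countable_topology}, 'e::euclidean_space) chart set
      \<Rightarrow> (('m, 'e) tvec \<Rightarrow> real) \<Rightarrow> bool"
  where "finsler_manifold A F \<longleftrightarrow> smooth_manifold A \<and> finsler_metric A F"


section \<open>Length, distance and geodesics\<close>

text \<open>
  The pieces of a piecewise smooth curve are smooth up to their end points, i.e. they extend
  to smooth curves on larger open sets of parameters.
\<close>

definition piecewise_smooth ::
    "('m::topological_space, 'e::euclidean_space) chart set \<Rightarrow> real \<Rightarrow> real \<Rightarrow> (real \<Rightarrow> 'm) \<Rightarrow> bool"
  where "piecewise_smooth A a b \<gamma> \<longleftrightarrow> continuous_on {a..b} \<gamma> \<and>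
    (\<exists>n \<tau>. \<tau> 0 = a \<and> \<tau> n = b \<and> (\<forall>i<n. \<tau> i < \<tau> (Suc i) \<and>
      (\<exists>J \<eta>. open J \<and> {\<tau> i..\<tau> (Suc i)} \<subseteq> J \<and> smooth_into A J \<eta> \<and>
        (\<forall>t\<in>{\<tau> i..\<tau> (Suc i)}. \<eta> t = \<gamma> t))))"

definition curve_length ::
    "('m::topological_space, 'e::euclidean_space) chart set \<Rightarrow> (('m, 'e) tvec \<Rightarrow> real)
      \<Rightarrow> real \<Rightarrow> real \<Rightarrow> (real \<Rightarrow> 'm) \<Rightarrow> real"
  where "curve_length A F a b \<gamma> = integral {a..b} (\<lambda>t. F (velocity A \<gamma> t))"

definition dist_from ::
    "('m::topological_space, 'e::euclidean_space) chart set \<Rightarrow> (('m, 'e) tvec \<Rightarrow> real)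
      \<Rightarrow> 'm set \<Rightarrow> 'm \<Rightarrow> ereal"
  where "dist_from A F N q = Inf {ereal (curve_length A F a b \<gamma>) | a b \<gamma>.
    a < b \<and> piecewise_smooth A a b \<gamma> \<and> \<gamma> a \<in> N \<and> \<gamma> b = q}"

definition energy ::
    "('m::topological_space, 'e::euclidean_space) chart set \<Rightarrow> (('m, 'e) tvec \<Rightarrow> real)
      \<Rightarrow> real \<Rightarrow> real \<Rightarrow> (real \<Rightarrow> 'm) \<Rightarrow> real"
  where "energy A F a b \<gamma> = (1/2) * integral {a..b} (\<lambda>t. (F (velocity A \<gamma> t))\<^sup>2)"

text \<open>Criticality is with respect to smooth variations \<open>\<Gamma>(s, t)\<close> with fixed end points.\<close>

definition energy_critical ::
    "('m::topological_space, 'e::euclidean_space) chart set \<Rightarrow> (('m, 'e) tvec \<Rightarrow> real)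
      \<Rightarrow> real \<Rightarrow> real \<Rightarrow> (real \<Rightarrow> 'm) \<Rightarrow> bool"
  where "energy_critical A F a b \<gamma> \<longleftrightarrow>
    (\<forall>\<delta> J \<Gamma>. \<delta> > 0 \<and> open J \<and> {a..b} \<subseteq> J \<and> smooth_into A ({-\<delta><..<\<delta>} \<times> J) \<Gamma> \<and>
      (\<forall>t\<in>{a..b}. \<Gamma> (0, t) = \<gamma> t) \<and>
      (\<forall>s\<in>{-\<delta><..<\<delta>}. \<Gamma> (s, a) = \<gamma> a \<and> \<Gamma> (s, b) = \<gamma> b) \<longrightarrow>
      ((\<lambda>s. energy A F a b (\<lambda>t. \<Gamma> (s, t))) has_real_derivative 0) (at 0))"

text \<open>Geodesics on open intervals: every compact piece is a critical point of the energy.\<close>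

definition geodesic ::
    "('m::topological_space, 'e::euclidean_space) chart set \<Rightarrow> (('m, 'e) tvec \<Rightarrow> real)
      \<Rightarrow> real set \<Rightarrow> (real \<Rightarrow> 'm) \<Rightarrow> bool"
  where "geodesic A F I \<gamma> \<longleftrightarrow> open I \<and> is_interval I \<and> smooth_into A I \<gamma> \<and>
    (\<forall>a b. a < b \<and> {a..b} \<subseteq> I \<longrightarrow> energy_critical A F a b \<gamma>)"

definition geodesic_end ::
    "('m::topological_space, 'e::euclidean_space) chart set \<Rightarrow> (('m, 'e) tvec \<Rightarrow> real)
      \<Rightarrow> ('m, 'e) tvec \<Rightarrow> 'm \<Rightarrow> bool"
  where "geodesic_end A F v q \<longleftrightarrow>
    (\<exists>I \<gamma>. geodesic A F I \<gamma> \<and> {0..1} \<subseteq> I \<and> velocity A \<gamma> 0 = v \<and> \<gamma> 1 = q)"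

definition exp_map ::
    "('m::topological_space, 'e::euclidean_space) chart set \<Rightarrow> (('m, 'e) tvec \<Rightarrow> real)
      \<Rightarrow> ('m, 'e) tvec \<Rightarrow> 'm"
  where "exp_map A F v = (THE q. geodesic_end A F v q)"

text \<open>The largest open set of tangent vectors for which the geodesic is defined up to time 1.\<close>

definition exp_domain ::
    "('m::topological_space, 'e::euclidean_space) chart set \<Rightarrow> (('m, 'e) tvec \<Rightarrow> real)
      \<Rightarrow> ('m, 'e) tvec set"
  where "exp_domain A F =
    bundle_topology A interior_of {v \<in> tangent_bundle A. \<exists>q. geodesic_end A F v q}"


section \<open>The normal cone and the cut time\<close>

definition normal_cone_at ::
    "('m::topological_space, 'e::euclidean_space) chart set \<Rightarrow> (('m, 'e) tvec \<Rightarrow> real)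
      \<Rightarrow> 'm set \<Rightarrow> 'm \<Rightarrow> ('m, 'e) tvec set"
  where "normal_cone_at A F N p =
    {v \<in> tangent_space A p - {tzero p}.
       \<forall>w \<in> submanifold_tangent_space A N p. fundamental_tensor F v v w = 0} \<union> {tzero p}"

definition normal_cone ::
    "('m::topological_space, 'e::euclidean_space) chart set \<Rightarrow> (('m, 'e) tvec \<Rightarrow> real)
      \<Rightarrow> 'm set \<Rightarrow> ('m, 'e) tvec set"
  where "normal_cone A F N = (\<Union>p\<in>N. normal_cone_at A F N p)"

definition unit_normal_cone ::
    "('m::topological_space, 'e::euclidean_space) chart set \<Rightarrow> (('m, 'e) tvec \<Rightarrow> real)
      \<Rightarrow> 'm set \<Rightarrow> ('m, 'e) tvec set"
  where "unit_normal_cone A F N = {v \<in> normal_cone A F N. F v = 1}"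

definition unit_normal_topology ::
    "('m::topological_space, 'e::euclidean_space) chart set \<Rightarrow> (('m, 'e) tvec \<Rightarrow> real)
      \<Rightarrow> 'm set \<Rightarrow> ('m, 'e) tvec topology"
  where "unit_normal_topology A F N = subtopology (bundle_topology A) (unit_normal_cone A F N)"

text \<open>Only times at which the normal exponential map is defined at \<open>t v\<close> are considered.\<close>

definition cut_time ::
    "('m::topological_space, 'e::euclidean_space) chart set \<Rightarrow> (('m, 'e) tvec \<Rightarrow> real)
      \<Rightarrow> 'm set \<Rightarrow> ('m, 'e) tvec \<Rightarrow> ereal"
  where "cut_time A F N v = Sup {ereal t | t. 0 \<le> t \<and>
    tscale t v \<in> normal_cone A F N \<inter> exp_domain A F \<and>
    dist_from A F N (exp_map A F (tscale t v)) = ereal t}"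

end

theory Submission
  imports Defs
begin

text \<open>
  Everything happens in one slice chart \<open>c\<close> around the base point of the given unit normal vector,
  where the submanifold is a linear subspace. Write \<open>L = f\<^sup>2 / 2\<close> with vertical gradient \<open>p\<close>, let
  \<open>x(t)\<close> be a unit speed geodesic with normal initial velocity \<open>\<eta>\<close>, and put
  \<open>u(t, y) = p(t) \<bullet> (y - x(t)) - (K t / 2) \<bar>y - x(t)\<bar>\<^sup>2\<close>. To first order in \<open>y - x(t)\<close> the
  Hamilton--Jacobi equation holds for \<open>u\<close> because \<open>p' = q\<close> (the horizontal gradient); for large \<open>K\<close>
  and \<open>0 \<le> t \<le> 1 / K\<close> the quadratic term turns it into an inequality near the geodesic, so that
  \<open>u(s, \<gamma>)\<close> does not increase along a curve \<open>\<gamma>\<close> with arc length \<open>s\<close>. It is \<open>0\<close> at the start,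
  since \<open>p(0)\<close> annihilates the subspace, but positive at \<open>x(T)\<close> if \<open>s < T\<close>; hence no curve
  from the submanifold to \<open>x(T)\<close> inside the chart is shorter than \<open>T\<close>, and curves leaving the chart are
  too long anyway. All constants depend only on a compact neighbourhood of the initial vector, which makes the
  bound locally uniform.
\<close>

section \<open>Calculus of smooth functions\<close>

text \<open>The factor \<open>t\<close> in the quadratic term of \<open>u\<close> is what makes one
  constant \<open>K\<close> work. At \<open>t = 0\<close> the term vanishes, so \<open>u\<close> is
  linear there and vanishes on the subspace. Its time derivative \<open>- (K / 2) |y - x|^2\<close>
  absorbs all errors of second order, while the covector of \<open>u\<close> changes only by
  \<open>- K t (y - x)\<close>, with a coefficient \<open>K t\<close> in [0, 1]. The size of the
  errors is therefore settled before \<open>K\<close> is chosen.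

  \<open>f\<close> is smooth off the zero section only, and a competing curve may stop or turn
  anywhere. Its velocity enters only through the fundamental inequality, which holds for every
  vector; Taylor expansions are made at vectors near the initial one alone.

  \<open>exp_map\<close> is a definite description over energy-critical curves on the manifold. To
  evaluate it, solutions of the spray must be shown critical under every variation, and every
  critical curve with the same initial velocity must be kept in the chart and identified with the
  solution. Moreover geodesics must exist up to time \<open>T\<close> for an open set of initial
  vectors, because \<open>exp_domain\<close> is an interior.\<close>

lemma Ck_on_cong:
  assumes "open S" "\<And>x. x \<in> S \<Longrightarrow> f x = g x"
  shows "Ck_on k f S \<longleftrightarrow> Ck_on k g S"
  using assms(2)
proof (induction k arbitrary: f g)
  case 0
  then show ?case by (simp cong: continuous_on_cong)
next
  case (Suc k)
  have hd: "(f has_derivative d) (at x) \<longleftrightarrow> (g has_derivative d) (at x)" if "x \<in> S" for x d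
    using has_derivative_transform_within_open[OF _ assms(1) that] Suc.prems by metis
  have fd: "frechet_derivative f (at x) = frechet_derivative g (at x)" if "x \<in> S" for x
    unfolding frechet_derivative_def using hd[OF that] by simp
  have "Ck_on k (\<lambda>x. frechet_derivative f (at x) v) S \<longleftrightarrow> Ck_on k (\<lambda>x. frechet_derivative g (at x) v) S" for v
    by (rule Suc.IH) (simp add: fd)
  moreover have "f differentiable at x \<longleftrightarrow> g differentiable at x" if "x \<in> S" for x
    unfolding differentiable_def using hd[OF that] by simp
  ultimately show ?case by simp
qed

lemma Ck_on_subset: "Ck_on k f S \<Longrightarrow> T \<subseteq> S \<Longrightarrow> Ck_on k f T"
  by (induction k arbitrary: f) (auto intro: continuous_on_subset)

lemma Ck_on_imp_continuous: "Ck_on k f S \<Longrightarrow> continuous_on S f"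
  by (cases k) (auto intro!: continuous_at_imp_continuous_on differentiable_imp_continuous_within)

lemma Ck_on_Suc_D: "Ck_on (Suc k) f S \<Longrightarrow> Ck_on k f S"
proof (induction k arbitrary: f)
  case 0
  then show ?case using Ck_on_imp_continuous by (simp del: Ck_on.simps(2))
next
  case (Suc k)
  then show ?case by simp
qed

lemma Ck_on_has_derivative:
  assumes "Ck_on (Suc k) f S" "x \<in> S"
  shows "(f has_derivative frechet_derivative f (at x)) (at x)"
  using assms by (simp add: frechet_derivative_works)

text \<open>\<open>frechet_derivative\<close> is a choice operator. Uniqueness of derivatives lets a
  proof exhibit a formula \<open>f'\<close> instead; the closure properties below rest on
  this.\<close>

lemma Ck_on_SucI:
  assumes "open S"
    and "\<And>x. x \<in> S \<Longrightarrow> (f has_derivative f' x) (at x)"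
    and "\<And>v. Ck_on k (\<lambda>x. f' x v) S"
  shows "Ck_on (Suc k) f S"
proof -
  have "frechet_derivative f (at x) = f' x" if "x \<in> S" for x
    using frechet_derivative_at[OF assms(2)[OF that]] by simp
  then have "Ck_on k (\<lambda>x. frechet_derivative f (at x) v) S" for v
    using assms(3)[of v] Ck_on_cong[OF assms(1), of "\<lambda>x. frechet_derivative f (at x) v" "\<lambda>x. f' x v" k]
    by simp
  then show ?thesis using assms(2) by (auto simp: differentiable_def)
qed

lemma Ck_on_const: "open S \<Longrightarrow> Ck_on k (\<lambda>x. c) S"
proof (induction k arbitrary: c)
  case (Suc k)
  show ?case by (rule Ck_on_SucI[where f' = "\<lambda>x v. 0"]) (use Suc in \<open>auto simp del: Ck_on.simps\<close>)
qed simp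

lemma Ck_on_linear_id:
  assumes "open S" "bounded_linear h"
  shows "Ck_on k h S"
proof (cases k)
  case 0
  then show ?thesis using assms by (simp add: linear_continuous_on)
next
  case (Suc n)
  show ?thesis unfolding \<open>k = Suc n\<close>
    by (rule Ck_on_SucI[where f' = "\<lambda>x. h"])
      (use assms in \<open>auto intro: Ck_on_const bounded_linear_imp_has_derivative\<close>)
qed

lemma Ck_on_add:
  assumes "open S" "Ck_on k f S" "Ck_on k g S"
  shows "Ck_on k (\<lambda>x. f x + g x) S"
  using assms(2,3)
proof (induction k arbitrary: f g)
  case 0
  then show ?case by (auto intro: continuous_intros)
next
  case (Suc k)
  show ?case
    by (rule Ck_on_SucI[OF assms(1), where f' = "\<lambda>x v. frechet_derivative f (at x) v + frechet_derivative g (at x) v"])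
      (use Suc Ck_on_has_derivative[OF Suc.prems(1)] Ck_on_has_derivative[OF Suc.prems(2)]
        in \<open>auto intro: has_derivative_add\<close>)
qed

lemma Ck_on_linear:
  assumes "open S" "bounded_linear h" "Ck_on k f S"
  shows "Ck_on k (\<lambda>x. h (f x)) S"
  using assms(3)
proof (induction k arbitrary: f)
  case 0
  then show ?case using bounded_linear.continuous_on[OF assms(2)] by auto
next
  case (Suc k)
  show ?case
    by (rule Ck_on_SucI[OF assms(1), where f' = "\<lambda>x v. h (frechet_derivative f (at x) v)"])
      (use Suc Ck_on_has_derivative[OF Suc.prems(1)]
        in \<open>auto intro: bounded_linear.has_derivative[OF assms(2)]\<close>)
qed

lemma Ck_on_bilinear:
  assumes "open S" "bounded_bilinear bl" "Ck_on k f S" "Ck_on k g S"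
  shows "Ck_on k (\<lambda>x. bl (f x) (g x)) S"
  using assms(3,4)
proof (induction k arbitrary: f g)
  case 0
  then show ?case using bounded_bilinear.continuous_on[OF assms(2)] by auto
next
  case (Suc k)
  show ?case
    by (rule Ck_on_SucI[OF assms(1), where f' = "\<lambda>x v. bl (f x) (frechet_derivative g (at x) v) + bl (frechet_derivative f (at x) v) (g x)"])
      (use Suc Ck_on_has_derivative[OF Suc.prems(1)] Ck_on_has_derivative[OF Suc.prems(2)]
        Ck_on_Suc_D[OF Suc.prems(1)] Ck_on_Suc_D[OF Suc.prems(2)]
        in \<open>auto intro!: Ck_on_add assms(1) intro: bounded_bilinear.FDERIV[OF assms(2)]\<close>)
qed

lemma Ck_on_sum:
  assumes "open S" "\<And>i. i \<in> I \<Longrightarrow> Ck_on k (f i) S"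
  shows "Ck_on k (\<lambda>x. \<Sum>i\<in>I. f i x) S"
  using assms(2)
  by (induction I rule: infinite_finite_induct) (auto intro: Ck_on_const Ck_on_add assms(1))

text \<open>\<open>Ck_on\<close> speaks of derivatives in a fixed direction. Expanding a moving
  direction in the basis turns the derivative in that direction into a finite sum of products of
  functions already under control.\<close>

lemma linear_sum_Basis:
  fixes d :: "'a::euclidean_space \<Rightarrow> 'b::real_vector"
  assumes "linear d"
  shows "d v = (\<Sum>b\<in>Basis. (v \<bullet> b) *\<^sub>R d b)"
proof -
  have "d v = d (\<Sum>b\<in>Basis. (v \<bullet> b) *\<^sub>R b)" by (simp add: euclidean_representation)
  also have "\<dots> = (\<Sum>b\<in>Basis. (v \<bullet> b) *\<^sub>R d b)"
    by (simp add: linear_sum[OF assms] linear_scale[OF assms])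
  finally show ?thesis .
qed

lemma linear_inner_Basis: "linear d \<Longrightarrow> d v = (\<Sum>b\<in>Basis. d b *\<^sub>R b) \<bullet> v"
  for d :: "'a::euclidean_space \<Rightarrow> real"
  by (subst linear_sum_Basis, simp) (simp add: inner_sum_left inner_commute[of v] mult.commute)

lemma linear_frechet_derivative_Ck: "Ck_on (Suc k) f S \<Longrightarrow> x \<in> S \<Longrightarrow> linear (frechet_derivative f (at x))"
  using Ck_on_has_derivative has_derivative_linear by blast

text \<open>The chain rule replaces \<open>f\<close> by its partial derivatives and keeps
  \<open>g\<close>, so the induction leaves \<open>f\<close> arbitrary. The derivative of
  \<open>f\<close> is taken in a moving direction, hence the expansion in the basis of the middle
  space.\<close>

lemma Ck_on_compose:
  fixes f :: "'b::euclidean_space \<Rightarrow> 'c::real_normed_vector" and g :: "'a::real_normed_vector \<Rightarrow> 'b"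
  assumes "open S" "open T" "Ck_on k f T" "Ck_on k g S" "g ` S \<subseteq> T"
  shows "Ck_on k (\<lambda>x. f (g x)) S"
  using assms(3,4)
proof (induction k arbitrary: f)
  case 0
  then show ?case using assms(5) by (auto intro: continuous_on_compose2)
next
  case (Suc k)
  let ?f' = "\<lambda>x v. \<Sum>b\<in>Basis. (frechet_derivative g (at x) v \<bullet> b) *\<^sub>R frechet_derivative f (at (g x)) b"
  have "((\<lambda>x. f (g x)) has_derivative ?f' x) (at x)" if "x \<in> S" for x
  proof -
    have gx: "g x \<in> T" using assms(5) that by auto
    have "((\<lambda>x. f (g x)) has_derivative (\<lambda>v. frechet_derivative f (at (g x)) (frechet_derivative g (at x) v))) (at x)"
      using has_derivative_compose[OF Ck_on_has_derivative[OF Suc.prems(2) that] Ck_on_has_derivative[OF Suc.prems(1) gx]] .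
    then show ?thesis
      by (subst (asm) linear_sum_Basis[OF linear_frechet_derivative_Ck[OF Suc.prems(1) gx]])
  qed
  moreover have "Ck_on k (\<lambda>x. ?f' x v) S" for v
    using Suc.prems Ck_on_Suc_D[OF Suc.prems(2)] Suc.IH
    by (intro Ck_on_sum Ck_on_bilinear[OF assms(1) bounded_bilinear_scaleR]
      Ck_on_linear[OF assms(1) bounded_linear_inner_left] assms(1)) auto
  ultimately show ?case by (rule Ck_on_SucI[OF assms(1)])
qed

subsection \<open>Smooth functions\<close>

lemma smooth_on_subset: "smooth_on f S \<Longrightarrow> T \<subseteq> S \<Longrightarrow> smooth_on f T"
  unfolding smooth_on_def using Ck_on_subset by blast

lemma smooth_on_cong: "open S \<Longrightarrow> (\<And>x. x \<in> S \<Longrightarrow> f x = g x) \<Longrightarrow> smooth_on f S \<longleftrightarrow> smooth_on g S"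
  unfolding smooth_on_def using Ck_on_cong[of S f g] by blast

lemma smooth_on_imp_continuous: "smooth_on f S \<Longrightarrow> continuous_on S f"
  unfolding smooth_on_def using Ck_on_imp_continuous by blast

lemma smooth_on_has_derivative:
  "smooth_on f S \<Longrightarrow> x \<in> S \<Longrightarrow> (f has_derivative frechet_derivative f (at x)) (at x)"
  unfolding smooth_on_def using Ck_on_has_derivative by blast

lemma smooth_on_linear_derivative: "smooth_on f S \<Longrightarrow> x \<in> S \<Longrightarrow> linear (frechet_derivative f (at x))"
  using smooth_on_has_derivative has_derivative_linear by blast

lemma smooth_on_derivative: "smooth_on f S \<Longrightarrow> smooth_on (\<lambda>x. frechet_derivative f (at x) v) S"
  unfolding smooth_on_def using Ck_on.simps(2) by blast

context
  fixes S :: "'a::real_normed_vector set"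
  assumes S: "open S"
begin

lemma smooth_on_const [intro]: "smooth_on (\<lambda>x. c) S"
  by (simp add: smooth_on_def Ck_on_const S)

lemma smooth_on_linear_id: "bounded_linear h \<Longrightarrow> smooth_on h S"
  by (simp add: smooth_on_def Ck_on_linear_id S)

lemma smooth_on_add: "smooth_on f S \<Longrightarrow> smooth_on g S \<Longrightarrow> smooth_on (\<lambda>x. f x + g x) S"
  by (simp add: smooth_on_def Ck_on_add S)

lemma smooth_on_linear: "bounded_linear h \<Longrightarrow> smooth_on f S \<Longrightarrow> smooth_on (\<lambda>x. h (f x)) S"
  by (simp add: smooth_on_def Ck_on_linear S)

lemma smooth_on_bilinear:
  "bounded_bilinear bl \<Longrightarrow> smooth_on f S \<Longrightarrow> smooth_on g S \<Longrightarrow> smooth_on (\<lambda>x. bl (f x) (g x)) S"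
  by (simp add: smooth_on_def Ck_on_bilinear S)

lemmas smooth_on_scaleR = smooth_on_bilinear[OF bounded_bilinear_scaleR]
lemmas smooth_on_mult = smooth_on_bilinear[OF bounded_bilinear_mult]

lemma smooth_on_minus: "smooth_on f S \<Longrightarrow> smooth_on g S \<Longrightarrow> smooth_on (\<lambda>x. f x - g x) S"
  using smooth_on_add[OF _ smooth_on_linear[OF bounded_linear_minus[OF bounded_linear_ident]], of f g] by simp

lemma smooth_on_sum: "(\<And>i. i \<in> I \<Longrightarrow> smooth_on (f i) S) \<Longrightarrow> smooth_on (\<lambda>x. \<Sum>i\<in>I. f i x) S"
  by (simp add: smooth_on_def Ck_on_sum S)

lemma smooth_on_Pair:
  assumes "smooth_on f S" "smooth_on g S"
  shows "smooth_on (\<lambda>x. (f x, g x)) S"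
proof -
  have "smooth_on (\<lambda>x. (f x, 0) + (0, g x)) S"
    by (intro smooth_on_add smooth_on_linear[where h = "\<lambda>x. (x, 0)"] smooth_on_linear[where h = "\<lambda>x. (0, x)"] assms)
      (auto intro!: bounded_linear_Pair bounded_linear_ident bounded_linear_zero)
  then show ?thesis by simp
qed

lemma smooth_on_compose:
  fixes f :: "'b::euclidean_space \<Rightarrow> 'c::real_normed_vector" and g :: "'a \<Rightarrow> 'b"
  assumes "open T" "smooth_on f T" "smooth_on g S" "g ` S \<subseteq> T"
  shows "smooth_on (\<lambda>x. f (g x)) S"
  using assms by (simp add: smooth_on_def Ck_on_compose[OF S])

end

section \<open>Derivatives in moving directions and bounds uniform on compact sets\<close>

lemma smooth_on_derivative_apply:
  fixes f :: "'a::euclidean_space \<Rightarrow> 'c::real_normed_vector"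
  assumes S: "open S" and f: "smooth_on f S" and g: "smooth_on g S"
  shows "smooth_on (\<lambda>x. frechet_derivative f (at x) (g x)) S"
proof -
  have "smooth_on (\<lambda>x. \<Sum>b\<in>Basis. (g x \<bullet> b) *\<^sub>R frechet_derivative f (at x) b) S"
    by (intro smooth_on_sum smooth_on_scaleR S smooth_on_linear[OF S bounded_linear_inner_left] g smooth_on_derivative f)
  then show ?thesis
    using smooth_on_cong[OF S, of "\<lambda>x. frechet_derivative f (at x) (g x)"
        "\<lambda>x. \<Sum>b\<in>Basis. (g x \<bullet> b) *\<^sub>R frechet_derivative f (at x) b"]
      linear_sum_Basis[OF smooth_on_linear_derivative[OF f]] by blast
qed

lemma smooth_on_continuous_derivative:
  fixes f :: "'a::euclidean_space \<Rightarrow> 'c::real_normed_vector"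
  assumes "open S" and f: "smooth_on f S"
  shows "continuous_on (S \<times> UNIV) (\<lambda>(x, v). frechet_derivative f (at x) v)"
proof -
  have "continuous_on (S \<times> UNIV) (\<lambda>z. \<Sum>b\<in>Basis. (snd z \<bullet> b) *\<^sub>R frechet_derivative f (at (fst z)) b)"
    by (intro continuous_intros continuous_on_compose2[OF smooth_on_imp_continuous[OF smooth_on_derivative[OF f]]]) auto
  then show ?thesis
    by (rule continuous_on_cong[THEN iffD1, rotated -1])
      (auto simp: linear_sum_Basis[OF smooth_on_linear_derivative[OF f], symmetric])
qed

lemma smooth_on_vector_derivative:
  fixes f :: "real \<Rightarrow> 'a::real_normed_vector"
  assumes "smooth_on f S" "x \<in> S"
  shows "(f has_vector_derivative frechet_derivative f (at x) 1) (at x)"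
  using smooth_on_has_derivative[OF assms] smooth_on_linear_derivative[OF assms]
  by (simp add: has_vector_derivative_def linear_cmul[symmetric])

text \<open>Joint continuity bounds the derivative on \<open>C\<close> times the unit sphere, which
  is compact; homogeneity in \<open>v\<close> extends the bound to all directions.\<close>

lemma smooth_on_derivative_bound:
  fixes f :: "'a::euclidean_space \<Rightarrow> 'b::euclidean_space"
  assumes "open S" "smooth_on f S" "compact C" "C \<subseteq> S"
  obtains K where "K \<ge> 0" "\<And>x v. x \<in> C \<Longrightarrow> norm (frechet_derivative f (at x) v) \<le> K * norm v"
proof -
  have "continuous_on (C \<times> sphere 0 1) (\<lambda>(x, v). frechet_derivative f (at x) v)"
    by (rule continuous_on_subset[OF smooth_on_continuous_derivative[OF assms(1,2)]]) (use assms(4) in auto)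
  then have "compact ((\<lambda>(x, v). frechet_derivative f (at x) v) ` (C \<times> sphere 0 1))"
    by (intro compact_continuous_image compact_Times assms(3)) auto
  then obtain K where K: "\<forall>y \<in> (\<lambda>(x, v). frechet_derivative f (at x) v) ` (C \<times> sphere 0 1). norm y \<le> K"
    using compact_imp_bounded bounded_iff by metis
  show ?thesis
  proof (rule that[of "max K 0"])
    fix x v assume x: "x \<in> C"
    have lin: "linear (frechet_derivative f (at x))"
      using smooth_on_linear_derivative[OF assms(2)] assms(4) x by auto
    show "norm (frechet_derivative f (at x) v) \<le> max K 0 * norm v"
    proof (cases "v = 0")
      case True
      then show ?thesis using linear_0[OF lin] by simp
    next
      case False
      have "norm (frechet_derivative f (at x) (v /\<^sub>R norm v)) \<le> K"
        using K x False by (auto simp: image_iff intro!: bspec[OF K] bexI[of _ x])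
      then have "norm (frechet_derivative f (at x) v) / norm v \<le> K"
        by (simp add: linear_scale[OF lin] divide_inverse mult.commute)
      then have "norm (frechet_derivative f (at x) v) \<le> K * norm v" using False by (simp add: pos_divide_le_eq)
      also have "\<dots> \<le> max K 0 * norm v" by (intro mult_right_mono) auto
      finally show ?thesis .
    qed
  qed simp
qed

lemma smooth_on_lipschitz:
  fixes f :: "'a::euclidean_space \<Rightarrow> 'b::euclidean_space"
  assumes "open S" "smooth_on f S" "compact C" "convex C" "C \<subseteq> S"
  obtains L where "L \<ge> 0" "\<And>x y. x \<in> C \<Longrightarrow> y \<in> C \<Longrightarrow> norm (f x - f y) \<le> L * norm (x - y)"
proof -
  obtain L where L: "L \<ge> 0" "\<And>x v. x \<in> C \<Longrightarrow> norm (frechet_derivative f (at x) v) \<le> L * norm v"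
    using smooth_on_derivative_bound[OF assms(1,2,3,5)] by blast
  have "norm (f x - f y) \<le> L * norm (x - y)" if "x \<in> C" "y \<in> C" for x y
  proof (rule differentiable_bound[OF assms(4) _ _ that])
    show "(f has_derivative frechet_derivative f (at z)) (at z within C)" if "z \<in> C" for z
      using smooth_on_has_derivative[OF assms(2)] that assms(5) has_derivative_at_withinI by blast
    show "onorm (frechet_derivative f (at z)) \<le> L" if "z \<in> C" for z
      by (rule onorm_bound[OF L(1) L(2)[OF that]])
  qed
  with L(1) show ?thesis by (rule that)
qed

text \<open>Each partial derivative is Lipschitz on \<open>C\<close>; summed over the basis, the
  derivative is Lipschitz in operator norm with constant \<open>K\<close>. The mean value inequality
  on the segment from \<open>x\<close> to \<open>y\<close>, which lies in \<open>C\<close> by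
  convexity, gives the quadratic remainder.\<close>

lemma smooth_on_taylor_compact:
  fixes f :: "'a::euclidean_space \<Rightarrow> 'b::euclidean_space"
  assumes "open S" "smooth_on f S" "compact C" "convex C" "C \<subseteq> S"
  obtains K where "K \<ge> 0"
    "\<And>x y. x \<in> C \<Longrightarrow> y \<in> C \<Longrightarrow> norm (f y - f x - frechet_derivative f (at x) (y - x)) \<le> K * (norm (y - x))\<^sup>2"
proof -
  let ?D = "\<lambda>x. frechet_derivative f (at x)"
  have "\<exists>k\<ge>0. \<forall>z\<in>C. \<forall>x\<in>C. norm (?D z b - ?D x b) \<le> k * norm (z - x)" for b
    using smooth_on_lipschitz[OF assms(1) smooth_on_derivative[OF assms(2)] assms(3-5), of b] by metis
  then obtain k where k0: "\<And>b. k b \<ge> 0"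
    and lip: "\<And>b z x. z \<in> C \<Longrightarrow> x \<in> C \<Longrightarrow> norm (?D z b - ?D x b) \<le> k b * norm (z - x)"
    by metis
  define K where "K = (\<Sum>b\<in>(Basis::'a set). k b)"
  have K0: "K \<ge> 0" unfolding K_def by (intro sum_nonneg k0)
  have lin: "linear (?D x)" if "x \<in> C" for x
    using smooth_on_linear_derivative[OF assms(2)] assms(5) that by auto
  have opb: "norm (?D z v - ?D x v) \<le> K * norm (z - x) * norm v" if "z \<in> C" "x \<in> C" for z x v
  proof -
    have "?D z v - ?D x v = (\<Sum>b\<in>Basis. (v \<bullet> b) *\<^sub>R (?D z b - ?D x b))"
      by (subst linear_sum_Basis[OF lin[OF that(1)]], subst linear_sum_Basis[OF lin[OF that(2)]])
        (simp add: sum_subtractf scaleR_diff_right)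
    also have "norm \<dots> \<le> (\<Sum>b\<in>Basis. norm v * (k b * norm (z - x)))"
      by (intro sum_norm_le) (auto intro!: mult_mono lip that Basis_le_norm)
    also have "\<dots> = K * norm (z - x) * norm v"
      unfolding K_def by (simp add: sum_distrib_left sum_distrib_right mult_ac)
    finally show ?thesis .
  qed
  show ?thesis
  proof (rule that[OF K0])
    fix x y assume xy: "x \<in> C" "y \<in> C"
    have seg: "closed_segment x y \<subseteq> C" using assms(4) xy by (rule convex_contains_segment[THEN iffD1, rule_format])
    have "norm (f y - f x - ?D x (y - x)) \<le> norm (y - x) * (K * norm (y - x))"
    proof (rule differentiable_bound_linearization[where S = "closed_segment x y" and f' = ?D])
      show "x + t *\<^sub>R (y - x) \<in> closed_segment x y" if "t \<in> {0..1}" for t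
        using that by (auto simp: closed_segment_def algebra_simps intro!: exI[of _ t])
      show "(f has_derivative ?D i) (at i within closed_segment x y)" if "i \<in> closed_segment x y" for i
        using smooth_on_has_derivative[OF assms(2)] that seg assms(5) has_derivative_at_withinI by blast
      show "onorm (?D i - ?D x) \<le> K * norm (y - x)" if i: "i \<in> closed_segment x y" for i
      proof (rule onorm_bound)
        fix v :: 'a
        have iC: "i \<in> C" using i seg by auto
        have "norm (i - x) \<le> norm (y - x)"
          using segment_bound(1)[OF i] by (simp add: norm_minus_commute)
        then have "K * norm (i - x) * norm v \<le> K * norm (y - x) * norm v"
          by (intro mult_right_mono mult_left_mono K0) auto
        then show "norm ((?D i - ?D x) v) \<le> K * norm (y - x) * norm v"
          using opb[OF iC xy(1), of v] by simp
      qed (simp add: K0)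
    qed simp
    then show "norm (f y - f x - ?D x (y - x)) \<le> K * (norm (y - x))\<^sup>2"
      by (simp add: power2_eq_square mult_ac)
  qed
qed

section \<open>Partial derivatives of maps of two real variables\<close>

lemma smooth_on_partial_fst:
  fixes f :: "real \<times> real \<Rightarrow> 'b::real_normed_vector"
  assumes "smooth_on f S" "(r, u) \<in> S"
  shows "((\<lambda>s. f (s, u)) has_vector_derivative frechet_derivative f (at (r, u)) (1, 0)) (at r)"
proof -
  have "((\<lambda>s. (s, u)) has_derivative (\<lambda>h. (h, 0))) (at r)" by (auto intro!: derivative_eq_intros)
  from has_derivative_compose[OF this smooth_on_has_derivative[OF assms]]
  have "((\<lambda>s. f (s, u)) has_derivative (\<lambda>h. frechet_derivative f (at (r, u)) (h, 0))) (at r)" .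
  moreover have eq: "frechet_derivative f (at (r, u)) (h, 0) = h *\<^sub>R frechet_derivative f (at (r, u)) (1, 0)" for h
    by (simp flip: linear_scale[OF smooth_on_linear_derivative[OF assms]])
  ultimately show ?thesis unfolding has_vector_derivative_def by (subst (asm) eq)
qed

lemma smooth_on_partial_snd:
  fixes f :: "real \<times> real \<Rightarrow> 'b::real_normed_vector"
  assumes "smooth_on f S" "(r, u) \<in> S"
  shows "((\<lambda>u. f (r, u)) has_vector_derivative frechet_derivative f (at (r, u)) (0, 1)) (at u)"
proof -
  have "((\<lambda>u. (r, u)) has_derivative (\<lambda>h. (0, h))) (at u)" by (auto intro!: derivative_eq_intros)
  from has_derivative_compose[OF this smooth_on_has_derivative[OF assms]]
  have "((\<lambda>u. f (r, u)) has_derivative (\<lambda>h. frechet_derivative f (at (r, u)) (0, h))) (at u)" .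
  moreover have eq: "frechet_derivative f (at (r, u)) (0, h) = h *\<^sub>R frechet_derivative f (at (r, u)) (0, 1)" for h
    by (simp flip: linear_scale[OF smooth_on_linear_derivative[OF assms]])
  ultimately show ?thesis unfolding has_vector_derivative_def by (subst (asm) eq)
qed

text \<open>Write the increment of \<open>X (r, u)\<close> in \<open>u\<close> as the integral of
  the \<open>t\<close>-derivative. Differentiating under the integral sign in \<open>r\<close>
  expresses the increment of the \<open>s\<close>-derivative as an integral, and the fundamental
  theorem differentiates that in \<open>u\<close>.\<close>

lemma mixed_partials:
  fixes X :: "real \<times> real \<Rightarrow> 'b::euclidean_space"
  assumes "open S" "smooth_on X S" "(s, t) \<in> S"
  shows "((\<lambda>t. frechet_derivative X (at (s, t)) (1, 0)) has_vector_derivative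
    frechet_derivative (\<lambda>z. frechet_derivative X (at z) (0, 1)) (at (s, t)) (1, 0)) (at t)"
proof -
  let ?Xs = "\<lambda>z. frechet_derivative X (at z) (1, 0)"
  let ?Xt = "\<lambda>z. frechet_derivative X (at z) (0, 1)"
  let ?Xts = "\<lambda>z. frechet_derivative ?Xt (at z) (1, 0)"
  obtain A B where AB: "open A" "open B" "(s, t) \<in> A \<times> B" "A \<times> B \<subseteq> S"
    using assms(1,3) by (metis open_prod_elim)
  obtain e where e: "e > 0" "cball s e \<subseteq> A" using AB open_contains_cball by (metis mem_Times_iff fst_conv)
  obtain d where d: "d > 0" "cball t d \<subseteq> B" using AB open_contains_cball by (metis mem_Times_iff snd_conv)
  let ?a = "t - d" and ?b = "t + d"
  have Bab: "{?a..?b} \<subseteq> B" using d(2) by (simp add: cball_eq_atLeastAtMost)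
  have U: "cball s e \<times> {?a..?b} \<subseteq> S" using e(2) Bab AB(4) by auto
  have smt: "smooth_on ?Xt S" "smooth_on ?Xts S" using assms(2) smooth_on_derivative by blast+
  note ds = smooth_on_partial_fst and dt = smooth_on_partial_snd
  have ts: "continuous_on {?a..?b} (\<lambda>u. ?Xts (s, u))"
    by (rule continuous_on_compose2[OF smooth_on_imp_continuous[OF smt(2)]]) (use U e in \<open>auto intro!: continuous_intros\<close>)
  have main: "?Xs (s, u) - ?Xs (s, ?a) = integral {?a..u} (\<lambda>u. ?Xts (s, u))" if u: "u \<in> {?a..?b}" for u
  proof -
    have uU: "cball s e \<times> {?a..u} \<subseteq> S" using u U by auto
    have eq: "X (r, u) - X (r, ?a) = integral (cbox ?a u) (\<lambda>v. ?Xt (r, v))" if "r \<in> cball s e" for r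
    proof -
      have "((\<lambda>v. ?Xt (r, v)) has_integral X (r, u) - X (r, ?a)) {?a..u}"
        using u uU that
        by (intro fundamental_theorem_of_calculus has_vector_derivative_at_within[OF dt[OF assms(2)]]) auto
      then show ?thesis by (simp add: integral_unique)
    qed
    have "((\<lambda>r. integral (cbox ?a u) (\<lambda>v. ?Xt (r, v))) has_vector_derivative integral (cbox ?a u) (\<lambda>v. ?Xts (s, v))) (at s within cball s e)"
    proof (rule leibniz_rule_vector_derivative)
      show "((\<lambda>r. ?Xt (r, v)) has_vector_derivative ?Xts (r, v)) (at r within cball s e)"
        if "r \<in> cball s e" "v \<in> cbox ?a u" for r v
        using that uU by (intro has_vector_derivative_at_within[OF ds[OF smt(1)]]) auto
      show "(\<lambda>v. ?Xt (r, v)) integrable_on cbox ?a u" if "r \<in> cball s e" for r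
        unfolding cbox_interval
        by (intro integrable_continuous_interval continuous_on_compose2[OF smooth_on_imp_continuous[OF smt(1)]])
          (use uU that in \<open>auto intro!: continuous_intros\<close>)
      show "continuous_on (cball s e \<times> cbox ?a u) (\<lambda>(r, v). ?Xts (r, v))"
        using continuous_on_subset[OF smooth_on_imp_continuous[OF smt(2)] uU] by (simp add: case_prod_unfold)
    qed (use e in auto)
    moreover have "((\<lambda>r. X (r, u) - X (r, ?a)) has_vector_derivative ?Xs (s, u) - ?Xs (s, ?a)) (at s within cball s e)"
      by (intro has_vector_derivative_diff has_vector_derivative_at_within[OF ds[OF assms(2)]])
        (use u U e d in auto)
    then have "((\<lambda>r. integral (cbox ?a u) (\<lambda>v. ?Xt (r, v))) has_vector_derivative ?Xs (s, u) - ?Xs (s, ?a)) (at s within cball s e)"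
      by (rule has_vector_derivative_transform[rotated 2]) (use eq e in auto)
    moreover have "at s within cball s e = at s" using e(1) by (intro at_within_interior) simp
    ultimately have "((\<lambda>r. integral (cbox ?a u) (\<lambda>v. ?Xt (r, v))) has_vector_derivative integral (cbox ?a u) (\<lambda>v. ?Xts (s, v))) (at s)"
      "((\<lambda>r. integral (cbox ?a u) (\<lambda>v. ?Xt (r, v))) has_vector_derivative ?Xs (s, u) - ?Xs (s, ?a)) (at s)"
      by simp_all
    from vector_derivative_unique_at[OF this] show ?thesis by simp
  qed
  have "((\<lambda>u. integral {?a..u} (\<lambda>u. ?Xts (s, u))) has_vector_derivative ?Xts (s, t)) (at t within {?a..?b})"
    using d(1) by (intro integral_has_vector_derivative ts) auto
  then have "((\<lambda>u. integral {?a..u} (\<lambda>u. ?Xts (s, u)) + ?Xs (s, ?a)) has_vector_derivative ?Xts (s, t)) (at t within {?a..?b})"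
    by (auto intro!: derivative_eq_intros)
  then have "((\<lambda>u. ?Xs (s, u)) has_vector_derivative ?Xts (s, t)) (at t within {?a..?b})"
  proof (rule has_vector_derivative_transform[rotated 2])
    show "?Xs (s, u) = integral {?a..u} (\<lambda>u. ?Xts (s, u)) + ?Xs (s, ?a)" if "u \<in> {?a..?b}" for u
      unfolding main[OF that, symmetric] by simp
  qed (use d(1) in auto)
  moreover have "at t within {?a..?b} = at t" using d(1) by (intro at_within_interior) auto
  ultimately show ?thesis by simp
qed

section \<open>Smooth dependence of the solution of a linear system on parameters\<close>

lemma coercive_on_compact:
  fixes M :: "'a::topological_space \<Rightarrow> 'e::euclidean_space \<Rightarrow> 'e"
  assumes C: "compact C" and lin: "\<And>x. x \<in> C \<Longrightarrow> linear (M x)"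
    and M: "\<And>u. continuous_on C (\<lambda>x. M x u)"
    and pos: "\<And>x u. x \<in> C \<Longrightarrow> u \<noteq> 0 \<Longrightarrow> M x u \<bullet> u > 0"
  obtains \<mu> where "\<mu> > 0" "\<And>x u. x \<in> C \<Longrightarrow> \<mu> * norm u \<le> norm (M x u)"
proof (cases "C = {}")
  case True
  then show ?thesis using that[of 1] by simp
next
  case False
  let ?C = "C \<times> sphere (0::'e) 1"
  \<comment> \<open>Continuity is assumed for each fixed \<open>u\<close>; the basis expansion makes
    the quadratic form \<open>M x u \<bullet> u\<close> jointly continuous. Its minimum over
    \<open>C\<close> times the sphere is \<open>\<mu>\<close>, and Cauchy-Schwarz turns it into a
    bound for the inverse of \<open>M x\<close>.\<close>
  have "continuous_on ?C (\<lambda>z. (\<Sum>b\<in>Basis. (snd z \<bullet> b) *\<^sub>R M (fst z) b) \<bullet> snd z)"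
    by (intro continuous_intros continuous_on_compose2[OF M]) auto
  then have "\<exists>z0\<in>?C. \<forall>z\<in>?C.
      (\<Sum>b\<in>Basis. (snd z0 \<bullet> b) *\<^sub>R M (fst z0) b) \<bullet> snd z0 \<le> (\<Sum>b\<in>Basis. (snd z \<bullet> b) *\<^sub>R M (fst z) b) \<bullet> snd z"
    using False C by (intro continuous_attains_inf compact_Times compact_sphere) auto
  then obtain z0 where z0: "z0 \<in> ?C" "\<And>z. z \<in> ?C \<Longrightarrow>
      (\<Sum>b\<in>Basis. (snd z0 \<bullet> b) *\<^sub>R M (fst z0) b) \<bullet> snd z0 \<le> (\<Sum>b\<in>Basis. (snd z \<bullet> b) *\<^sub>R M (fst z) b) \<bullet> snd z"
    by blast
  define \<mu> where "\<mu> = (\<Sum>b\<in>Basis. (snd z0 \<bullet> b) *\<^sub>R M (fst z0) b) \<bullet> snd z0"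
  have \<mu>: "\<mu> \<le> M x u \<bullet> u" if "x \<in> C" "norm u = 1" for x u
    using z0(2)[of "(x, u)"] that linear_sum_Basis[OF lin, of x u] by (auto simp: \<mu>_def)
  have z0S: "fst z0 \<in> C" "snd z0 \<noteq> 0" using z0(1) by auto
  have "\<mu> = M (fst z0) (snd z0) \<bullet> snd z0"
    unfolding \<mu>_def using linear_sum_Basis[OF lin[OF z0S(1)], of "snd z0"] by simp
  then have "\<mu> > 0" using pos[OF z0S] by simp
  moreover have "\<mu> * norm u \<le> norm (M x u)" if x: "x \<in> C" for x u
  proof (cases "u = 0")
    case False
    have "\<mu> \<le> M x (u /\<^sub>R norm u) \<bullet> (u /\<^sub>R norm u)" using x False by (intro \<mu>) auto
    also have "\<dots> \<le> norm (M x (u /\<^sub>R norm u)) * norm (u /\<^sub>R norm u)" by (rule norm_cauchy_schwarz)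
    also have "\<dots> = norm (M x u) / norm u"
      using False lin[OF x] by (simp add: linear_scale divide_inverse mult.commute)
    finally show ?thesis using False by (simp add: pos_le_divide_eq)
  qed simp
  ultimately show ?thesis by (rule that)
qed

text \<open>Differentiating \<open>M x (G x) = R x\<close> gives a system with the same
  \<open>M\<close> for the derivative of \<open>G\<close>. Its right-hand side involves
  \<open>G\<close> and first derivatives of \<open>R\<close> and \<open>M\<close>, so it is of class
  \<open>k\<close> once \<open>G\<close> is. The induction therefore runs over all \<open>R\<close>
  and \<open>G\<close>.\<close>

lemma Ck_on_solve_linear:
  fixes M :: "'a::euclidean_space \<Rightarrow> 'e::euclidean_space \<Rightarrow> 'e"
  assumes S: "open S" and lin: "\<And>x. x \<in> S \<Longrightarrow> linear (M x)"
    and M: "\<And>u. smooth_on (\<lambda>x. M x u) S"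
    and pos: "\<And>x u. x \<in> S \<Longrightarrow> u \<noteq> 0 \<Longrightarrow> M x u \<bullet> u > 0"
    and R: "Ck_on k R S" and G: "\<And>x. x \<in> S \<Longrightarrow> M x (G x) = R x"
  shows "Ck_on k G S"
  using R G
proof (induction k arbitrary: R G)
  have coercive: "\<exists>\<mu>>0. \<forall>\<^sub>F x in nhds a. \<forall>u. \<mu> * norm u \<le> norm (M x u)" if a: "a \<in> S" for a
  proof -
    obtain r where r: "r > 0" "cball a r \<subseteq> S" using S a open_contains_cball by blast
    obtain \<mu> where \<mu>: "\<mu> > 0" "\<And>x u. x \<in> cball a r \<Longrightarrow> \<mu> * norm u \<le> norm (M x u)"
    proof (rule coercive_on_compact[of "cball a r" M])
      show "continuous_on (cball a r) (\<lambda>x. M x u)" for u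
        using continuous_on_subset[OF smooth_on_imp_continuous[OF M] r(2)] .
    qed (use r(2) lin pos in auto)
    have "\<forall>\<^sub>F x in nhds a. \<forall>u. \<mu> * norm u \<le> norm (M x u)"
      using eventually_nhds_in_open[of "ball a r" a] r(1) by (auto elim!: eventually_mono intro: \<mu>(2))
    with \<mu>(1) show ?thesis by blast
  qed
  {
    case 0
    have "isCont G a" if a: "a \<in> S" for a
    proof -
      obtain \<mu> where \<mu>: "\<mu> > 0" "\<forall>\<^sub>F x in nhds a. \<forall>u. \<mu> * norm u \<le> norm (M x u)" using coercive[OF a] by blast
      let ?h = "\<lambda>x. R x - M x (G a)"
      have "isCont R a" using 0(1) a S by (simp add: continuous_on_eq_continuous_at)
      moreover have "isCont (\<lambda>x. M x (G a)) a" using smooth_on_imp_continuous[OF M] a S by (simp add: continuous_on_eq_continuous_at)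
      ultimately have "isCont (\<lambda>x. norm (?h x) / \<mu>) a" using \<mu>(1) by (intro continuous_intros) auto
      then have lim: "((\<lambda>x. norm (?h x) / \<mu>) \<longlongrightarrow> 0) (at a)" using 0(2)[OF a] by (simp add: isCont_def)
      have "\<forall>\<^sub>F x in at a. norm (G x - G a) \<le> norm (?h x) / \<mu>"
        using eventually_nhds_in_open[OF S a] \<mu>(2) unfolding eventually_at_filter
      proof eventually_elim
        case (elim x)
        have "M x (G x - G a) = ?h x" using elim 0(2) by (simp add: linear_diff[OF lin])
        then show ?case using elim(2)[rule_format, of "G x - G a"] \<mu>(1) by (simp add: pos_le_divide_eq mult.commute)
      qed
      from Lim_null_comparison[OF this lim] show ?thesis
        by (simp add: isCont_def LIM_zero_iff)
    qed
    then show ?case by (simp add: continuous_at_imp_continuous_on)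
  next
    case (Suc k)
    have CkG: "Ck_on k G S" by (rule Suc.IH[OF Ck_on_Suc_D[OF Suc.prems(1)] Suc.prems(2)])
    let ?DM = "\<lambda>b x. frechet_derivative (\<lambda>x. M x b) (at x)"
    \<comment> \<open>Right-hand side of the differentiated system; its solution \<open>G'\<close>
      is the candidate for the derivative of \<open>G\<close>.\<close>
    define h' where "h' x v = frechet_derivative R (at x) v - (\<Sum>b\<in>Basis. (G x \<bullet> b) *\<^sub>R ?DM b x v)" for x v
    define G' where "G' x v = inv (M x) (h' x v)" for x v
    have inj: "inj (M x)" if "x \<in> S" for x
      using pos[OF that] by (subst linear_injective_0[OF lin[OF that]]) force
    have MG': "M x (G' x v) = h' x v" if "x \<in> S" for x v
      unfolding G'_def using linear_injective_imp_surjective[OF lin[OF that] inj[OF that]]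
      by (simp add: surj_f_inv_f)
    have DR: "(R has_derivative frechet_derivative R (at x)) (at x)" if "x \<in> S" for x
      using Ck_on_has_derivative[OF Suc.prems(1) that] .
    have h'l: "bounded_linear (h' x)" if "x \<in> S" for x
      unfolding h'_def
      using DR[OF that] smooth_on_has_derivative[OF M that]
      by (intro bounded_linear_sub bounded_linear_sum bounded_linear_const_scaleR) (auto dest: has_derivative_bounded_linear)
    have G'l: "linear (G' x)" if "x \<in> S" for x
    proof (rule linearI)
      fix v w and c :: real
      have "M x (G' x (v + w)) = M x (G' x v + G' x w)"
        using linear_add[OF lin[OF that]] MG'[OF that] linear_add[OF bounded_linear.linear[OF h'l[OF that]]] by simp
      then show "G' x (v + w) = G' x v + G' x w" using inj[OF that] by (simp add: inj_eq)
      have "M x (G' x (c *\<^sub>R v)) = M x (c *\<^sub>R G' x v)"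
        using linear_scale[OF lin[OF that]] MG'[OF that] linear_scale[OF bounded_linear.linear[OF h'l[OF that]]] by simp
      then show "G' x (c *\<^sub>R v) = c *\<^sub>R G' x v" using inj[OF that] by (simp add: inj_eq)
    qed
    have der: "(G has_derivative G' a) (at a)" if a: "a \<in> S" for a
    proof -
      obtain \<mu> where \<mu>: "\<mu> > 0" "\<forall>\<^sub>F x in nhds a. \<forall>u. \<mu> * norm u \<le> norm (M x u)" using coercive[OF a] by blast
      let ?h = "\<lambda>x. R x - M x (G a)"
      have Mb: "M x (G a) = (\<Sum>b\<in>Basis. (G a \<bullet> b) *\<^sub>R M x b)" if "x \<in> S" for x
        using linear_sum_Basis[OF lin[OF that]] .
      have "((\<lambda>x. R x - (\<Sum>b\<in>Basis. (G a \<bullet> b) *\<^sub>R M x b)) has_derivative h' a) (at a)"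
        unfolding h'_def
        by (intro has_derivative_diff has_derivative_sum has_derivative_scaleR_right DR[OF a] smooth_on_has_derivative[OF M a])
      then have hd: "(?h has_derivative h' a) (at a)"
        by (rule has_derivative_transform_within_open[OF _ S a]) (simp add: Mb)
      have h0: "?h a = 0" using Suc.prems(2)[OF a] by simp
      have l1: "((\<lambda>x. norm (?h x - h' a (x - a)) / norm (x - a)) \<longlongrightarrow> 0) (at a)"
        using hd h0 unfolding has_derivative_iff_norm by simp
      obtain B where B: "\<And>v. norm (G' a v) \<le> B * norm v" "B > 0"
        using linear_bounded_pos[OF G'l[OF a]] by blast
      have l2: "((\<lambda>x. \<Sum>b\<in>Basis. norm (M x b - M a b)) \<longlongrightarrow> (\<Sum>b\<in>(Basis::'e set). 0)) (at a)"
      proof (rule tendsto_sum)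
        fix b
        have "isCont (\<lambda>x. M x b) a" using smooth_on_imp_continuous[OF M] a S by (simp add: continuous_on_eq_continuous_at)
        then show "((\<lambda>x. norm (M x b - M a b)) \<longlongrightarrow> 0) (at a)"
          by (simp add: isCont_def tendsto_norm_zero_iff LIM_zero_iff)
      qed
      let ?bd = "\<lambda>x. (norm (?h x - h' a (x - a)) / norm (x - a) + B * (\<Sum>b\<in>Basis. norm (M x b - M a b))) / \<mu>"
      have "(?bd \<longlongrightarrow> (0 + B * (\<Sum>b\<in>(Basis::'e set). 0)) / \<mu>) (at a)"
        using \<mu>(1) by (intro tendsto_intros l1 l2) auto
      then have lim: "(?bd \<longlongrightarrow> 0) (at a)" by simp
      have "\<forall>\<^sub>F x in nhds a. x \<noteq> a \<longrightarrow> norm (norm (G x - G a - G' a (x - a)) / norm (x - a)) \<le> ?bd x"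
        using eventually_nhds_in_open[OF S a] \<mu>(2)
      proof eventually_elim
        case (elim x)
        let ?v = "G' a (x - a)"
        \<comment> \<open>Applying \<open>M x\<close> splits the remainder of \<open>G\<close>: the
          first bracket is the first-order remainder of \<open>R x - M x (G a)\<close>, the second
          is small because \<open>M x\<close> tends to \<open>M a\<close>. Coercivity carries the
          estimates back.\<close>
        have e1: "M x (G x - G a - ?v) = (?h x - h' a (x - a)) + (M a ?v - M x ?v)"
          using elim Suc.prems(2) MG'[OF a] by (simp add: linear_diff[OF lin])
        have "M a ?v - M x ?v = (\<Sum>b\<in>Basis. (?v \<bullet> b) *\<^sub>R (M a b - M x b))"
          by (subst linear_sum_Basis[OF lin[OF a]], subst linear_sum_Basis[OF lin[OF elim(1)]])
            (simp add: sum_subtractf scaleR_diff_right)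
        also have "norm \<dots> \<le> (\<Sum>b\<in>Basis. norm ?v * norm (M x b - M a b))"
          by (intro sum_norm_le) (auto intro!: mult_mono Basis_le_norm simp: norm_minus_commute)
        also have "\<dots> \<le> B * norm (x - a) * (\<Sum>b\<in>Basis. norm (M x b - M a b))"
          unfolding sum_distrib_left[symmetric] by (intro mult_right_mono B sum_nonneg) auto
        finally have e2: "norm (M a ?v - M x ?v) \<le> B * norm (x - a) * (\<Sum>b\<in>Basis. norm (M x b - M a b))" .
        have "\<mu> * norm (G x - G a - ?v) \<le> norm ((?h x - h' a (x - a)) + (M a ?v - M x ?v))"
          using elim(2)[rule_format, of "G x - G a - ?v"] e1 by simp
        also have "\<dots> \<le> norm (?h x - h' a (x - a)) + B * norm (x - a) * (\<Sum>b\<in>Basis. norm (M x b - M a b))"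
          using norm_triangle_ineq e2 by (meson add_left_mono order_trans)
        finally show ?case using \<mu>(1) by (auto simp: field_simps)
      qed
      then have "\<forall>\<^sub>F x in at a. norm (norm (G x - G a - G' a (x - a)) / norm (x - a)) \<le> ?bd x"
        by (simp add: eventually_at_filter)
      from Lim_null_comparison[OF this lim] show ?thesis
        unfolding has_derivative_iff_norm using G'l[OF a] by (simp add: linear_conv_bounded_linear)
    qed
    have "Ck_on k (\<lambda>x. G' x v) S" for v
    proof (rule Suc.IH)
      show "M x (G' x v) = h' x v" if "x \<in> S" for x by (rule MG'[OF that])
      have "Ck_on k (\<lambda>x. frechet_derivative R (at x) v + (\<Sum>b\<in>Basis. (- (G x \<bullet> b)) *\<^sub>R ?DM b x v)) S"
        using Suc.prems(1) smooth_on_derivative[OF M]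
        by (intro Ck_on_add Ck_on_sum S Ck_on_bilinear[OF S bounded_bilinear_scaleR]
            Ck_on_linear[OF S bounded_linear_minus[OF bounded_linear_inner_left]] CkG)
          (auto simp: smooth_on_def)
      then show "Ck_on k (\<lambda>x. h' x v) S" by (simp add: h'_def sum_negf)
    qed
    with der show ?case by (rule Ck_on_SucI[OF S])
  }
qed

lemma smooth_on_solve_linear:
  fixes M :: "'a::euclidean_space \<Rightarrow> 'e::euclidean_space \<Rightarrow> 'e"
  assumes "open S" "\<And>x. x \<in> S \<Longrightarrow> linear (M x)" "\<And>u. smooth_on (\<lambda>x. M x u) S"
    "\<And>x u. x \<in> S \<Longrightarrow> u \<noteq> 0 \<Longrightarrow> M x u \<bullet> u > 0"
    "smooth_on R S" "\<And>x. x \<in> S \<Longrightarrow> M x (G x) = R x"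
  shows "smooth_on G S"
  using Ck_on_solve_linear[OF assms(1-4) _ assms(6)] assms(5) unfolding smooth_on_def by blast

section \<open>Ordinary differential equations\<close>

text \<open>The difference stands for the oriented integral from 0 to \<open>t\<close>; for negative
  \<open>t\<close> the integral over \<open>{0..t}\<close> would be zero.\<close>

lemma integral_bound_from_0:
  fixes g :: "real \<Rightarrow> 'a::euclidean_space"
  assumes g: "continuous_on {-T..T} g" and B: "\<And>s. s \<in> {-T..T} \<Longrightarrow> norm (g s) \<le> B" "B \<ge> 0"
    and t: "t \<in> {-T..T}" "0 \<in> {-T..T}"
  shows "norm (integral {-T..t} g - integral {-T..0} g) \<le> B * \<bar>t\<bar>"
proof -
  have "norm (integral {-T..t} g - integral {-T..0} g) \<le> B * norm (t - 0)"
  proof (rule differentiable_bound[where S = "{-T..T}" and f' = "\<lambda>s h. h *\<^sub>R g s"])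
    show "((\<lambda>u. integral {-T..u} g) has_derivative (\<lambda>h. h *\<^sub>R g s)) (at s within {-T..T})" if "s \<in> {-T..T}" for s
      using integral_has_vector_derivative[OF g that] by (simp add: has_vector_derivative_def)
    show "onorm (\<lambda>h. h *\<^sub>R g s) \<le> B" if "s \<in> {-T..T}" for s
    proof (rule onorm_bound[OF B(2)])
      show "norm (h *\<^sub>R g s) \<le> B * norm h" for h
        using mult_right_mono[OF B(1)[OF that] abs_ge_zero[of h]] by (simp add: mult.commute)
    qed
  qed (use t in auto)
  then show ?thesis by simp
qed

text \<open>The Picard operator on bounded continuous functions is a contraction with factor
  \<open>L * T \<le> 1/2\<close>. The admissible \<open>T\<close> depends on \<open>L\<close> alone,
  not on the initial value.\<close>

lemma picard_lindelof:
  fixes X :: "'a::euclidean_space \<Rightarrow> 'a"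
  assumes lip: "\<And>x y. norm (X x - X y) \<le> L * norm (x - y)" and L: "L \<ge> 0"
    and bd: "\<And>x. norm (X x) \<le> B" and T: "T > 0" "L * T \<le> 1/2"
  obtains z where "z 0 = u" "\<And>t. t \<in> {-T<..<T} \<Longrightarrow> (z has_vector_derivative X (z t)) (at t)"
    "\<And>t. t \<in> {-T<..<T} \<Longrightarrow> norm (z t - u) \<le> B * \<bar>t\<bar>"
proof -
  have B0: "B \<ge> 0" using bd[of 0] norm_ge_zero order_trans by blast
  have contX: "continuous_on UNIV X"
    using lip L by (intro lipschitz_on_continuous_on[where L = L]) (auto simp: lipschitz_on_def dist_norm)
  \<comment> \<open>Freezing time outside \<open>{-T..T}\<close> makes the iterates bounded
    continuous functions on the whole line, a complete space to which the fixed point theorem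
    applies.\<close>
  define cl where "cl t = max (-T) (min T t)" for t
  have cl: "cl t \<in> {-T..T}" for t using T by (auto simp: cl_def)
  have contcl: "continuous_on UNIV cl" unfolding cl_def by (intro continuous_intros)
  define P where "P z t = u + integral {-T..cl t} (\<lambda>s. X (z s)) - integral {-T..0} (\<lambda>s. X (z s))" for z t
  have contXz: "continuous_on A (\<lambda>s. X (apply_bcontfun z s))" for z A
    by (rule continuous_on_compose2[OF contX]) (auto intro: continuous_on_apply_bcontfun)
  have Pbc: "P (apply_bcontfun z) \<in> bcontfun" for z
  proof (rule bcontfun_normI)
    have "continuous_on UNIV (\<lambda>t. integral {-T..cl t} (\<lambda>s. X (apply_bcontfun z s)))"
      by (rule continuous_on_compose2[OF indefinite_integral_continuous_1[where b = T] contcl])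
        (use cl in \<open>auto intro!: integrable_continuous_interval contXz\<close>)
    then show "continuous_on UNIV (P (apply_bcontfun z))" unfolding P_def by (intro continuous_intros) auto
    fix t
    have "norm (integral {-T..cl t} (\<lambda>s. X (z s)) - integral {-T..0} (\<lambda>s. X (z s))) \<le> B * \<bar>cl t\<bar>"
      by (rule integral_bound_from_0[OF contXz bd B0 cl]) (use T in auto)
    also have "\<dots> \<le> B * T" using cl[of t] B0 by (intro mult_left_mono) auto
    finally show "norm (P (apply_bcontfun z) t) \<le> norm u + B * T"
      unfolding P_def using norm_triangle_ineq[of u "integral {-T..cl t} (\<lambda>s. X (z s)) - integral {-T..0} (\<lambda>s. X (z s))"]
      by (simp add: algebra_simps)
  qed
  define \<Phi> where "\<Phi> z = Bcontfun (P (apply_bcontfun z))" for z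
  have \<Phi>: "apply_bcontfun (\<Phi> z) = P (apply_bcontfun z)" for z unfolding \<Phi>_def by (rule Bcontfun_inverse[OF Pbc])
  have "\<exists>!z. \<Phi> z = z"
  proof (rule banach_fix_type[of "1/2"])
    show "\<forall>z w. dist (\<Phi> z) (\<Phi> w) \<le> 1/2 * dist z w"
    proof (intro allI dist_bound)
      fix z w :: "real \<Rightarrow>\<^sub>C 'a" and t :: real
      let ?g = "\<lambda>s::real. X (apply_bcontfun z s) - X (apply_bcontfun w s)"
      have gint: "integral {-T..v} ?g = integral {-T..v} (\<lambda>s. X (z s)) - integral {-T..v} (\<lambda>s. X (w s))" for v
        by (intro integral_diff integrable_continuous_interval contXz)
      have "norm (integral {-T..cl t} ?g - integral {-T..0} ?g) \<le> L * dist z w * \<bar>cl t\<bar>"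
      proof (rule integral_bound_from_0[OF _ _ _ cl])
        show "continuous_on {-T..T} ?g" by (intro continuous_intros contXz)
        show "norm (?g s) \<le> L * dist z w" for s
          using order_trans[OF lip mult_left_mono[OF dist_bounded[of z s w, unfolded dist_norm] L]] by (simp add: dist_norm)
      qed (use T L in auto)
      also have "\<dots> \<le> L * dist z w * T" using cl[of t] L by (intro mult_left_mono) auto
      also have "\<dots> = (L * T) * dist z w" by simp
      also have "\<dots> \<le> 1/2 * dist z w" by (intro mult_right_mono T) auto
      finally show "dist (\<Phi> z t) (\<Phi> w t) \<le> 1/2 * dist z w"
        unfolding \<Phi> P_def gint by (simp add: dist_norm algebra_simps)
    qed
  qed auto
  then obtain z where z: "\<Phi> z = z" by blast
  have zt: "z t = u + integral {-T..cl t} (\<lambda>s. X (z s)) - integral {-T..0} (\<lambda>s. X (z s))" for t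
    using \<Phi>[of z] unfolding z P_def by metis
  show ?thesis
  proof (rule that[of "apply_bcontfun z"])
    have "cl 0 = 0" using T by (simp add: cl_def)
    then show "z 0 = u" using zt[of 0] by simp
    fix t assume t: "t \<in> {-T<..<T}"
    have clt: "cl t = t" using t by (auto simp: cl_def)
    have "norm (integral {-T..cl t} (\<lambda>s. X (z s)) - integral {-T..0} (\<lambda>s. X (z s))) \<le> B * \<bar>cl t\<bar>"
      by (rule integral_bound_from_0[OF contXz bd B0 cl]) (use T in auto)
    then show "norm (z t - u) \<le> B * \<bar>t\<bar>" unfolding zt[of t] clt by (simp add: add_diff_eq[symmetric])
    have "((\<lambda>t. integral {-T..t} (\<lambda>s. X (z s))) has_vector_derivative X (z t)) (at t within {-T..T})"
      using t by (intro integral_has_vector_derivative contXz) auto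
    moreover have "at t within {-T..T} = at t" using t by (intro at_within_interior) auto
    ultimately have "((\<lambda>t. integral {-T..t} (\<lambda>s. X (z s))) has_vector_derivative X (z t)) (at t)" by simp
    then have "((\<lambda>t. u + integral {-T..t} (\<lambda>s. X (z s)) - integral {-T..0} (\<lambda>s. X (z s))) has_vector_derivative X (z t)) (at t)"
      by (auto intro!: derivative_eq_intros)
    then show "(apply_bcontfun z has_vector_derivative X (z t)) (at t)"
    proof (rule has_vector_derivative_transform_within_open[OF _ open_greaterThanLessThan t])
      fix s assume "s \<in> {-T<..<T}"
      then have "cl s = s" by (auto simp: cl_def)
      then show "u + integral {-T..s} (\<lambda>s. X (z s)) - integral {-T..0} (\<lambda>s. X (z s)) = z s" using zt[of s] by simp
    qed
  qed
qed

text \<open>One time \<open>T\<close> serves all initial values in the half ball. This uniformity is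
  one source of the locally uniform bound on the cut time.\<close>

lemma ode_exists:
  fixes X :: "'a::euclidean_space \<Rightarrow> 'a"
  assumes S: "open S" and X: "smooth_on X S" and r: "r > 0" "cball z0 r \<subseteq> S"
  obtains T where "T > 0"
    "\<And>u. u \<in> cball z0 (r/2) \<Longrightarrow> \<exists>z. z 0 = u \<and>
      (\<forall>t\<in>{-T<..<T}. (z has_vector_derivative X (z t)) (at t) \<and> z t \<in> cball z0 r)"
proof -
  let ?C = "cball z0 r"
  obtain L where L: "L \<ge> 0" "\<And>x y. x \<in> ?C \<Longrightarrow> y \<in> ?C \<Longrightarrow> norm (X x - X y) \<le> L * norm (x - y)"
    using smooth_on_lipschitz[OF S X compact_cball convex_cball r(2)] by blast
  have "compact (X ` ?C)"
    using continuous_on_subset[OF smooth_on_imp_continuous[OF X] r(2)] by (intro compact_continuous_image) auto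
  then obtain B where B: "B > 0" "\<And>x. x \<in> ?C \<Longrightarrow> norm (X x) \<le> B"
    using compact_imp_bounded bounded_pos by (metis imageI)
  \<comment> \<open>Projection to the ball is 1-Lipschitz, so \<open>Y\<close> extends
    \<open>X\<close> from the ball to the whole space with the same constants \<open>L\<close> and
    \<open>B\<close>.\<close>
  define Y where "Y x = X (closest_point ?C x)" for x
  have cp: "closest_point ?C x \<in> ?C" for x using r by (intro closest_point_in_set) auto
  have Ylip: "norm (Y x - Y y) \<le> L * norm (x - y)" for x y
  proof -
    have "norm (Y x - Y y) \<le> L * norm (closest_point ?C x - closest_point ?C y)"
      unfolding Y_def by (intro L cp)
    also have "\<dots> \<le> L * norm (x - y)"
      using closest_point_lipschitz[of ?C x y] r by (intro mult_left_mono L) (auto simp: dist_norm)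
    finally show ?thesis .
  qed
  have Ybd: "norm (Y x) \<le> B" for x unfolding Y_def by (intro B cp)
  \<comment> \<open>The first bound gives \<open>L * T \<le> 1/2\<close>, with \<open>L + 1\<close>
    because \<open>L\<close> may be zero. The second keeps a solution that starts in the half ball
    inside the ball, where \<open>Y\<close> and \<open>X\<close> agree.\<close>
  define T where "T = min (1 / (2 * (L + 1))) (r / (2 * B))"
  have T: "T > 0" "B * T \<le> r / 2" unfolding T_def using L B r by (auto simp: min_def field_simps)
  have "L * T \<le> L * (1 / (2 * (L + 1)))" unfolding T_def using L by (intro mult_left_mono) auto
  also have "\<dots> \<le> 1/2" using L by (simp add: field_simps)
  finally have LT: "L * T \<le> 1/2" .
  show ?thesis
  proof (rule that[OF T(1)])
    fix u assume u: "u \<in> cball z0 (r/2)"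
    obtain z where z: "z 0 = u" "\<And>t. t \<in> {-T<..<T} \<Longrightarrow> (z has_vector_derivative Y (z t)) (at t)"
      "\<And>t. t \<in> {-T<..<T} \<Longrightarrow> norm (z t - u) \<le> B * \<bar>t\<bar>"
      using picard_lindelof[OF Ylip L(1) Ybd T(1) LT] by metis
    have zC: "z t \<in> ?C" if t: "t \<in> {-T<..<T}" for t
    proof -
      have "norm (z t - u) \<le> B * \<bar>t\<bar>" by (rule z(3)[OF t])
      also have "\<dots> \<le> B * T" using t B(1) by (intro mult_left_mono) auto
      also have "\<dots> \<le> r / 2" by (rule T)
      finally have "dist u (z t) \<le> r / 2" by (simp add: dist_norm norm_minus_commute)
      then show ?thesis using u dist_triangle[of z0 "z t" u] by simp
    qed
    have "Y (z t) = X (z t)" if "t \<in> {-T<..<T}" for t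
      unfolding Y_def using zC[OF that] by (simp add: closest_point_self)
    then show "\<exists>z. z 0 = u \<and> (\<forall>t\<in>{-T<..<T}. (z has_vector_derivative X (z t)) (at t) \<and> z t \<in> cball z0 r)"
      using z(1,2) zC by (intro exI[of _ z]) auto
  qed
qed

text \<open>Gronwall's argument: while both solutions stay in a ball on which \<open>X\<close> is
  Lipschitz, \<open>exp (- 2 L t) |z - w|^2\<close> does not increase, and it starts at zero.
  Agreement is claimed for a short time only; continuation is carried out for geodesics, which might
  leave the chart.\<close>

lemma ode_unique:
  fixes X :: "'a::euclidean_space \<Rightarrow> 'a"
  assumes S: "open S" and X: "smooth_on X S" and "a < b"
    and z: "\<And>t. t \<in> {a..b} \<Longrightarrow> (z has_vector_derivative X (z t)) (at t)"
    and w: "\<And>t. t \<in> {a..b} \<Longrightarrow> (w has_vector_derivative X (w t)) (at t)"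
    and eq: "z a = w a" "z a \<in> S"
  obtains d where "d > 0" "a + d \<le> b" "\<And>t. t \<in> {a..a + d} \<Longrightarrow> z t = w t"
proof -
  obtain r where r: "r > 0" "cball (z a) r \<subseteq> S" using S eq(2) open_contains_cball by blast
  let ?C = "cball (z a) r"
  obtain L where L: "L \<ge> 0" "\<And>x y. x \<in> ?C \<Longrightarrow> y \<in> ?C \<Longrightarrow> norm (X x - X y) \<le> L * norm (x - y)"
    using smooth_on_lipschitz[OF S X compact_cball convex_cball r(2)] by blast
  have "\<exists>d>0. \<forall>t. dist t a < d \<longrightarrow> dist (y t) (y a) < r"
    if "\<And>t. t \<in> {a..b} \<Longrightarrow> (y has_vector_derivative X (y t)) (at t)" for y
    using has_vector_derivative_continuous[OF that[of a]] \<open>a < b\<close> r(1)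
    by (auto simp: continuous_at_eps_delta)
  then obtain d1 d2 where d1: "d1 > 0" "\<And>t. dist t a < d1 \<Longrightarrow> dist (z t) (z a) < r"
    and d2: "d2 > 0" "\<And>t. dist t a < d2 \<Longrightarrow> dist (w t) (w a) < r"
    using z w by metis
  define d where "d = min (b - a) (min d1 d2 / 2)"
  have d: "d > 0" "a + d \<le> b" using d1 d2 \<open>a < b\<close> by (auto simp: d_def)
  have inC: "z t \<in> ?C" "w t \<in> ?C" if "t \<in> {a..a+d}" for t
  proof -
    have "dist t a < d1" "dist t a < d2" using that d1 d2 \<open>a < b\<close> by (auto simp: d_def dist_real_def min_def split: if_splits)
    then show "z t \<in> ?C" "w t \<in> ?C" using d1(2)[of t] d2(2)[of t] eq by (auto simp: dist_commute less_imp_le)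
  qed
  let ?g = "\<lambda>t. exp (- (2 * L) * t) * ((z t - w t) \<bullet> (z t - w t))"
  have "z t = w t" if t: "t \<in> {a..a+d}" for t
  proof -
    have "?g t \<le> ?g a"
    proof (rule DERIV_nonpos_imp_nonincreasing[where f = ?g])
      fix s assume s: "a \<le> s" "s \<le> t"
      let ?D = "exp (- (2 * L) * s) * (2 * ((X (z s) - X (w s)) \<bullet> (z s - w s)) - 2 * L * ((z s - w s) \<bullet> (z s - w s)))"
      have zs: "(z has_vector_derivative X (z s)) (at s)" "(w has_vector_derivative X (w s)) (at s)"
        using s t d by (auto intro!: z w)
      have dw: "((\<lambda>t. z t - w t) has_derivative (\<lambda>h. h *\<^sub>R (X (z s) - X (w s)))) (at s)"
        using has_vector_derivative_diff[OF zs] by (simp add: has_vector_derivative_def)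
      have dsq: "((\<lambda>t. (z t - w t) \<bullet> (z t - w t)) has_real_derivative 2 * ((X (z s) - X (w s)) \<bullet> (z s - w s))) (at s)"
        unfolding has_field_derivative_def
        by (rule has_derivative_eq_rhs[OF has_derivative_inner[OF dw dw]]) (auto simp: inner_commute)
      have "((\<lambda>t. exp (- (2 * L) * t)) has_real_derivative exp (- (2 * L) * s) * (- (2 * L))) (at s)"
        by (auto intro!: derivative_eq_intros)
      from DERIV_mult[OF this dsq] have "(?g has_real_derivative ?D) (at s)"
        by (rule DERIV_cong) (simp add: algebra_simps)
      moreover have "?D \<le> 0"
      proof -
        have "(X (z s) - X (w s)) \<bullet> (z s - w s) \<le> norm (X (z s) - X (w s)) * norm (z s - w s)"
          by (rule norm_cauchy_schwarz)
        also have "\<dots> \<le> L * norm (z s - w s) * norm (z s - w s)"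
          using s t by (intro mult_right_mono L inC) auto
        also have "\<dots> = L * ((z s - w s) \<bullet> (z s - w s))" by (simp add: dot_square_norm power2_eq_square)
        finally show ?thesis by (intro mult_nonneg_nonpos) auto
      qed
      ultimately show "\<exists>y. (?g has_real_derivative y) (at s) \<and> y \<le> 0" by blast
    qed (use t in auto)
    then show ?thesis using eq(1) inner_ge_zero[of "z t - w t"] by (auto simp: mult_le_0_iff dest: antisym)
  qed
  with d show ?thesis by (rule that)
qed

text \<open>Bootstrapping: \<open>z' = X (z)\<close> is as smooth as \<open>z\<close>, so
  \<open>z\<close> gains one order at each step.\<close>

lemma ode_smooth:
  fixes X :: "'a::euclidean_space \<Rightarrow> 'a" and J :: "real set"
  assumes S: "open S" and X: "smooth_on X S" and J: "open J"
    and z: "\<And>t. t \<in> J \<Longrightarrow> (z has_vector_derivative X (z t)) (at t)" "\<And>t. t \<in> J \<Longrightarrow> z t \<in> S"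
  shows "smooth_on z J"
  unfolding smooth_on_def
proof
  fix k show "Ck_on k z J"
  proof (induction k)
    case 0
    then show ?case
      using z(1) by (auto intro!: continuous_at_imp_continuous_on has_vector_derivative_continuous)
  next
    case (Suc k)
    show ?case
    proof (rule Ck_on_SucI[OF J, where f' = "\<lambda>t h. h *\<^sub>R X (z t)"])
      show "(z has_derivative (\<lambda>h. h *\<^sub>R X (z t))) (at t)" if "t \<in> J" for t
        using z(1)[OF that] by (simp add: has_vector_derivative_def)
      have "Ck_on k (\<lambda>t. X (z t)) J"
        by (rule Ck_on_compose[OF J S _ Suc]) (use X z(2) in \<open>auto simp: smooth_on_def\<close>)
      then show "Ck_on k (\<lambda>t. h *\<^sub>R X (z t)) J" for h
        by (rule Ck_on_linear[OF J bounded_linear_scaleR_right])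
    qed
  qed
qed

section \<open>Finsler metrics in a chart\<close>

text \<open>A Finsler metric read in a chart with image \<open>D\<close>. Positivity is phrased with
  the iterated \<open>deriv\<close> of the fundamental tensor, on the diagonal and without the
  factor 1/2, so that it transfers from the manifold directly.\<close>

locale finsler_chart =
  fixes D :: "'e::euclidean_space set" and f :: "'e \<times> 'e \<Rightarrow> real"
  assumes open_D: "open D"
    and smooth_f: "smooth_on f (D \<times> - {0})"
    and cont_f: "continuous_on (D \<times> UNIV) f"
    and f_nonneg: "x \<in> D \<Longrightarrow> 0 \<le> f (x, y)"
    and f_zero: "x \<in> D \<Longrightarrow> f (x, 0) = 0"
    and f_scale: "x \<in> D \<Longrightarrow> y \<noteq> 0 \<Longrightarrow> r > 0 \<Longrightarrow> f (x, r *\<^sub>R y) = r * f (x, y)"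
    and f_posdef: "x \<in> D \<Longrightarrow> y \<noteq> 0 \<Longrightarrow> w \<noteq> 0 \<Longrightarrow>
      0 < deriv (\<lambda>s1. deriv (\<lambda>s2. (f (x, y + s1 *\<^sub>R w + s2 *\<^sub>R w))\<^sup>2) 0) 0"
begin

section \<open>Momentum, homogeneity and Euler identities\<close>

definition slit :: "('e \<times> 'e) set" where "slit = D \<times> - {0}"

definition L :: "'e \<times> 'e \<Rightarrow> real" where "L z = (1/2) * (f z)\<^sup>2"

text \<open>The momentum, that is the Legendre transform of the velocity: a covector written as a
  vector by means of the Euclidean inner product of the chart.\<close>

definition p :: "'e \<times> 'e \<Rightarrow> 'e" where "p z = (\<Sum>b\<in>Basis. frechet_derivative L (at z) (0, b) *\<^sub>R b)"

definition q :: "'e \<times> 'e \<Rightarrow> 'e" where "q z = (\<Sum>b\<in>Basis. frechet_derivative L (at z) (b, 0) *\<^sub>R b)"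

abbreviation Dp :: "'e \<times> 'e \<Rightarrow> 'e \<times> 'e \<Rightarrow> 'e" where "Dp z \<equiv> frechet_derivative p (at z)"

lemma mem_slit [simp]: "(x, y) \<in> slit \<longleftrightarrow> x \<in> D \<and> y \<noteq> 0"
  by (simp add: slit_def)

lemma open_slit: "open slit"
  unfolding slit_def by (intro open_Times open_D) auto

lemma smooth_f_slit: "smooth_on f slit"
  using smooth_f by (simp add: slit_def)

lemma smooth_L: "smooth_on L slit"
proof -
  have "smooth_on (\<lambda>z. (1/2) * (f z * f z)) slit"
    by (intro smooth_on_mult open_slit smooth_f_slit smooth_on_const)
  then show ?thesis unfolding L_def by (simp add: power2_eq_square)
qed

lemma smooth_p: "smooth_on p slit" and smooth_q: "smooth_on q slit"
  unfolding p_def q_def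
  by (intro smooth_on_sum smooth_on_scaleR open_slit smooth_on_const smooth_on_derivative smooth_L)+

lemma fd_L:
  assumes "z \<in> slit"
  shows "frechet_derivative L (at z) (h, k) = q z \<bullet> h + p z \<bullet> k"
proof -
  let ?d = "frechet_derivative L (at z)"
  have lin: "linear ?d" using smooth_on_linear_derivative[OF smooth_L assms] .
  have "linear (\<lambda>h. ?d (h, 0))" using linear_compose[OF _ lin, of "\<lambda>h. (h, 0)"]
    by (simp add: o_def linear_iff)
  moreover have "linear (\<lambda>k. ?d (0, k))" using linear_compose[OF _ lin, of "\<lambda>k. (0, k)"]
    by (simp add: o_def linear_iff)
  moreover have "?d (h, k) = ?d (h, 0) + ?d (0, k)"
    by (simp flip: linear_add[OF lin])
  ultimately show ?thesis unfolding p_def q_def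
    using linear_inner_Basis[of "\<lambda>h. ?d (h, 0)" h] linear_inner_Basis[of "\<lambda>k. ?d (0, k)" k] by simp
qed

lemma L_has_derivative:
  assumes "z \<in> slit"
  shows "(L has_derivative (\<lambda>v. q z \<bullet> fst v + p z \<bullet> snd v)) (at z)"
proof -
  have "frechet_derivative L (at z) = (\<lambda>v. q z \<bullet> fst v + p z \<bullet> snd v)"
    using fd_L[OF assms, of "fst v" "snd v" for v] by (intro ext) simp
  then show ?thesis using smooth_on_has_derivative[OF smooth_L assms] by simp
qed

lemma p_has_derivative: "z \<in> slit \<Longrightarrow> (p has_derivative Dp z) (at z)"
  using smooth_on_has_derivative[OF smooth_p] .

lemma linear_Dp: "z \<in> slit \<Longrightarrow> linear (Dp z)"
  using smooth_on_linear_derivative[OF smooth_p] .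

lemma Dp_add: "z \<in> slit \<Longrightarrow> Dp z (h, k) = Dp z (h, 0) + Dp z (0, k)"
  using linear_add[OF linear_Dp, of z "(h, 0)" "(0, k)"] by simp

lemma L_curve:
  assumes "(x has_vector_derivative x') (at t)" "(y has_vector_derivative y') (at t)" "(x t, y t) \<in> slit"
  shows "((\<lambda>t. L (x t, y t)) has_real_derivative q (x t, y t) \<bullet> x' + p (x t, y t) \<bullet> y') (at t)"
proof -
  have "((\<lambda>t. (x t, y t)) has_derivative (\<lambda>h. (h *\<^sub>R x', h *\<^sub>R y'))) (at t)"
    using assms(1,2) by (auto simp: has_vector_derivative_def intro!: has_derivative_Pair)
  from has_derivative_compose[OF this L_has_derivative[OF assms(3)]] show ?thesis
    unfolding has_field_derivative_def by (rule has_derivative_eq_rhs) (auto simp: algebra_simps)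
qed

lemma p_curve:
  assumes "(x has_vector_derivative x') (at t)" "(y has_vector_derivative y') (at t)" "(x t, y t) \<in> slit"
  shows "((\<lambda>t. p (x t, y t)) has_vector_derivative Dp (x t, y t) (x', y')) (at t)"
proof -
  have "((\<lambda>t. (x t, y t)) has_derivative (\<lambda>h. (h *\<^sub>R x', h *\<^sub>R y'))) (at t)"
    using assms(1,2) by (auto simp: has_vector_derivative_def intro!: has_derivative_Pair)
  from has_derivative_compose[OF this p_has_derivative[OF assms(3)]] show ?thesis
    unfolding has_vector_derivative_def
    by (rule has_derivative_eq_rhs) (simp add: linear_scale[OF linear_Dp[OF assms(3)], of _ "(x', y')", simplified])
qed

text \<open>The vertical derivative of \<open>p\<close> is the Hessian of \<open>L\<close>. The
  inner derivative is evaluated where \<open>y + s a\<close> is nonzero, so the outer one is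
  compared on a neighbourhood of \<open>s = 0\<close>.\<close>

lemma fundamental_tensor_eq:
  assumes "x \<in> D" "y \<noteq> 0"
  shows "deriv (\<lambda>s1. deriv (\<lambda>s2. (f (x, y + s1 *\<^sub>R a + s2 *\<^sub>R b))\<^sup>2) 0) 0 = 2 * (Dp (x, y) (0, a) \<bullet> b)"
proof -
  have vd: "((\<lambda>s. w + s *\<^sub>R c) has_vector_derivative c) (at s)" for w c :: 'e and s
    by (auto intro!: derivative_eq_intros)
  have inner: "deriv (\<lambda>s2. (f (x, w + s2 *\<^sub>R b))\<^sup>2) 0 = 2 * (p (x, w) \<bullet> b)" if "w \<noteq> 0" for w
  proof -
    have "((\<lambda>s. 2 * L (x, w + s *\<^sub>R b)) has_real_derivative 2 * (p (x, w) \<bullet> b)) (at 0)"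
      using L_curve[OF has_vector_derivative_const vd[of w b 0], of x] assms that
      by (auto intro!: DERIV_cmult)
    then show ?thesis unfolding L_def by (simp add: DERIV_imp_deriv)
  qed
  have "isCont (\<lambda>s. y + s *\<^sub>R a) 0" by (intro continuous_intros)
  then have "\<forall>\<^sub>F s in at 0. y + s *\<^sub>R a \<noteq> 0"
    using tendsto_imp_eventually_ne[of "\<lambda>s. y + s *\<^sub>R a" y "at 0" 0] assms(2) by (simp add: isCont_def)
  then have "\<forall>\<^sub>F s in nhds 0. y + s *\<^sub>R a \<noteq> 0"
    using assms(2) by (auto simp: eventually_at_filter elim: eventually_mono)
  then have "\<forall>\<^sub>F s in nhds 0. deriv (\<lambda>s2. (f (x, y + s *\<^sub>R a + s2 *\<^sub>R b))\<^sup>2) 0 = 2 * (p (x, y + s *\<^sub>R a) \<bullet> b)"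
    by (rule eventually_mono) (rule inner)
  then have "deriv (\<lambda>s1. deriv (\<lambda>s2. (f (x, y + s1 *\<^sub>R a + s2 *\<^sub>R b))\<^sup>2) 0) 0 = deriv (\<lambda>s. 2 * (p (x, y + s *\<^sub>R a) \<bullet> b)) 0"
    by (rule deriv_cong_ev) simp
  also have "\<dots> = 2 * (Dp (x, y) (0, a) \<bullet> b)"
  proof (rule DERIV_imp_deriv)
    have "((\<lambda>s. p (x, y + s *\<^sub>R a)) has_vector_derivative Dp (x, y) (0, a)) (at 0)"
      using p_curve[OF has_vector_derivative_const vd[of y a 0], of x] assms by simp
    from bounded_linear.has_vector_derivative[OF bounded_linear_inner_left[of b] this]
    show "((\<lambda>s. 2 * (p (x, y + s *\<^sub>R a) \<bullet> b)) has_real_derivative 2 * (Dp (x, y) (0, a) \<bullet> b)) (at 0)"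
      by (intro DERIV_cmult) (simp add: has_real_derivative_iff_has_vector_derivative)
  qed
  finally show ?thesis .
qed

lemma Dp_posdef: "x \<in> D \<Longrightarrow> y \<noteq> 0 \<Longrightarrow> w \<noteq> 0 \<Longrightarrow> 0 < Dp (x, y) (0, w) \<bullet> w"
  using f_posdef[of x y w] fundamental_tensor_eq[of x y w w] by simp

lemma L_scale: "x \<in> D \<Longrightarrow> y \<noteq> 0 \<Longrightarrow> r > 0 \<Longrightarrow> L (x, r *\<^sub>R y) = r\<^sup>2 * L (x, y)"
  by (simp add: L_def f_scale power_mult_distrib)

text \<open>Differentiate \<open>L (x, r y) = r^2 L (x, y)\<close> in both variables at once and
  compare components.\<close>

lemma
  assumes "x \<in> D" "y \<noteq> 0" "r > 0"
  shows p_scale: "p (x, r *\<^sub>R y) = r *\<^sub>R p (x, y)"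
    and q_scale: "q (x, r *\<^sub>R y) = r\<^sup>2 *\<^sub>R q (x, y)"
proof -
  have z: "(x, y) \<in> slit" "(x, r *\<^sub>R y) \<in> slit" using assms by auto
  have sc: "((\<lambda>v. (fst v, r *\<^sub>R snd v)) has_derivative (\<lambda>v. (fst v, r *\<^sub>R snd v))) (at (x, y))"
    by (auto intro!: derivative_eq_intros)
  have "((\<lambda>v. L (fst v, r *\<^sub>R snd v)) has_derivative (\<lambda>v. q (x, r *\<^sub>R y) \<bullet> fst v + p (x, r *\<^sub>R y) \<bullet> (r *\<^sub>R snd v))) (at (x, y))"
    using has_derivative_compose[OF sc, of L] L_has_derivative[OF z(2)] by fastforce
  moreover have "((\<lambda>v. r\<^sup>2 * L v) has_derivative (\<lambda>v. r\<^sup>2 * (q (x, y) \<bullet> fst v + p (x, y) \<bullet> snd v))) (at (x, y))"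
    by (intro has_derivative_mult_right L_has_derivative z)
  then have "((\<lambda>v. L (fst v, r *\<^sub>R snd v)) has_derivative (\<lambda>v. r\<^sup>2 * (q (x, y) \<bullet> fst v + p (x, y) \<bullet> snd v))) (at (x, y))"
  proof (rule has_derivative_transform_within_open[OF _ open_slit z(1)])
    show "r\<^sup>2 * L v = L (fst v, r *\<^sub>R snd v)" if "v \<in> slit" for v
      using L_scale[of "fst v" "snd v" r] assms(3) that by (cases v) simp
  qed
  ultimately have "(\<lambda>v. q (x, r *\<^sub>R y) \<bullet> fst v + p (x, r *\<^sub>R y) \<bullet> (r *\<^sub>R snd v)) = (\<lambda>v. r\<^sup>2 * (q (x, y) \<bullet> fst v + p (x, y) \<bullet> snd v))"
    by (rule has_derivative_unique)
  then have eq: "q (x, r *\<^sub>R y) \<bullet> h + p (x, r *\<^sub>R y) \<bullet> (r *\<^sub>R k) = r\<^sup>2 * (q (x, y) \<bullet> h + p (x, y) \<bullet> k)" for h k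
    by (auto dest: fun_cong[where x = "(h, k)"])
  show "q (x, r *\<^sub>R y) = r\<^sup>2 *\<^sub>R q (x, y)"
    by (rule vector_eq_rdot[THEN iffD1]) (use eq[of _ 0] in auto)
  show "p (x, r *\<^sub>R y) = r *\<^sub>R p (x, y)"
  proof (rule vector_eq_rdot[THEN iffD1], rule allI)
    fix k
    have "r * (p (x, r *\<^sub>R y) \<bullet> k) = r * (r * (p (x, y) \<bullet> k))" using eq[of 0 k] by (simp add: power2_eq_square)
    then show "p (x, r *\<^sub>R y) \<bullet> k = r *\<^sub>R p (x, y) \<bullet> k" using assms(3) by simp
  qed
qed

lemma euler:
  assumes "x \<in> D" "y \<noteq> 0"
  shows "p (x, y) \<bullet> y = 2 * L (x, y)"
proof -
  have "((\<lambda>s. s *\<^sub>R y) has_vector_derivative y) (at 1)" by (auto intro!: derivative_eq_intros)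
  then have "((\<lambda>s. L (x, s *\<^sub>R y)) has_real_derivative p (x, y) \<bullet> y) (at 1)"
    using L_curve[OF has_vector_derivative_const, of "\<lambda>s. s *\<^sub>R y" y 1 x] assms by simp
  moreover have "((\<lambda>s. s\<^sup>2 * L (x, y)) has_real_derivative 2 * L (x, y)) (at 1)"
    by (auto intro!: derivative_eq_intros)
  then have "((\<lambda>s. L (x, s *\<^sub>R y)) has_real_derivative 2 * L (x, y)) (at 1)"
    by (rule DERIV_cong_ev[THEN iffD1, rotated -1])
      (use eventually_nhds_in_open[of "{0::real<..}" 1] assms in \<open>auto elim!: eventually_mono simp: L_scale\<close>)
  ultimately show ?thesis by (rule DERIV_unique)
qed

text \<open>Euler's identity \<open>p \<bullet> y = 2 L\<close>, differentiated in both variables.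
  It later evaluates \<open>p \<bullet> u\<close> for a vector \<open>u\<close> that is known only
  through \<open>Dp (0, u)\<close>.\<close>

lemma Dp_snd:
  assumes "(x, y) \<in> slit"
  shows "Dp (x, y) (h, u) \<bullet> y = 2 * (q (x, y) \<bullet> h) + p (x, y) \<bullet> u"
proof -
  have "((\<lambda>z. p z \<bullet> snd z) has_derivative (\<lambda>v. p (x, y) \<bullet> snd v + Dp (x, y) v \<bullet> y)) (at (x, y))"
    using has_derivative_inner[OF p_has_derivative[OF assms] has_derivative_snd[OF has_derivative_ident]] by simp
  moreover have "((\<lambda>z. 2 * L z) has_derivative (\<lambda>v. 2 * (q (x, y) \<bullet> fst v + p (x, y) \<bullet> snd v))) (at (x, y))"
    by (intro has_derivative_mult_right L_has_derivative assms)
  then have "((\<lambda>z. p z \<bullet> snd z) has_derivative (\<lambda>v. 2 * (q (x, y) \<bullet> fst v + p (x, y) \<bullet> snd v))) (at (x, y))"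
    by (rule has_derivative_transform_within_open[OF _ open_slit assms]) (auto simp: euler)
  ultimately have "(\<lambda>v. p (x, y) \<bullet> snd v + Dp (x, y) v \<bullet> y) = (\<lambda>v. 2 * (q (x, y) \<bullet> fst v + p (x, y) \<bullet> snd v))"
    by (rule has_derivative_unique)
  from fun_cong[OF this, of "(h, u)"] show ?thesis by simp
qed

lemma Dp_self:
  assumes "x \<in> D" "y \<noteq> 0"
  shows "Dp (x, y) (0, y) = p (x, y)"
proof -
  have "((\<lambda>s. s *\<^sub>R y) has_vector_derivative y) (at 1)" by (auto intro!: derivative_eq_intros)
  then have "((\<lambda>s. p (x, s *\<^sub>R y)) has_vector_derivative Dp (x, y) (0, y)) (at 1)"
    using p_curve[OF has_vector_derivative_const, of "\<lambda>s. s *\<^sub>R y" y 1 x] assms by simp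
  moreover have "((\<lambda>s. s *\<^sub>R p (x, y)) has_vector_derivative p (x, y)) (at 1)"
    by (auto intro!: derivative_eq_intros)
  then have "((\<lambda>s. p (x, s *\<^sub>R y)) has_vector_derivative p (x, y)) (at 1)"
    by (rule has_vector_derivative_transform_within_open[where S = "{0<..}"]) (use assms in \<open>auto simp: p_scale\<close>)
  ultimately show ?thesis by (rule vector_derivative_unique_at)
qed

section \<open>Positivity, convexity and the fundamental inequality\<close>

lemma f_pos: "x \<in> D \<Longrightarrow> y \<noteq> 0 \<Longrightarrow> 0 < f (x, y)"
  \<comment> \<open>On the diagonal the fundamental tensor gives
    \<open>Dp (0, y) \<bullet> y = p \<bullet> y = f^2\<close>, so \<open>f\<close> is nonzero; its
    sign comes from \<open>f_nonneg\<close>.\<close>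
  using Dp_posdef[of x y y] Dp_self[of x y] euler[of x y] f_nonneg[of x y] by (auto simp: L_def less_le)

text \<open>The second derivative of \<open>L\<close> along the segment is the fundamental tensor,
  hence nonnegative, as long as the segment avoids the zero vector, where \<open>L\<close> need not
  be smooth.\<close>

lemma L_convex:
  assumes x: "x \<in> D" and seg: "\<And>s. 0 \<le> s \<Longrightarrow> s \<le> 1 \<Longrightarrow> v + s *\<^sub>R d \<noteq> 0"
  shows "L (x, v) + p (x, v) \<bullet> d \<le> L (x, v + d)"
proof -
  have vd: "((\<lambda>s. v + s *\<^sub>R d) has_vector_derivative d) (at s)" for s
    by (auto intro!: derivative_eq_intros)
  have d1: "((\<lambda>s. L (x, v + s *\<^sub>R d)) has_real_derivative p (x, v + s *\<^sub>R d) \<bullet> d) (at s)" if "0 \<le> s" "s \<le> 1" for s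
    using L_curve[OF has_vector_derivative_const vd, of x s] x seg[OF that] by simp
  have d2: "((\<lambda>s. p (x, v + s *\<^sub>R d) \<bullet> d) has_real_derivative Dp (x, v + s *\<^sub>R d) (0, d) \<bullet> d) (at s)" if "0 \<le> s" "s \<le> 1" for s
    using bounded_linear.has_vector_derivative[OF bounded_linear_inner_left[of d] p_curve[OF has_vector_derivative_const vd, of x s]] x seg[OF that]
    by (simp add: has_real_derivative_iff_has_vector_derivative)
  obtain s where s: "0 < s" "s < 1" "L (x, v + 1 *\<^sub>R d) - L (x, v + 0 *\<^sub>R d) = (1 - 0) * (p (x, v + s *\<^sub>R d) \<bullet> d)"
    using MVT2[of 0 1, OF _ d1] by auto
  have "p (x, v + 0 *\<^sub>R d) \<bullet> d \<le> p (x, v + s *\<^sub>R d) \<bullet> d"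
  proof (rule DERIV_nonneg_imp_nondecreasing[where f = "\<lambda>s. p (x, v + s *\<^sub>R d) \<bullet> d"])
    fix r assume r: "0 \<le> r" "r \<le> s"
    show "\<exists>y. ((\<lambda>s. p (x, v + s *\<^sub>R d) \<bullet> d) has_real_derivative y) (at r) \<and> 0 \<le> y"
    proof (cases "d = 0")
      case True
      then show ?thesis using d2[of r] r s by (intro exI[of _ "Dp (x, v + r *\<^sub>R d) (0, d) \<bullet> d"]) auto
    next
      case False
      then show ?thesis using d2[of r] r s Dp_posdef[OF x seg[of r], of d] by (auto intro!: exI less_imp_le)
    qed
  qed (use s in auto)
  then show ?thesis using s(3) by simp
qed

text \<open>Cauchy-Schwarz for a Finsler norm. Rescale \<open>w\<close> to the same
  \<open>f\<close>-value as \<open>v\<close>: convexity of \<open>L\<close> gives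
  \<open>p \<bullet> (c w - v) \<le> 0\<close>, and \<open>p \<bullet> v = f^2\<close> by Euler's
  identity. The segment from \<open>v\<close> to \<open>c w\<close> meets the origin only if
  \<open>w\<close> points opposite to \<open>v\<close>; then \<open>p \<bullet> w \<le> 0\<close>
  already.\<close>

lemma fundamental_inequality:
  assumes x: "x \<in> D" and v: "v \<noteq> 0"
  shows "p (x, v) \<bullet> w \<le> f (x, v) * f (x, w)"
proof (cases "w = 0")
  case True
  then show ?thesis using f_zero[OF x] by simp
next
  case False
  define c where "c = f (x, v) / f (x, w)"
  have fv: "0 < f (x, v)" and fw: "0 < f (x, w)" using f_pos x v False by auto
  have c: "c > 0" using fv fw by (simp add: c_def)
  have "p (x, v) \<bullet> (c *\<^sub>R w) \<le> f (x, v) * f (x, v)"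
  proof (cases "\<exists>s. 0 \<le> s \<and> s \<le> 1 \<and> v + s *\<^sub>R (c *\<^sub>R w - v) = 0")
    case True
    then obtain s where s: "0 \<le> s" "s \<le> 1" "v + s *\<^sub>R (c *\<^sub>R w - v) = 0" by blast
    then have "s > 0" using v by (cases "s = 0") auto
    have "s *\<^sub>R (c *\<^sub>R w) = (s - 1) *\<^sub>R v" using s(3) by (simp add: algebra_simps eq_neg_iff_add_eq_0)
    then have "s * (p (x, v) \<bullet> (c *\<^sub>R w)) = (s - 1) * (p (x, v) \<bullet> v)"
      by (metis inner_scaleR_right)
    also have "\<dots> \<le> 0" using s euler[OF x v] by (simp add: L_def mult_nonpos_nonneg)
    finally have "p (x, v) \<bullet> (c *\<^sub>R w) \<le> 0" using \<open>s > 0\<close> by (simp add: mult_le_0_iff)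
    then show ?thesis using fv by (meson mult_nonneg_nonneg less_imp_le order_trans)
  next
    case F: False
    have "L (x, v) + p (x, v) \<bullet> (c *\<^sub>R w - v) \<le> L (x, v + (c *\<^sub>R w - v))"
      by (rule L_convex[OF x]) (use F in blast)
    moreover have "L (x, c *\<^sub>R w) = L (x, v)" using f_scale[OF x False c] fw by (simp add: L_def c_def)
    ultimately have "p (x, v) \<bullet> (c *\<^sub>R w) \<le> p (x, v) \<bullet> v" by (simp add: inner_diff_right)
    then show ?thesis using euler[OF x v] by (simp add: L_def power2_eq_square)
  qed
  then have "c * (p (x, v) \<bullet> w) \<le> c * (f (x, v) * f (x, w))"
    using fw by (simp add: c_def)
  then show ?thesis using c by simp
qed

subsection \<open>The geodesic equation\<close>

text \<open>Along a curve with velocity \<open>y\<close> the chain rule gives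
  \<open>p' = Dp (y, y')\<close>. \<open>G\<close> is the acceleration for which this equals
  \<open>q\<close>; the operator inverted is the fundamental tensor, bijective on the slit
  bundle.\<close>

definition G :: "'e \<times> 'e \<Rightarrow> 'e" where
  "G z = inv (\<lambda>u. Dp z (0, u)) (q z - Dp z (snd z, 0))"

lemma linear_Dp_vertical: "z \<in> slit \<Longrightarrow> linear (\<lambda>u. Dp z (0, u))"
  using linear_compose[OF _ linear_Dp, of "\<lambda>u. (0, u)"] by (simp add: o_def linear_iff)

lemma inj_Dp_vertical: "z \<in> slit \<Longrightarrow> inj (\<lambda>u. Dp z (0, u))"
  using Dp_posdef[of "fst z" "snd z"]
  by (subst linear_injective_0[OF linear_Dp_vertical]) (cases z, force)+

lemma surj_Dp_vertical: "z \<in> slit \<Longrightarrow> surj (\<lambda>u. Dp z (0, u))"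
  using linear_injective_imp_surjective[OF linear_Dp_vertical inj_Dp_vertical] by simp

lemma Dp_G: "z \<in> slit \<Longrightarrow> Dp z (0, G z) = q z - Dp z (snd z, 0)"
  unfolding G_def using surj_f_inv_f[OF surj_Dp_vertical] .

lemma G_unique: "z \<in> slit \<Longrightarrow> Dp z (snd z, a) = q z \<Longrightarrow> a = G z"
  using injD[OF inj_Dp_vertical, of z a "G z"] Dp_G[of z] Dp_add[of z "snd z" a] by (simp add: algebra_simps)

lemma smooth_G: "smooth_on G slit"
proof (rule smooth_on_solve_linear[OF open_slit linear_Dp_vertical])
  show "smooth_on (\<lambda>z. Dp z (0, u)) slit" for u by (rule smooth_on_derivative[OF smooth_p])
  show "0 < Dp z (0, u) \<bullet> u" if "z \<in> slit" "u \<noteq> 0" for z u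
    using Dp_posdef[of "fst z" "snd z" u] that by (cases z) auto
  have "smooth_on (\<lambda>z::'e \<times> 'e. (snd z, 0::'e)) slit"
    by (intro smooth_on_linear_id open_slit bounded_linear_Pair bounded_linear_snd bounded_linear_zero)
  then show "smooth_on (\<lambda>z. q z - Dp z (snd z, 0)) slit"
    by (intro smooth_on_minus open_slit smooth_q smooth_on_derivative_apply smooth_p)
  show "Dp z (0, G z) = q z - Dp z (snd z, 0)" if "z \<in> slit" for z by (rule Dp_G[OF that])
qed

definition spray :: "'e \<times> 'e \<Rightarrow> 'e \<times> 'e" where "spray z = (snd z, G z)"

lemma smooth_spray: "smooth_on spray slit"
  unfolding spray_def
  by (intro smooth_on_Pair smooth_on_linear_id bounded_linear_snd open_slit smooth_G)

lemma spray_curve: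
  assumes "(z has_vector_derivative spray (z t)) (at t)"
  shows "((\<lambda>t. fst (z t)) has_vector_derivative snd (z t)) (at t)"
    and "((\<lambda>t. snd (z t)) has_vector_derivative G (z t)) (at t)"
  using bounded_linear.has_vector_derivative[OF bounded_linear_fst assms]
    bounded_linear.has_vector_derivative[OF bounded_linear_snd assms] by (simp_all add: spray_def)

lemma spray_euler_lagrange:
  assumes "(z has_vector_derivative spray (z t)) (at t)" "z t \<in> slit"
  shows "((\<lambda>t. p (z t)) has_vector_derivative q (z t)) (at t)"
proof -
  have "((\<lambda>t. p (fst (z t), snd (z t))) has_vector_derivative Dp (fst (z t), snd (z t)) (snd (z t), G (z t))) (at t)"
    by (rule p_curve[OF spray_curve[OF assms(1)]]) (use assms(2) in auto)
  then show ?thesis using Dp_G[OF assms(2)] Dp_add[OF assms(2), of "snd (z t)" "G (z t)"] by simp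
qed

text \<open>The derivative of \<open>2 L = p \<bullet> y\<close> by the product rule, with
  \<open>p' = q\<close>, is \<open>q \<bullet> y + p \<bullet> G\<close>. The chain rule gives the
  same value for the derivative of \<open>L\<close>. Hence it equals its own double and
  vanishes.\<close>

lemma spray_speed_constant:
  assumes z: "\<And>t. t \<in> {a<..<b} \<Longrightarrow> (z has_vector_derivative spray (z t)) (at t)"
    "\<And>t. t \<in> {a<..<b} \<Longrightarrow> z t \<in> slit"
    and ts: "t \<in> {a<..<b}" "s \<in> {a<..<b}"
  shows "f (z t) = f (z s)"
proof -
  have "((\<lambda>t. L (z t)) has_derivative (\<lambda>h. 0)) (at t within {a<..<b})" if t: "t \<in> {a<..<b}" for t
  proof -
    let ?y = "snd (z t)"
    have dL: "((\<lambda>t. L (z t)) has_real_derivative q (z t) \<bullet> ?y + p (z t) \<bullet> G (z t)) (at t)"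
      using L_curve[OF spray_curve[OF z(1)[OF t]]] z(2)[OF t] by simp
    have "((\<lambda>t. p (z t) \<bullet> snd (z t)) has_vector_derivative p (z t) \<bullet> G (z t) + q (z t) \<bullet> ?y) (at t)"
      by (rule bounded_bilinear.has_vector_derivative[OF bounded_bilinear_inner spray_euler_lagrange[OF z(1)[OF t] z(2)[OF t]] spray_curve(2)[OF z(1)[OF t]]])
    then have "((\<lambda>t. 2 * L (z t)) has_vector_derivative p (z t) \<bullet> G (z t) + q (z t) \<bullet> ?y) (at t)"
    proof (rule has_vector_derivative_transform_within_open[OF _ open_greaterThanLessThan t])
      show "p (z s) \<bullet> snd (z s) = 2 * L (z s)" if "s \<in> {a<..<b}" for s
        using z(2)[OF that] euler[of "fst (z s)" "snd (z s)"] by (cases "z s") auto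
    qed
    then have "((\<lambda>t. 2 * L (z t)) has_real_derivative p (z t) \<bullet> G (z t) + q (z t) \<bullet> ?y) (at t)"
      by (simp add: has_real_derivative_iff_has_vector_derivative)
    from DERIV_unique[OF this DERIV_cmult[OF dL]] have "q (z t) \<bullet> ?y + p (z t) \<bullet> G (z t) = 0" by simp
    with dL have "((\<lambda>t. L (z t)) has_derivative (\<lambda>h. 0)) (at t)"
      unfolding has_field_derivative_def by (auto elim!: has_derivative_eq_rhs)
    then show ?thesis by (rule has_derivative_at_withinI)
  qed
  then obtain c where c: "\<And>t. t \<in> {a<..<b} \<Longrightarrow> L (z t) = c"
    using has_derivative_zero_constant[of "{a<..<b}" "\<lambda>t. L (z t)"] by auto
  have "L (z t) = L (z s)" using c ts by simp
  moreover have "f (z t) \<ge> 0" "f (z s) \<ge> 0" using f_nonneg z(2) ts by (metis mem_slit prod.collapse)+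
  ultimately show ?thesis by (simp add: L_def)
qed

end

subsection \<open>The first variation of energy\<close>

context finsler_chart
begin

text \<open>Differentiation under the integral sign. Since \<open>L\<close> is smooth only at
  nonzero velocities, the condition at \<open>s = 0\<close> is thickened by compactness of the
  interval to a tube of small \<open>s\<close>.\<close>

lemma first_variation:
  fixes X :: "real \<times> real \<Rightarrow> 'e"
  defines "Xs \<equiv> \<lambda>z. frechet_derivative X (at z) (1, 0)" and "Xt \<equiv> \<lambda>z. frechet_derivative X (at z) (0, 1)"
  assumes W: "open W" and X: "smooth_on X W" and sub: "{0} \<times> {a..b} \<subseteq> W" and XD: "\<And>z. z \<in> W \<Longrightarrow> X z \<in> D"
    and nz: "\<And>t. t \<in> {a..b} \<Longrightarrow> Xt (0, t) \<noteq> 0"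
  shows "((\<lambda>s. integral {a..b} (\<lambda>t. L (X (s, t), Xt (s, t)))) has_real_derivative
    integral {a..b} (\<lambda>t. q (X (0, t), Xt (0, t)) \<bullet> Xs (0, t)
      + p (X (0, t), Xt (0, t)) \<bullet> frechet_derivative Xt (at (0, t)) (1, 0))) (at 0)"
proof -
  let ?Xst = "\<lambda>z. frechet_derivative Xt (at z) (1, 0)"
  have sm: "smooth_on Xs W" "smooth_on Xt W" unfolding Xs_def Xt_def by (intro smooth_on_derivative X)+
  have smst: "smooth_on ?Xst W" by (intro smooth_on_derivative sm)
  note cont = smooth_on_imp_continuous
  define W' where "W' = W \<inter> Xt -` (- {0})"
  have W': "open W'" unfolding W'_def
    by (rule continuous_open_preimage[OF cont[OF sm(2)] W]) auto
  have slit: "(X z, Xt z) \<in> slit" if "z \<in> W'" for z using that XD by (auto simp: W'_def)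
  have "compact ({0::real} \<times> {a..b})" by (intro compact_Times) auto
  moreover have "{0} \<times> {a..b} \<subseteq> W'" using sub nz by (auto simp: W'_def)
  ultimately obtain e where e: "e > 0" "(\<Union>x\<in>{0} \<times> {a..b}. cball x e) \<subseteq> W'"
    using compact_subset_open_imp_cball_epsilon_subset[OF _ W'] by metis
  have box: "(s, t) \<in> W'" if "s \<in> cball 0 e" "t \<in> {a..b}" for s :: real and t
  proof -
    have "(s, t) \<in> cball (0, t) e" using that(1) by (simp add: dist_Pair_Pair)
    then show ?thesis using e(2) that(2) by blast
  qed
  then have boxsub: "cball 0 e \<times> {a..b} \<subseteq> W'" by auto
  have contZ: "continuous_on W' (\<lambda>z. g (X z, Xt z))" if "continuous_on slit g" for g :: "'e \<times> 'e \<Rightarrow> 'c::topological_space"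
  proof (rule continuous_on_compose2[OF that])
    show "continuous_on W' (\<lambda>z. (X z, Xt z))"
      by (intro continuous_on_Pair continuous_on_subset[OF cont[OF X]] continuous_on_subset[OF cont[OF sm(2)]])
        (auto simp: W'_def)
    show "(\<lambda>z. (X z, Xt z)) ` W' \<subseteq> slit" using slit by blast
  qed
  let ?dL = "\<lambda>s t. q (X (s, t), Xt (s, t)) \<bullet> Xs (s, t) + p (X (s, t), Xt (s, t)) \<bullet> ?Xst (s, t)"
  have "((\<lambda>s. integral (cbox a b) (\<lambda>t. L (X (s, t), Xt (s, t)))) has_field_derivative
      integral (cbox a b) (?dL 0)) (at 0 within cball 0 e)"
  proof (rule leibniz_rule_field_derivative[where f = "\<lambda>s t. L (X (s, t), Xt (s, t))" and fx = ?dL])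
    fix s t :: real assume s: "s \<in> cball 0 e" and t: "t \<in> cbox a b"
    then have st: "(s, t) \<in> W'" using box by auto
    then have stW: "(s, t) \<in> W" by (auto simp: W'_def)
    have "((\<lambda>s. L (X (s, t), Xt (s, t))) has_real_derivative ?dL s t) (at s)"
      unfolding Xs_def
      by (rule L_curve[OF smooth_on_partial_fst[OF X stW] smooth_on_partial_fst[OF sm(2) stW] slit[OF st]])
    then show "((\<lambda>s. L (X (s, t), Xt (s, t))) has_real_derivative ?dL s t) (at s within cball 0 e)"
      by (rule has_field_derivative_at_within)
  next
    fix s :: real assume "s \<in> cball 0 e"
    then show "(\<lambda>t. L (X (s, t), Xt (s, t))) integrable_on cbox a b"
      unfolding cbox_interval
      by (intro integrable_continuous_interval continuous_on_compose2[OF contZ[OF cont[OF smooth_L]], of "{a..b}" "Pair s"])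
        (use box in \<open>auto intro!: continuous_intros\<close>)
  next
    have "continuous_on W' (\<lambda>z. q (X z, Xt z) \<bullet> Xs z + p (X z, Xt z) \<bullet> ?Xst z)"
      by (intro continuous_intros contZ cont[OF smooth_p] cont[OF smooth_q]
          continuous_on_subset[OF cont[OF sm(1)]] continuous_on_subset[OF cont[OF smst]]) (auto simp: W'_def)
    from continuous_on_subset[OF this boxsub]
    show "continuous_on (cball 0 e \<times> cbox a b) (\<lambda>(s, t). ?dL s t)" by (simp add: case_prod_unfold)
  qed (use e in auto)
  moreover have "at (0::real) within cball 0 e = at 0" using e(1) by (intro at_within_interior) simp
  ultimately show ?thesis by simp
qed

text \<open>By the Euler-Lagrange equation and the symmetry of mixed derivatives the integrand is
  the derivative of \<open>p \<bullet> Xs\<close>, which vanishes at both ends. Derivatives are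
  taken within \<open>{a..b}\<close> because a variation agrees with the geodesic there
  only.\<close>

lemma euler_lagrange_stationary:
  fixes X :: "real \<times> real \<Rightarrow> 'e"
  defines "Xs \<equiv> \<lambda>z. frechet_derivative X (at z) (1, 0)" and "Xt \<equiv> \<lambda>z. frechet_derivative X (at z) (0, 1)"
  assumes W: "open W" and X: "smooth_on X W" and sub: "{0} \<times> {a..b} \<subseteq> W" and "a \<le> b"
    and EL: "\<And>t. t \<in> {a..b} \<Longrightarrow>
      ((\<lambda>t. p (X (0, t), Xt (0, t))) has_vector_derivative q (X (0, t), Xt (0, t))) (at t within {a..b})"
    and ends: "Xs (0, a) = 0" "Xs (0, b) = 0"
  shows "integral {a..b} (\<lambda>t. q (X (0, t), Xt (0, t)) \<bullet> Xs (0, t)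
      + p (X (0, t), Xt (0, t)) \<bullet> frechet_derivative Xt (at (0, t)) (1, 0)) = 0"
proof (rule integral_unique)
  let ?Z = "\<lambda>t. (X (0, t), Xt (0, t))"
  have "((\<lambda>t. p (?Z t) \<bullet> frechet_derivative Xt (at (0, t)) (1, 0) + q (?Z t) \<bullet> Xs (0, t)) has_integral
      p (?Z b) \<bullet> Xs (0, b) - p (?Z a) \<bullet> Xs (0, a)) {a..b}"
  proof (rule fundamental_theorem_of_calculus[OF \<open>a \<le> b\<close>])
    fix t assume t: "t \<in> {a..b}"
    have "((\<lambda>t. Xs (0, t)) has_vector_derivative frechet_derivative Xt (at (0, t)) (1, 0)) (at t)"
      unfolding Xs_def Xt_def by (rule mixed_partials[OF W X]) (use sub t in auto)
    from bounded_bilinear.has_vector_derivative[OF bounded_bilinear_inner EL[OF t] has_vector_derivative_at_within[OF this]]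
    show "((\<lambda>t. p (?Z t) \<bullet> Xs (0, t)) has_vector_derivative
        p (?Z t) \<bullet> frechet_derivative Xt (at (0, t)) (1, 0) + q (?Z t) \<bullet> Xs (0, t)) (at t within {a..b})" .
  qed
  then show "((\<lambda>t. q (?Z t) \<bullet> Xs (0, t) + p (?Z t) \<bullet> frechet_derivative Xt (at (0, t)) (1, 0)) has_integral 0) {a..b}"
    using ends by (simp add: add.commute)
qed

text \<open>The fundamental lemma of the calculus of variations. Since stationarity is available on
  every compact subinterval of \<open>J\<close>, the polynomial \<open>(t - a) (b - t)\<close> can
  play the part of a bump function: it vanishes at the ends and is positive between them.\<close>

lemma stationary_imp_geodesic_equation:
  fixes x :: "real \<Rightarrow> 'e" and J :: "real set"
  assumes J: "open J" and x: "smooth_on x J" and y: "smooth_on y J"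
    and xy: "\<And>t. t \<in> J \<Longrightarrow> (x has_vector_derivative y t) (at t)"
    and slit: "\<And>t. t \<in> J \<Longrightarrow> (x t, y t) \<in> slit"
    and stat: "\<And>a b w. a < b \<Longrightarrow> {a..b} \<subseteq> J \<Longrightarrow>
      integral {a..b} (\<lambda>t. q (x t, y t) \<bullet> (((t - a) * (b - t)) *\<^sub>R w) + p (x t, y t) \<bullet> ((a + b - 2 * t) *\<^sub>R w)) = 0"
    and t0: "t0 \<in> J"
  shows "((\<lambda>t. (x t, y t)) has_vector_derivative spray (x t0, y t0)) (at t0)"
proof -
  let ?Z = "\<lambda>t. (x t, y t)"
  define y' where "y' t = frechet_derivative y (at t) 1" for t
  define r where "r t = q (?Z t) - Dp (?Z t) (y t, y' t)" for t
  have y': "(y has_vector_derivative y' t) (at t)" if "t \<in> J" for t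
    unfolding y'_def by (rule smooth_on_vector_derivative[OF y that])
  have smy': "smooth_on y' J" unfolding y'_def by (rule smooth_on_derivative[OF y])
  note cont = smooth_on_imp_continuous
  have contZ: "continuous_on J (\<lambda>t. g (?Z t))" if "continuous_on slit g" for g :: "'e \<times> 'e \<Rightarrow> 'c::topological_space"
    by (rule continuous_on_compose2[OF that]) (use slit in \<open>auto intro!: continuous_on_Pair cont[OF x] cont[OF y]\<close>)
  have contDp: "continuous_on J (\<lambda>t. Dp (?Z t) (y t, y' t))"
  proof -
    have "continuous_on J (\<lambda>t. (?Z t, (y t, y' t)))"
      by (intro continuous_on_Pair cont[OF x] cont[OF y] cont[OF smy'])
    from continuous_on_compose2[OF smooth_on_continuous_derivative[OF open_slit smooth_p] this]
    show ?thesis using slit by (simp add: image_subset_iff)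
  qed
  have contr: "continuous_on J r"
    unfolding r_def by (intro continuous_intros contZ cont smooth_q contDp)
  \<comment> \<open>Integration by parts moves the derivative from the test field to
    \<open>p\<close>, with zero boundary terms, so that only the residual \<open>r\<close> of the
    Euler-Lagrange equation remains.\<close>
  have zero: "integral {a..b} (\<lambda>t. ((t - a) * (b - t)) * (r t \<bullet> w)) = 0" if ab: "a < b" "{a..b} \<subseteq> J" for a b w
  proof -
    have "((\<lambda>t. ((t - a) * (b - t)) * (Dp (?Z t) (y t, y' t) \<bullet> w) + (a + b - 2 * t) * (p (?Z t) \<bullet> w)) has_integral
       ((b - a) * (b - b)) * (p (?Z b) \<bullet> w) - ((a - a) * (b - a)) * (p (?Z a) \<bullet> w)) {a..b}"
    proof (rule fundamental_theorem_of_calculus)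
      fix t assume "t \<in> {a..b}"
      then have t: "t \<in> J" using ab by auto
      have "((\<lambda>t. (t - a) * (b - t)) has_vector_derivative (a + b - 2 * t)) (at t)"
        by (auto intro!: derivative_eq_intros simp: algebra_simps)
      moreover have "((\<lambda>t. p (?Z t) \<bullet> w) has_vector_derivative Dp (?Z t) (y t, y' t) \<bullet> w) (at t)"
        using bounded_linear.has_vector_derivative[OF bounded_linear_inner_left p_curve[OF xy[OF t] y'[OF t] slit[OF t]]] .
      ultimately show "((\<lambda>t. (t - a) * (b - t) * (p (?Z t) \<bullet> w)) has_vector_derivative
          ((t - a) * (b - t)) * (Dp (?Z t) (y t, y' t) \<bullet> w) + (a + b - 2 * t) * (p (?Z t) \<bullet> w)) (at t within {a..b})"
        using bounded_bilinear.has_vector_derivative[OF bounded_bilinear_mult] has_vector_derivative_at_within by blast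
    qed (use ab in simp)
    then have i1: "((\<lambda>t. ((t - a) * (b - t)) * (Dp (?Z t) (y t, y' t) \<bullet> w) + (a + b - 2 * t) * (p (?Z t) \<bullet> w)) has_integral 0) {a..b}"
      by simp
    have "(\<lambda>t. q (?Z t) \<bullet> (((t - a) * (b - t)) *\<^sub>R w) + p (?Z t) \<bullet> ((a + b - 2 * t) *\<^sub>R w)) integrable_on {a..b}"
      by (intro integrable_continuous_interval continuous_intros continuous_on_subset[OF contZ[OF cont[OF smooth_q]] ab(2)]
          continuous_on_subset[OF contZ[OF cont[OF smooth_p]] ab(2)])
    then have i2: "((\<lambda>t. q (?Z t) \<bullet> (((t - a) * (b - t)) *\<^sub>R w) + p (?Z t) \<bullet> ((a + b - 2 * t) *\<^sub>R w)) has_integral 0) {a..b}"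
      using stat[OF ab, of w] by (simp add: has_integral_integral)
    show ?thesis
      by (rule integral_unique, rule has_integral_eq[OF _ has_integral_diff[OF i2 i1, simplified]])
        (auto simp: r_def inner_diff_left algebra_simps)
  qed
  have r0: "r t0 = 0"
  proof (rule ccontr)
    assume "r t0 \<noteq> 0"
    \<comment> \<open>Testing in the direction \<open>w = r t0\<close> makes the integrand positive
      in the interior of a small interval around \<open>t0\<close>.\<close>
    let ?h = "\<lambda>t. r t \<bullet> r t0"
    have ch: "continuous_on J ?h" by (intro continuous_intros contr)
    have "open (J \<inter> ?h -` {0<..})" by (rule continuous_open_preimage[OF ch J]) auto
    moreover have "t0 \<in> J \<inter> ?h -` {0<..}" using t0 \<open>r t0 \<noteq> 0\<close> by auto
    ultimately obtain e where e: "e > 0" "cball t0 e \<subseteq> J \<inter> ?h -` {0<..}" using open_contains_cball by blast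
    have sub: "{t0 - e..t0 + e} \<subseteq> J \<inter> ?h -` {0<..}" using e by (simp add: cball_eq_atLeastAtMost)
    have "\<forall>t\<in>{t0 - e..t0 + e}. (t - (t0 - e)) * (t0 + e - t) * ?h t = 0"
    proof (rule integral_eq_0_iff[THEN iffD1])
      show "continuous_on {t0 - e..t0 + e} (\<lambda>t. (t - (t0 - e)) * (t0 + e - t) * ?h t)"
        by (intro continuous_intros continuous_on_subset[OF contr]) (use sub in auto)
      show "0 \<le> (t - (t0 - e)) * (t0 + e - t) * ?h t" if "t \<in> {t0 - e..t0 + e}" for t
        using that sub by (intro mult_nonneg_nonneg) (auto simp: subset_iff less_imp_le)
      show "integral {t0 - e..t0 + e} (\<lambda>t. (t - (t0 - e)) * (t0 + e - t) * ?h t) = 0"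
        by (rule zero) (use e sub in auto)
    qed (use e in auto)
    from bspec[OF this, of t0] e(1) \<open>r t0 \<noteq> 0\<close> show False by auto
  qed
  have "y' t0 = G (?Z t0)"
    by (rule G_unique[OF slit[OF t0]]) (use r0 in \<open>simp add: r_def\<close>)
  then show ?thesis
    using xy[OF t0] y'[OF t0] unfolding spray_def has_vector_derivative_def
    by (auto intro!: has_derivative_eq_rhs[OF has_derivative_Pair])
qed

subsection \<open>Calibration\<close>

text \<open>\<open>L = f^2 / 2\<close> gives \<open>dL = f df\<close>, so the two differentials
  agree at unit vectors.\<close>

lemma fd_f:
  assumes "z \<in> slit" "f z = 1"
  shows "frechet_derivative f (at z) (h, k) = q z \<bullet> h + p z \<bullet> k"
proof -
  have "(f has_derivative frechet_derivative f (at z)) (at z)"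
    by (rule smooth_on_has_derivative[OF smooth_f_slit assms(1)])
  from has_derivative_mult[OF this this] have "((\<lambda>z. f z * f z) has_derivative (\<lambda>v. 2 * frechet_derivative f (at z) v)) (at z)"
    by (simp add: assms(2))
  from has_derivative_mult_right[OF this, of "1/2"] have "(L has_derivative frechet_derivative f (at z)) (at z)"
    by (simp add: L_def[abs_def] power2_eq_square)
  then have "frechet_derivative L (at z) = frechet_derivative f (at z)" by (metis frechet_derivative_at)
  then show ?thesis using fd_L[OF assms(1)] by metis
qed

text \<open>The minimum of \<open>f\<close> over \<open>C\<close> times the unit sphere, extended by
  homogeneity. The constant converts Euclidean errors into multiples of \<open>f\<close> in the
  calibration and measures the cost of crossing an annulus.\<close>

lemma f_lower_bound:
  assumes "compact C" "C \<subseteq> D"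
  obtains m where "m > 0" "\<And>x w. x \<in> C \<Longrightarrow> m * norm w \<le> f (x, w)"
proof (cases "C = {}")
  case True
  then show ?thesis using that[of 1] by simp
next
  case False
  let ?C = "C \<times> sphere (0::'e) 1"
  have "\<exists>z0\<in>?C. \<forall>z\<in>?C. f z0 \<le> f z"
    using False assms by (intro continuous_attains_inf compact_Times compact_sphere continuous_on_subset[OF cont_f]) auto
  then obtain z0 where z0: "z0 \<in> ?C" "\<And>z. z \<in> ?C \<Longrightarrow> f z0 \<le> f z" by blast
  have "fst z0 \<in> D" "snd z0 \<noteq> 0" using z0(1) assms(2) by auto
  then have "f z0 > 0" using f_pos[of "fst z0" "snd z0"] by simp
  moreover have "f z0 * norm w \<le> f (x, w)" if x: "x \<in> C" for x w
  proof (cases "w = 0")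
    case True
    then show ?thesis using f_zero assms x by auto
  next
    case False
    have "f z0 \<le> f (x, w /\<^sub>R norm w)" using z0(2) x False by auto
    also have "\<dots> = f (x, w) / norm w" using f_scale[of x w "inverse (norm w)"] x assms False
      by (auto simp: divide_inverse mult.commute)
    finally show ?thesis using False by (simp add: pos_le_divide_eq)
  qed
  ultimately show ?thesis by (rule that)
qed

text \<open>The covector \<open>p (\<xi>, \<eta>) - k y\<close> differs by \<open>O(\<bar>y\<bar>\<^sup>2)\<close> from the Legendre transform
  of \<open>\<eta> + u\<close> at \<open>x\<close>, where \<open>u\<close> solves the linearised equation; this reduces the claim to the
  fundamental inequality.\<close>

lemma calibration_inequality:
  assumes R: "cball x0 R \<times> cball y0 R \<subseteq> slit" "R > 0"
  obtains r K where "0 < r" "r \<le> R" "K > 0"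
    "\<And>\<xi> \<eta> x k w. \<xi> \<in> cball x0 r \<Longrightarrow> \<eta> \<in> cball y0 r \<Longrightarrow> f (\<xi>, \<eta>) = 1 \<Longrightarrow> x \<in> cball x0 r \<Longrightarrow>
      0 \<le> k \<Longrightarrow> k \<le> 1 \<Longrightarrow>
      p (\<xi>, \<eta>) \<bullet> w - k * ((x - \<xi>) \<bullet> w) \<le>
      (1 - q (\<xi>, \<eta>) \<bullet> (x - \<xi>) - k * (\<eta> \<bullet> (x - \<xi>)) + K / 2 * (norm (x - \<xi>))\<^sup>2) * f (x, w)"
proof -
  let ?C = "cball x0 R \<times> cball y0 R"
  have C: "compact ?C" "convex ?C" "?C \<subseteq> slit"
    using R by (auto intro!: compact_Times convex_Times)
  have RD: "cball x0 R \<subseteq> D" using R by (auto simp: slit_def times_subset_iff)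
  obtain \<mu> where \<mu>: "\<mu> > 0" "\<And>z u. z \<in> ?C \<Longrightarrow> \<mu> * norm u \<le> norm (Dp z (0, u))"
  proof (rule coercive_on_compact[of ?C "\<lambda>z u. Dp z (0, u)"])
    show "continuous_on ?C (\<lambda>z. Dp z (0, u))" for u
      using continuous_on_subset[OF smooth_on_imp_continuous[OF smooth_on_derivative[OF smooth_p]] C(3)] .
    show "0 < Dp z (0, u) \<bullet> u" if "z \<in> ?C" "u \<noteq> 0" for z u
      using Dp_posdef[of "fst z" "snd z" u] that(2) subsetD[OF C(3) that(1)] by (cases z) auto
  qed (use C linear_Dp_vertical in auto)
  obtain Kd where Kd: "Kd \<ge> 0" "\<And>z v. z \<in> ?C \<Longrightarrow> norm (Dp z v) \<le> Kd * norm v"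
    using smooth_on_derivative_bound[OF open_slit smooth_p C(1,3)] by metis
  obtain Kp where Kp: "Kp \<ge> 0" "\<And>z z'. z \<in> ?C \<Longrightarrow> z' \<in> ?C \<Longrightarrow>
      norm (p z' - p z - Dp z (z' - z)) \<le> Kp * (norm (z' - z))\<^sup>2"
    using smooth_on_taylor_compact[OF open_slit smooth_p C] by metis
  obtain Kf where Kf: "Kf \<ge> 0" "\<And>z z'. z \<in> ?C \<Longrightarrow> z' \<in> ?C \<Longrightarrow>
      norm (f z' - f z - frechet_derivative f (at z) (z' - z)) \<le> Kf * (norm (z' - z))\<^sup>2"
    using smooth_on_taylor_compact[OF open_slit smooth_f_slit C] by metis
  obtain m where m: "m > 0" "\<And>x w. x \<in> cball x0 R \<Longrightarrow> m * norm w \<le> f (x, w)"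
    using f_lower_bound[OF compact_cball RD] by metis
  \<comment> \<open>\<open>A\<close> bounds the correction, \<open>norm u \<le> A * norm y\<close>;
    \<open>Q\<close> bounds the squared norm of \<open>(y, u)\<close> by that of \<open>y\<close>;
    \<open>K / 2\<close> exceeds the sum of the two second-order errors; \<open>r\<close> keeps
    \<open>\<eta> + u\<close> in the ball of radius \<open>R\<close>. The 1 in \<open>A\<close>
    bounds \<open>k\<close>, so none of these depends on \<open>k\<close>.\<close>
  define A where "A = (1 + Kd) / \<mu>"
  define Q where "Q = 1 + A\<^sup>2"
  define K where "K = 2 * (Kf * Q + Kp * Q / m) + 1"
  define r where "r = min (R / 2) (R / (4 * (A + 1)))"
  have A: "A \<ge> 0" using \<mu>(1) Kd(1) by (simp add: A_def)
  have Q: "Q \<ge> 1" by (simp add: Q_def)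
  have K: "K > 0" using Kf Kp Q m by (simp add: K_def add_nonneg_pos)
  have "0 < R / (4 * (A + 1))" using R(2) A by (intro divide_pos_pos) auto
  then have r: "r \<le> R / 2" "0 < r" using R(2) unfolding r_def by (simp_all only: min.cobounded1 min_less_iff_conj) simp
  have "r * (A + 1) \<le> R / (4 * (A + 1)) * (A + 1)" unfolding r_def using A by (intro mult_right_mono) auto
  also have "\<dots> = R / 4" using A by (simp add: field_simps)
  finally have rA: "r * (A + 1) \<le> R / 4" .
  show ?thesis
  proof (rule that[of r K])
    show "0 < r" "r \<le> R" "K > 0" using r R K by auto
    fix \<xi> \<eta> x w :: 'e and k :: real
    assume \<xi>: "\<xi> \<in> cball x0 r" and \<eta>: "\<eta> \<in> cball y0 r" and f1: "f (\<xi>, \<eta>) = 1" and x: "x \<in> cball x0 r"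
      and k: "0 \<le> k" "k \<le> 1"
    define y where "y = x - \<xi>"
    let ?z = "(\<xi>, \<eta>)"
    have zC: "?z \<in> ?C" using \<xi> \<eta> r by auto
    then have zs: "?z \<in> slit" using C(3) by blast
    \<comment> \<open>With this \<open>u\<close> the derivative of \<open>p\<close> in direction
      \<open>(y, u)\<close> is \<open>- k y\<close>: at base point \<open>x\<close> and vector
      \<open>\<eta> + u\<close> the momentum is \<open>p - k y\<close> up to second order.\<close>
    obtain u where u: "Dp ?z (0, u) = - (k *\<^sub>R y) - Dp ?z (y, 0)"
      using surjD[OF surj_Dp_vertical[OF zs]] by metis
    have "\<mu> * norm u \<le> norm (Dp ?z (0, u))" by (rule \<mu>(2)[OF zC])
    also have "\<dots> \<le> norm (k *\<^sub>R y) + norm (Dp ?z (y, 0))" unfolding u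
      using norm_triangle_ineq4[of "- (k *\<^sub>R y)" "Dp ?z (y, 0)"] by simp
    also have "\<dots> \<le> 1 * norm y + Kd * norm y"
      using k Kd(2)[OF zC, of "(y, 0)"] mult_right_mono[OF k(2) norm_ge_zero[of y]]
      by (intro add_mono) (auto simp: norm_Pair)
    finally have uA: "norm u \<le> A * norm y" using \<mu>(1) by (simp add: A_def field_simps)
    have "norm y \<le> dist \<xi> x0 + dist x0 x" unfolding y_def using dist_triangle[of \<xi> x x0] by (simp add: dist_norm norm_minus_commute)
    then have y2: "norm y \<le> 2 * r" using \<xi> x by (simp add: dist_commute)
    have "norm u \<le> A * (2 * r)" using uA mult_left_mono[OF y2 A] by linarith
    also have "\<dots> \<le> R / 2" using rA r(2) by (simp add: algebra_simps)
    finally have uR: "norm u \<le> R / 2" .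
    let ?z' = "(x, \<eta> + u)"
    have "dist y0 (\<eta> + u) \<le> dist y0 \<eta> + norm u" by (metis add_diff_cancel_left' dist_norm dist_triangle norm_minus_commute)
    then have z'C: "?z' \<in> ?C" using x \<eta> r uR by auto
    have dz: "?z' - ?z = (y, u)" by (simp add: y_def)
    have "(norm (y, u))\<^sup>2 = (norm y)\<^sup>2 + (norm u)\<^sup>2" by (simp add: norm_Pair)
    also have "(norm u)\<^sup>2 \<le> (A * norm y)\<^sup>2" using uA by (intro power_mono) auto
    finally have nQ: "(norm (y, u))\<^sup>2 \<le> Q * (norm y)\<^sup>2" by (simp add: Q_def power_mult_distrib algebra_simps)
    define e where "e = p ?z' - p ?z - Dp ?z (y, u)"
    have "norm e \<le> Kp * (norm (y, u))\<^sup>2" using Kp(2)[OF zC z'C] unfolding e_def dz .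
    also have "\<dots> \<le> Kp * (Q * (norm y)\<^sup>2)" by (intro mult_left_mono nQ Kp)
    finally have e: "norm e \<le> Kp * Q * (norm y)\<^sup>2" by simp
    have "p ?z' = p ?z - k *\<^sub>R y + e" using Dp_add[OF zs, of y u] u by (simp add: e_def)
    then have "p ?z \<bullet> w - k * (y \<bullet> w) = p ?z' \<bullet> w - e \<bullet> w" by (simp add: inner_add_left inner_diff_left)
    also have "\<dots> \<le> f ?z' * f (x, w) + norm e * norm w"
    proof -
      have "p ?z' \<bullet> w \<le> f ?z' * f (x, w)"
        using fundamental_inequality[of x "\<eta> + u" w] subsetD[OF C(3) z'C] by auto
      moreover have "- (e \<bullet> w) \<le> norm e * norm w" using Cauchy_Schwarz_ineq2[of e w] by linarith
      ultimately show ?thesis by linarith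
    qed
    also have "norm e * norm w \<le> (Kp * Q * (norm y)\<^sup>2) * (f (x, w) / m)"
    proof (intro mult_mono e)
      show "norm w \<le> f (x, w) / m" using m x r by (simp add: pos_le_divide_eq mult.commute)
      show "0 \<le> Kp * Q * (norm y)\<^sup>2" using Kp Q by auto
    qed auto
    finally have 1: "p ?z \<bullet> w - k * (y \<bullet> w) \<le> (f ?z' + Kp * Q / m * (norm y)\<^sup>2) * f (x, w)"
      by (simp add: algebra_simps)
    \<comment> \<open>The first-order change of \<open>f\<close> is
      \<open>q \<bullet> y + p \<bullet> u\<close>. By this identity it becomes
      \<open>- q \<bullet> y - k (\<eta> \<bullet> y)\<close>, exactly the linear terms of the
      claim.\<close>
    have "p ?z \<bullet> u = Dp ?z (0, u) \<bullet> \<eta>" using Dp_snd[OF zs, of 0 u] by simp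
    also have "\<dots> = - (k * (\<eta> \<bullet> y)) - 2 * (q ?z \<bullet> y)"
      unfolding u using Dp_snd[OF zs, of y 0] by (simp add: inner_diff_left inner_commute[of y \<eta>])
    finally have pu: "p ?z \<bullet> u = - (k * (\<eta> \<bullet> y)) - 2 * (q ?z \<bullet> y)" .
    have "\<bar>f ?z' - f ?z - frechet_derivative f (at ?z) (y, u)\<bar> \<le> Kf * (norm (y, u))\<^sup>2"
      using Kf(2)[OF zC z'C] unfolding dz by simp
    also have "\<dots> \<le> Kf * (Q * (norm y)\<^sup>2)" by (intro mult_left_mono nQ Kf)
    finally have "f ?z' \<le> 1 - q ?z \<bullet> y - k * (\<eta> \<bullet> y) + Kf * Q * (norm y)\<^sup>2"
      unfolding fd_f[OF zs f1] pu f1 by simp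
    then have "f ?z' + Kp * Q / m * (norm y)\<^sup>2 \<le> 1 - q ?z \<bullet> y - k * (\<eta> \<bullet> y) + (Kf * Q + Kp * Q / m) * (norm y)\<^sup>2"
      by (simp add: algebra_simps)
    also have "\<dots> \<le> 1 - q ?z \<bullet> y - k * (\<eta> \<bullet> y) + K / 2 * (norm y)\<^sup>2"
    proof (intro add_left_mono mult_right_mono)
      have "c \<le> (2 * c + 1) / 2" for c :: real by simp
      then show "Kf * Q + Kp * Q / m \<le> K / 2" unfolding K_def .
    qed auto
    finally have 2: "f ?z' + Kp * Q / m * (norm y)\<^sup>2 \<le> 1 - q ?z \<bullet> y - k * (\<eta> \<bullet> y) + K / 2 * (norm y)\<^sup>2" .
    have "0 \<le> f (x, w)" using f_nonneg z'C subsetD[OF RD, of x] by auto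
    from order_trans[OF 1 mult_right_mono[OF 2 this]]
    show "p ?z \<bullet> w - k * ((x - \<xi>) \<bullet> w) \<le>
      (1 - q ?z \<bullet> (x - \<xi>) - k * (\<eta> \<bullet> (x - \<xi>)) + K / 2 * (norm (x - \<xi>))\<^sup>2) * f (x, w)"
      unfolding y_def .
  qed
qed

end

subsection \<open>Local minimality\<close>

context finsler_chart
begin

text \<open>What remains of a piecewise smooth curve in coordinates. Outside the finite set
  \<open>E\<close> the curve is differentiable with speed \<open>g\<close>, and \<open>g\<close> is
  continuous, so that arc length has derivative \<open>g\<close> there. On \<open>E\<close> nothing
  ties \<open>g\<close> to the curve.\<close>

definition speed_of :: "real \<Rightarrow> real \<Rightarrow> (real \<Rightarrow> 'e) \<Rightarrow> (real \<Rightarrow> real) \<Rightarrow> bool" where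
  "speed_of a b c g \<longleftrightarrow> a \<le> b \<and> continuous_on {a..b} c \<and> g integrable_on {a..b} \<and>
    (\<forall>t\<in>{a..b}. 0 \<le> g t) \<and>
    (\<exists>E. finite E \<and> (\<forall>t\<in>{a<..<b} - E. isCont g t \<and>
      (\<exists>v. (c has_vector_derivative v) (at t) \<and> g t = f (c t, v))))"

text \<open>The component of the velocity along the displacement integrates to the length of the
  displacement, and \<open>g\<close> dominates \<open>m\<close> times that component.\<close>

lemma speed_of_displacement:
  assumes g: "speed_of a b c g" and m: "m > 0"
    and lb: "\<And>t w. t \<in> {a..b} \<Longrightarrow> m * norm w \<le> f (c t, w)"
  shows "m * norm (c b - c a) \<le> integral {a..b} g"
proof (cases "c b = c a")
  case True
  then show ?thesis using g by (auto simp: speed_of_def intro!: Henstock_Kurzweil_Integration.integral_nonneg)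
next
  case False
  obtain E where ab: "a \<le> b" and c: "continuous_on {a..b} c" and gi: "g integrable_on {a..b}"
    and E: "finite E" "\<forall>t\<in>{a<..<b} - E. \<exists>v. (c has_vector_derivative v) (at t) \<and> g t = f (c t, v)"
    using g unfolding speed_of_def by metis
  obtain c' where c': "\<And>t. t \<in> {a<..<b} - E \<Longrightarrow> (c has_vector_derivative c' t) (at t) \<and> g t = f (c t, c' t)"
    using E(2) by metis
  define e where "e = (c b - c a) /\<^sub>R norm (c b - c a)"
  have ne: "norm e = 1" using False by (simp add: e_def)
  have "((\<lambda>t. c' t \<bullet> e) has_integral c b \<bullet> e - c a \<bullet> e) {a..b}"
    by (rule fundamental_theorem_of_calculus_interior_strong[OF E(1) ab])
      (use c' c in \<open>auto intro!: bounded_linear.has_vector_derivative[OF bounded_linear_inner_left] continuous_intros\<close>)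
  moreover have "c b \<bullet> e - c a \<bullet> e = norm (c b - c a)"
  proof -
    have "c b \<bullet> e - c a \<bullet> e = (c b - c a) \<bullet> e" by (simp add: inner_diff_left)
    also have "\<dots> = norm (c b - c a)" using False by (simp add: e_def dot_square_norm power2_eq_square)
    finally show ?thesis .
  qed
  ultimately have i1: "((\<lambda>t. m * (c' t \<bullet> e)) has_integral m * norm (c b - c a)) {a..b}"
    using has_integral_mult_right by metis
  \<comment> \<open>Where \<open>g\<close> says nothing about the curve, the integrand is replaced
    by the lower bound itself; this changes it on a finite set only.\<close>
  have "m * norm (c b - c a) \<le> integral {a..b} (\<lambda>t. if t \<in> {a<..<b} - E then g t else m * (c' t \<bullet> e))"
  proof (rule has_integral_le[OF i1 integrable_integral])
    show "(\<lambda>t. if t \<in> {a<..<b} - E then g t else m * (c' t \<bullet> e)) integrable_on {a..b}"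
      by (rule integrable_spike_finite[OF _ _ gi, of "E \<union> {a, b}"]) (use E(1) in auto)
    fix t assume t: "t \<in> {a..b}"
    show "m * (c' t \<bullet> e) \<le> (if t \<in> {a<..<b} - E then g t else m * (c' t \<bullet> e))"
    proof (cases "t \<in> {a<..<b} - E")
      case True
      have "m * (c' t \<bullet> e) \<le> m * norm (c' t)" using norm_cauchy_schwarz[of "c' t" e] ne m by simp
      also have "\<dots> \<le> g t" using lb[OF t, of "c' t"] c'[OF True] by simp
      finally show ?thesis using True by simp
    qed auto
  qed
  also have "\<dots> = integral {a..b} g"
    by (rule integral_spike[of "E \<union> {a, b}"]) (use E(1) in \<open>auto intro: negligible_finite\<close>)
  finally show ?thesis .
qed

text \<open>\<open>K * T \<le> 1\<close> keeps the coefficient \<open>k = K s\<close> in the range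
  of \<open>ineq\<close>. With \<open>l\<close> the length assumed to be less than \<open>T\<close>,
  \<open>small\<close> makes \<open>u (l, x t)\<close> increase as \<open>t\<close> runs from
  \<open>l\<close> to \<open>T\<close>; \<open>P\<close>, \<open>B\<close> and \<open>Y\<close>
  bound momentum, acceleration and velocity.\<close>

lemma calibration:
  assumes K: "K > 0"
    and ineq: "\<And>\<xi> \<eta> x k w. \<xi> \<in> cball x0 r \<Longrightarrow> \<eta> \<in> cball y0 r \<Longrightarrow> f (\<xi>, \<eta>) = 1 \<Longrightarrow> x \<in> cball x0 r \<Longrightarrow>
      0 \<le> k \<Longrightarrow> k \<le> 1 \<Longrightarrow>
      p (\<xi>, \<eta>) \<bullet> w - k * ((x - \<xi>) \<bullet> w) \<le>
      (1 - q (\<xi>, \<eta>) \<bullet> (x - \<xi>) - k * (\<eta> \<bullet> (x - \<xi>)) + K / 2 * (norm (x - \<xi>))\<^sup>2) * f (x, w)"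
    and sub: "cball x0 r \<times> cball y0 r \<subseteq> slit"
    and z: "\<And>t. t \<in> {-\<tau><..<\<tau>} \<Longrightarrow> (z has_vector_derivative spray (z t)) (at t)"
      "\<And>t. t \<in> {-\<tau><..<\<tau>} \<Longrightarrow> z t \<in> cball x0 r \<times> cball y0 r"
    and f1: "f (z 0) = 1" and T: "0 < T" "T < \<tau>" "K * T \<le> 1"
    and P: "\<And>w. w \<in> cball x0 r \<times> cball y0 r \<Longrightarrow> norm (p w) \<le> P" "0 \<le> P"
    and B: "\<And>w. w \<in> cball x0 r \<times> cball y0 r \<Longrightarrow> norm (G w) \<le> B"
    and Y: "\<And>w. w \<in> cball x0 r \<times> cball y0 r \<Longrightarrow> norm (snd w) \<le> Y" "0 \<le> Y"
    and small: "T * (P * B + Y\<^sup>2) < 1"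
    and g: "speed_of a b c g" and cD: "\<And>t. t \<in> {a..b} \<Longrightarrow> c t \<in> cball x0 r"
    and start: "p (z 0) \<bullet> (c a - fst (z 0)) \<le> 0" and fin: "c b = fst (z T)"
  shows "T \<le> integral {a..b} g"
proof (rule ccontr)
  let ?I = "{-\<tau><..<\<tau>}"
  define l where "l = integral {a..b} g"
  assume "\<not> T \<le> integral {a..b} g"
  \<comment> \<open>The indirect assumption also keeps the arc length below \<open>T\<close>, so
    that the geodesic is defined at every parameter \<open>s t\<close>.\<close>
  then have lT: "l < T" by (simp add: l_def)
  let ?x = "\<lambda>t. fst (z t)" and ?y = "\<lambda>t. snd (z t)"
  have zs: "z t \<in> slit" if "t \<in> ?I" for t by (rule subsetD[OF sub z(2)[OF that]])
  have dx: "(?x has_vector_derivative ?y t) (at t)" and dy: "(?y has_vector_derivative G (z t)) (at t)"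
    and dp: "((\<lambda>t. p (z t)) has_vector_derivative q (z t)) (at t)" if "t \<in> ?I" for t
    using spray_curve[OF z(1)[OF that]] spray_euler_lagrange[OF z(1)[OF that] zs[OF that]] by auto
  have f1: "f (z t) = 1" if "t \<in> ?I" for t
    using spray_speed_constant[of "-\<tau>" \<tau> z t 0, OF z(1) zs that] f1 T by auto
  have py: "p (z t) \<bullet> ?y t = 1" if "t \<in> ?I" for t
    using euler[of "?x t" "?y t"] zs[OF that] f1[OF that] by (cases "z t") (auto simp: L_def)
  obtain E where ab: "a \<le> b" and c: "continuous_on {a..b} c" and gi: "g integrable_on {a..b}"
    and g0: "\<forall>t\<in>{a..b}. 0 \<le> g t" and E: "finite E"
    "\<forall>t\<in>{a<..<b} - E. isCont g t \<and> (\<exists>v. (c has_vector_derivative v) (at t) \<and> g t = f (c t, v))"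
    using g unfolding speed_of_def by metis
  obtain c' where c': "\<And>t. t \<in> {a<..<b} - E \<Longrightarrow> (c has_vector_derivative c' t) (at t) \<and> g t = f (c t, c' t)"
    using E(2) by metis
  define s where "s t = integral {a..t} g" for t
  have s_range: "0 \<le> s t" "s t \<le> l" if "t \<in> {a..b}" for t
  proof -
    have gt: "g integrable_on {a..t}" "g integrable_on {t..b}"
      using integrable_subinterval_real[OF gi] that by auto
    show "0 \<le> s t" unfolding s_def using g0 that gt by (intro integral_nonneg) auto
    have "0 \<le> integral {t..b} g" using g0 that gt by (intro integral_nonneg) auto
    then show "s t \<le> l" unfolding s_def l_def
      using Henstock_Kurzweil_Integration.integral_combine[OF _ _ gi, of t] that by simp
  qed
  have sI: "s t \<in> ?I" if "t \<in> {a..b}" for t using s_range[OF that] lT T by auto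
  have s_cont: "continuous_on {a..b} s" unfolding s_def by (rule indefinite_integral_continuous_1[OF gi])
  have s_der: "(s has_real_derivative g t) (at t)" if t: "t \<in> {a<..<b} - E" for t
  proof -
    have "((\<lambda>u. integral {a..u} g) has_vector_derivative g t) (at t within ({a..b} - {}))"
      using t E(2) by (intro integral_has_vector_derivative_continuous_at[OF gi])
        (auto intro: continuous_at_imp_continuous_at_within)
    moreover have "at t within {a..b} = at t" using t by (intro at_within_interior) auto
    ultimately show ?thesis unfolding s_def[abs_def] by (simp add: has_real_derivative_iff_has_vector_derivative)
  qed
  define y where "y t = c t - ?x (s t)" for t
  \<comment> \<open>\<open>\<phi>\<close> is \<open>u\<close> along the curve, with arc length as
    time; \<open>\<phi>'\<close> is its derivative, using \<open>x' = y\<close> and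
    \<open>p' = q\<close>.\<close>
  define \<phi> where "\<phi> t = p (z (s t)) \<bullet> y t - K / 2 * (s t * (y t \<bullet> y t))" for t
  define \<phi>' where "\<phi>' t = p (z (s t)) \<bullet> (c' t - g t *\<^sub>R ?y (s t)) + (g t *\<^sub>R q (z (s t))) \<bullet> y t
    - K / 2 * (g t * (y t \<bullet> y t) + s t * (2 * (y t \<bullet> (c' t - g t *\<^sub>R ?y (s t)))))" for t
  have z_cont: "continuous_on ?I z"
    by (intro continuous_at_imp_continuous_on ballI has_vector_derivative_continuous[OF z(1)])
  have pz_cont: "continuous_on ?I (\<lambda>t. p (z t))"
    by (intro continuous_at_imp_continuous_on ballI has_vector_derivative_continuous[OF dp])
  have \<phi>_cont: "continuous_on {a..b} \<phi>"
    unfolding \<phi>_def y_def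
    by (intro continuous_intros c s_cont continuous_on_compose2[OF z_cont s_cont] continuous_on_compose2[OF pz_cont s_cont])
      (use sI in auto)
  have \<phi>_der: "(\<phi> has_vector_derivative \<phi>' t) (at t)" if t: "t \<in> {a<..<b} - E" for t
  proof -
    have st: "s t \<in> ?I" using sI t by auto
    have comp: "((\<lambda>t. h (s t)) has_vector_derivative g t *\<^sub>R d) (at t)"
      if "(h has_vector_derivative d) (at (s t))" for h :: "real \<Rightarrow> 'e" and d
      using vector_diff_chain_at[of s "g t" t h d] s_der[OF t] that
      by (simp add: has_real_derivative_iff_has_vector_derivative o_def)
    have yd: "(y has_vector_derivative c' t - g t *\<^sub>R ?y (s t)) (at t)"
      unfolding y_def using c'[OF t] comp[OF dx[OF st]] by (auto intro!: has_vector_derivative_diff)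
    have 1: "((\<lambda>t. p (z (s t)) \<bullet> y t) has_vector_derivative
        p (z (s t)) \<bullet> (c' t - g t *\<^sub>R ?y (s t)) + (g t *\<^sub>R q (z (s t))) \<bullet> y t) (at t)"
      by (rule bounded_bilinear.has_vector_derivative[OF bounded_bilinear_inner comp[OF dp[OF st]] yd])
    have "((\<lambda>t. y t \<bullet> y t) has_vector_derivative 2 * (y t \<bullet> (c' t - g t *\<^sub>R ?y (s t)))) (at t)"
      using bounded_bilinear.has_vector_derivative[OF bounded_bilinear_inner yd yd] by (simp add: inner_commute)
    moreover have "(s has_vector_derivative g t) (at t)"
      using s_der[OF t] by (simp add: has_real_derivative_iff_has_vector_derivative)
    ultimately have "((\<lambda>t. s t * (y t \<bullet> y t)) has_vector_derivative
        g t * (y t \<bullet> y t) + s t * (2 * (y t \<bullet> (c' t - g t *\<^sub>R ?y (s t))))) (at t)"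
      using bounded_bilinear.has_vector_derivative[OF bounded_bilinear_mult, of s "g t" t UNIV
          "\<lambda>t. y t \<bullet> y t" "2 * (y t \<bullet> (c' t - g t *\<^sub>R ?y (s t)))"]
      by (simp only: add.commute)
    from has_vector_derivative_diff[OF 1 bounded_linear.has_vector_derivative[OF bounded_linear_mult_right this]]
    show ?thesis unfolding \<phi>_def \<phi>'_def .
  qed
  have \<phi>'_le: "\<phi>' t \<le> 0" if t: "t \<in> {a<..<b} - E" for t
  proof -
    have tab: "t \<in> {a..b}" and st: "s t \<in> ?I" using sI t by auto
    have box: "?x (s t) \<in> cball x0 r" "?y (s t) \<in> cball y0 r" using z(2)[OF st] by (cases "z (s t)", auto)+
    have k: "0 \<le> K * s t" "K * s t \<le> 1"
    proof -
      show "0 \<le> K * s t" using s_range(1)[OF tab] K by simp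
      have "s t \<le> T" using s_range(2)[OF tab] lT by simp
      then have "K * s t \<le> K * T" using K by simp
      then show "K * s t \<le> 1" using T(3) by simp
    qed
    \<comment> \<open>The calibration inequality at \<open>\<xi> = x (s t)\<close>,
      \<open>\<eta> = y (s t)\<close> and \<open>k = K * s t\<close>. The constant 1 is then written
      as \<open>p \<bullet> y\<close>, valid along the unit speed geodesic, and the claim is a
      rearrangement.\<close>
    have "p (z (s t)) \<bullet> c' t - K * s t * (y t \<bullet> c' t) \<le>
      (1 - q (z (s t)) \<bullet> y t - K * s t * (?y (s t) \<bullet> y t) + K / 2 * (norm (y t))\<^sup>2) * f (c t, c' t)"
      using ineq[OF box _ cD[OF tab] k, of "c' t"] f1[OF st] by (simp add: y_def)
    then have "p (z (s t)) \<bullet> c' t - K * s t * (y t \<bullet> c' t) \<le>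
      (p (z (s t)) \<bullet> ?y (s t) - q (z (s t)) \<bullet> y t - K * s t * (?y (s t) \<bullet> y t) + K / 2 * (y t \<bullet> y t)) * g t"
      using c'[OF t] py[OF st] by (simp add: dot_square_norm)
    then show ?thesis unfolding \<phi>'_def by (simp add: algebra_simps inner_diff_right inner_commute)
  qed
  have "(\<phi>' has_integral \<phi> b - \<phi> a) {a..b}"
    by (rule fundamental_theorem_of_calculus_interior_strong[OF E(1) ab \<phi>_der \<phi>_cont])
  then have "((\<lambda>t. if t \<in> {a<..<b} - E then \<phi>' t else 0) has_integral \<phi> b - \<phi> a) {a..b}"
    by (rule has_integral_spike_finite[of "E \<union> {a, b}", rotated 2]) (use E(1) in auto)
  then have "\<phi> b - \<phi> a \<le> 0"
    by (rule has_integral_le[OF _ has_integral_0]) (use \<phi>'_le in auto)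
  moreover have "\<phi> a \<le> 0" using start by (simp add: \<phi>_def s_def y_def)
  ultimately have \<phi>b: "\<phi> b \<le> 0" by linarith
  have l0: "0 \<le> l" "l \<in> ?I" using s_range[of b] sI[of b] ab by (auto simp: s_def l_def)
  \<comment> \<open>\<open>u (l, x t)\<close> as a function of \<open>t\<close>: zero at
    \<open>t = l\<close>, and equal to \<open>\<phi> b\<close> at \<open>t = T\<close> since the
    curve ends at \<open>x T\<close>. Its derivative differs from 1 by at most
    \<open>(t - l) (P B + Y^2)\<close>.\<close>
  let ?h = "\<lambda>t. p (z l) \<bullet> (?x t - ?x l) - K / 2 * (l * ((?x t - ?x l) \<bullet> (?x t - ?x l)))"
  have "?h l < ?h T"
  proof (rule DERIV_pos_imp_increasing[where f = ?h, OF lT])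
    fix t assume t: "l \<le> t" "t \<le> T"
    then have tI: "t \<in> ?I" using l0 T by auto
    have tlI: "{l..t} \<subseteq> ?I" using tI l0 by auto
    have lip: "norm (?x t - ?x l) \<le> Y * norm (t - l)"
    proof (rule differentiable_bound[of "{l..t}" _ "\<lambda>s h. h *\<^sub>R ?y s"])
      show "(?x has_derivative (\<lambda>h. h *\<^sub>R ?y s)) (at s within {l..t})" if "s \<in> {l..t}" for s
        using dx[OF subsetD[OF tlI that]] by (simp add: has_vector_derivative_def has_derivative_at_withinI)
      show "onorm (\<lambda>h. h *\<^sub>R ?y s) \<le> Y" if "s \<in> {l..t}" for s
      proof (rule onorm_bound[OF Y(2)])
        show "norm (h *\<^sub>R ?y s) \<le> Y * norm h" for h
          using mult_right_mono[OF Y(1)[OF z(2)[OF subsetD[OF tlI that]]] abs_ge_zero[of h]] by (simp add: mult.commute)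
      qed
    qed (use t in auto)
    have B0: "0 \<le> B" using B[OF z(2)[OF l0(2)]] norm_ge_zero order_trans by blast
    have lip2: "norm (?y t - ?y l) \<le> B * norm (t - l)"
    proof (rule differentiable_bound[of "{l..t}" _ "\<lambda>s h. h *\<^sub>R G (z s)"])
      show "(?y has_derivative (\<lambda>h. h *\<^sub>R G (z s))) (at s within {l..t})" if "s \<in> {l..t}" for s
        using dy[OF subsetD[OF tlI that]] by (simp add: has_vector_derivative_def has_derivative_at_withinI)
      show "onorm (\<lambda>h. h *\<^sub>R G (z s)) \<le> B" if "s \<in> {l..t}" for s
      proof (rule onorm_bound[OF B0])
        show "norm (h *\<^sub>R G (z s)) \<le> B * norm h" for h
          using mult_right_mono[OF B[OF z(2)[OF subsetD[OF tlI that]]] abs_ge_zero[of h]] by (simp add: mult.commute)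
      qed
    qed (use t in auto)
    let ?d = "p (z l) \<bullet> ?y t - K / 2 * (l * (2 * ((?x t - ?x l) \<bullet> ?y t)))"
    have xd: "((\<lambda>t. ?x t - ?x l) has_vector_derivative ?y t) (at t)"
      using has_vector_derivative_diff[OF dx[OF tI] has_vector_derivative_const[of "?x l"]] by simp
    have "((\<lambda>t. (?x t - ?x l) \<bullet> (?x t - ?x l)) has_vector_derivative 2 * ((?x t - ?x l) \<bullet> ?y t)) (at t)"
      using bounded_bilinear.has_vector_derivative[OF bounded_bilinear_inner xd xd] by (simp add: inner_commute)
    then have "(?h has_vector_derivative ?d) (at t)"
      by (intro has_vector_derivative_diff bounded_linear.has_vector_derivative[OF bounded_linear_mult_right]
          bounded_linear.has_vector_derivative[OF bounded_linear_inner_right] xd)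
    then have hd: "(?h has_real_derivative ?d) (at t)" by (simp add: has_real_derivative_iff_has_vector_derivative)
    have "p (z l) \<bullet> ?y t = 1 + p (z l) \<bullet> (?y t - ?y l)" using py[OF l0(2)] by (simp add: inner_diff_right)
    moreover have "\<bar>p (z l) \<bullet> (?y t - ?y l)\<bar> \<le> P * (B * (t - l))"
      using Cauchy_Schwarz_ineq2[of "p (z l)" "?y t - ?y l"]
        mult_mono[OF P(1)[OF z(2)[OF l0(2)]] lip2 P(2) norm_ge_zero] t by simp
    moreover have "\<bar>(K * l) * ((?x t - ?x l) \<bullet> ?y t)\<bar> \<le> 1 * (Y * (t - l) * Y)"
    proof -
      have "K * l \<le> K * T" using lT K by simp
      then have "K * l \<le> 1" using T(3) by simp
      moreover have "\<bar>(?x t - ?x l) \<bullet> ?y t\<bar> \<le> Y * (t - l) * Y"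
        using Cauchy_Schwarz_ineq2[of "?x t - ?x l" "?y t"]
          mult_mono[OF lip Y(1)[OF z(2)[OF tI]] _ norm_ge_zero] t Y(2) by simp
      ultimately show ?thesis unfolding abs_mult using K l0 by (intro mult_mono) auto
    qed
    moreover have "P * (B * (t - l)) + Y * (t - l) * Y = (t - l) * (P * B + Y\<^sup>2)"
      by (simp add: algebra_simps power2_eq_square)
    moreover have "(t - l) * (P * B + Y\<^sup>2) \<le> T * (P * B + Y\<^sup>2)"
      using t l0 P(2) B0 by (intro mult_right_mono) auto
    ultimately have "?d > 0" using small by (simp add: algebra_simps abs_le_iff)
    then show "\<exists>y. (?h has_real_derivative y) (at t) \<and> 0 < y" using hd by blast
  qed
  moreover have "?h T = \<phi> b" using fin by (simp add: \<phi>_def y_def s_def l_def)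
  ultimately show False using \<phi>b by simp
qed

text \<open>\<open>T\<close> and \<open>\<tau>\<close> are fixed before \<open>u\<close>.
  \<open>W\<close> is open among all nonzero vectors: solutions are needed on an open set to reach
  the interior in \<open>exp_domain\<close>, minimality only at unit vectors. A competing curve
  starts either on the nonpositive side of the momentum or, as the final piece of a curve that left
  the ball, on the sphere.\<close>

theorem local_minimality:
  assumes z0: "(x0, y0) \<in> slit"
  obtains \<rho> T \<tau> W where "0 < \<rho>" "cball x0 \<rho> \<subseteq> D" "0 < T" "T < \<tau>" "open W" "(x0, y0) \<in> W" "W \<subseteq> slit"
    "\<And>u. u \<in> W \<Longrightarrow> fst u \<in> ball x0 \<rho> \<and> (\<exists>z. z 0 = u \<and>
      (\<forall>t\<in>{-\<tau><..<\<tau>}. (z has_vector_derivative spray (z t)) (at t) \<and> z t \<in> slit \<and> fst (z t) \<in> ball x0 \<rho>) \<and>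
      (f u = 1 \<longrightarrow> (\<forall>a b c g. speed_of a b c g \<and> (\<forall>t\<in>{a..b}. c t \<in> cball x0 \<rho>) \<and> c b = fst (z T) \<and>
        (p u \<bullet> (c a - fst u) \<le> 0 \<or> norm (c a - x0) = \<rho>) \<longrightarrow> T \<le> integral {a..b} g)))"
proof -
  obtain A B where AB: "open A" "open B" "(x0, y0) \<in> A \<times> B" "A \<times> B \<subseteq> slit"
    using open_slit z0 by (metis open_prod_elim)
  obtain e1 where e1: "e1 > 0" "cball x0 e1 \<subseteq> A" using AB open_contains_cball by (metis mem_Times_iff fst_conv)
  obtain e2 where e2: "e2 > 0" "cball y0 e2 \<subseteq> B" using AB open_contains_cball by (metis mem_Times_iff snd_conv)
  define R where "R = min e1 e2"
  have "cball x0 R \<times> cball y0 R \<subseteq> A \<times> B"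
    using e1(2) e2(2) subset_cball[of R e1 x0] subset_cball[of R e2 y0] by (auto simp: R_def)
  then have R: "cball x0 R \<times> cball y0 R \<subseteq> slit" "R > 0" using AB(4) e1 e2 by (auto simp: R_def)
  obtain r K where rK: "0 < r" "r \<le> R" "K > 0" and ineq: "\<And>\<xi> \<eta> x k w. \<xi> \<in> cball x0 r \<Longrightarrow> \<eta> \<in> cball y0 r \<Longrightarrow> f (\<xi>, \<eta>) = 1 \<Longrightarrow> x \<in> cball x0 r \<Longrightarrow>
      0 \<le> k \<Longrightarrow> k \<le> 1 \<Longrightarrow>
      p (\<xi>, \<eta>) \<bullet> w - k * ((x - \<xi>) \<bullet> w) \<le>
      (1 - q (\<xi>, \<eta>) \<bullet> (x - \<xi>) - k * (\<eta> \<bullet> (x - \<xi>)) + K / 2 * (norm (x - \<xi>))\<^sup>2) * f (x, w)"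
    using calibration_inequality[OF R] by metis
  let ?C = "cball x0 r \<times> cball y0 r"
  have CR: "?C \<subseteq> slit" using R(1) subset_cball[OF rK(2), of x0] subset_cball[OF rK(2), of y0] by blast
  have rD: "cball x0 r \<subseteq> D" using CR rK(1) by (auto simp: slit_def times_subset_iff)
  have C: "compact ?C" by (intro compact_Times compact_cball)
  have bd: "\<exists>M>0. \<forall>w\<in>?C. norm (h w) \<le> M" if "continuous_on slit h" for h :: "'e \<times> 'e \<Rightarrow> 'e"
  proof -
    have "compact (h ` ?C)" by (rule compact_continuous_image[OF continuous_on_subset[OF that CR] C])
    then show ?thesis using compact_imp_bounded bounded_pos by (metis imageI)
  qed
  obtain P where P: "P > 0" "\<And>w. w \<in> ?C \<Longrightarrow> norm (p w) \<le> P" using bd[OF smooth_on_imp_continuous[OF smooth_p]] by blast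
  obtain B where B: "B > 0" "\<And>w. w \<in> ?C \<Longrightarrow> norm (G w) \<le> B" using bd[OF smooth_on_imp_continuous[OF smooth_G]] by blast
  obtain Y where Y: "Y > 0" "\<And>w. w \<in> ?C \<Longrightarrow> norm (snd w) \<le> Y"
    using bd[OF continuous_on_snd[OF continuous_on_id]] by blast
  obtain m where m: "m > 0" "\<And>x w. x \<in> cball x0 r \<Longrightarrow> m * norm w \<le> f (x, w)"
    using f_lower_bound[OF compact_cball rD] by metis
  let ?z0 = "(x0, y0)"
  have sub: "cball ?z0 (r / 2) \<subseteq> cball x0 (r / 2) \<times> cball y0 (r / 2)"
  proof
    fix w assume "w \<in> cball ?z0 (r / 2)"
    then show "w \<in> cball x0 (r / 2) \<times> cball y0 (r / 2)"
      using dist_fst_le[of ?z0 w] dist_snd_le[of ?z0 w] by (cases w) auto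
  qed
  also have "\<dots> \<subseteq> ?C" using rK(1) subset_cball[of "r/2" r] by (intro Sigma_mono) auto
  finally have subC: "cball ?z0 (r / 2) \<subseteq> ?C" .
  \<comment> \<open>The geodesics stay within \<open>r / 2\<close> of the centre, which leaves an
    annulus of width \<open>r / 2\<close> to be crossed by curves from the sphere of radius
    \<open>r\<close>.\<close>
  obtain \<tau> where \<tau>: "\<tau> > 0" "\<And>u. u \<in> cball ?z0 (r / 2 / 2) \<Longrightarrow> \<exists>z. z 0 = u \<and>
      (\<forall>t\<in>{-\<tau><..<\<tau>}. (z has_vector_derivative spray (z t)) (at t) \<and> z t \<in> cball ?z0 (r / 2))"
    using ode_exists[OF open_slit smooth_spray half_gt_zero[OF rK(1)] order_trans[OF subC CR]] by blast
  \<comment> \<open>The four bounds: solutions exist beyond \<open>T\<close>;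
    \<open>K * T \<le> 1\<close>; the condition \<open>small\<close> of \<open>calibration\<close>,
    where the factor 2 gives strictness; and crossing the annulus costs at least
    \<open>m * (r / 2)\<close>.\<close>
  define T where "T = min (min (\<tau> / 2) (1 / K)) (min (1 / (2 * (P * B + Y\<^sup>2))) (m * (r / 2)))"
  have PB: "P * B + Y\<^sup>2 > 0" using P B by (simp add: add_pos_nonneg)
  have T: "0 < T" "T \<le> \<tau> / 2" "T \<le> 1 / K" "T \<le> 1 / (2 * (P * B + Y\<^sup>2))" "T \<le> m * (r / 2)"
    using \<tau>(1) rK m PB by (auto simp: T_def)
  have KT: "K * T \<le> 1" using mult_left_mono[OF T(3), of K] rK(3) by simp
  have small: "T * (P * B + Y\<^sup>2) < 1" 
  proof -
    have "t * c < 1" if "t \<le> 1 / (2 * c)" "c > 0" for t c :: real using that by (simp add: field_simps)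
    from this[OF T(4) PB] show ?thesis .
  qed
  show ?thesis
  proof (rule that[of r T \<tau> "ball ?z0 (r / 2 / 2)"])
    have "ball ?z0 (r / 2 / 2) \<subseteq> cball ?z0 (r / 2)" using rK(1) by auto
    then show "ball ?z0 (r / 2 / 2) \<subseteq> slit" using subC CR by blast
    fix u assume "u \<in> ball ?z0 (r / 2 / 2)"
    then have u: "u \<in> cball ?z0 (r / 2 / 2)" by auto
    then obtain z where z: "z 0 = u"
      "\<And>t. t \<in> {-\<tau><..<\<tau>} \<Longrightarrow> (z has_vector_derivative spray (z t)) (at t)"
      "\<And>t. t \<in> {-\<tau><..<\<tau>} \<Longrightarrow> z t \<in> cball ?z0 (r / 2)" using \<tau>(2)[OF u] by metis
    have zC: "z t \<in> ?C" if "t \<in> {-\<tau><..<\<tau>}" for t using z(3)[OF that] subC by blast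
    have zx: "dist x0 (fst (z t)) \<le> r / 2" if "t \<in> {-\<tau><..<\<tau>}" for t
      using subsetD[OF sub z(3)[OF that]] by (cases "z t") auto
    have "T \<le> integral {a..b} g"
      if f1: "f u = 1" and g: "speed_of a b c g" and cD: "\<forall>t\<in>{a..b}. c t \<in> cball x0 r" and fin: "c b = fst (z T)"
        and st: "p u \<bullet> (c a - fst u) \<le> 0 \<or> norm (c a - x0) = r" for a b c g
    proof (cases "p u \<bullet> (c a - fst u) \<le> 0")
      case True
      show ?thesis
        by (rule calibration[OF rK(3) ineq CR z(2) zC _ T(1) _ KT P(2) _ B(2) Y(2) _ small g])
          (use z(1) f1 T \<tau>(1) P Y cD fin True in auto)
    next
      case False
      have "r = norm (c a - x0)" using st False by simp
      also have "\<dots> \<le> norm (c b - c a) + norm (c b - x0)" by norm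
      also have "norm (c b - x0) \<le> r / 2"
        using zx[of T] T \<tau>(1) fin by (simp add: dist_norm norm_minus_commute)
      finally have "m * (r / 2) \<le> m * norm (c b - c a)" using m by simp
      also have "\<dots> \<le> integral {a..b} g"
        by (rule speed_of_displacement[OF g m(1)]) (use m(2) cD in auto)
      finally show ?thesis using T(5) by simp
    qed
    then show "fst u \<in> ball x0 r \<and> (\<exists>z. z 0 = u \<and>
      (\<forall>t\<in>{-\<tau><..<\<tau>}. (z has_vector_derivative spray (z t)) (at t) \<and> z t \<in> slit \<and> fst (z t) \<in> ball x0 r) \<and>
      (f u = 1 \<longrightarrow> (\<forall>a b c g. speed_of a b c g \<and> (\<forall>t\<in>{a..b}. c t \<in> cball x0 r) \<and> c b = fst (z T) \<and>
        (p u \<bullet> (c a - fst u) \<le> 0 \<or> norm (c a - x0) = r) \<longrightarrow> T \<le> integral {a..b} g)))"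
      using z zC CR zx rK(1) zx[of 0] \<tau>(1) by (intro conjI exI[of _ z]) (auto, fastforce+)
  qed (use rK rD T \<tau>(1) in auto)
qed

end

section \<open>Charts and tangent vectors\<close>

abbreviation chart_inv :: "('m, 'e) chart \<Rightarrow> 'e \<Rightarrow> 'm"
  where "chart_inv c \<equiv> inv_into (fst c) (snd c)"

context
  fixes c :: "('m::topological_space, 'e::euclidean_space) chart"
  assumes c: "is_chart c"
begin

lemma open_chart_domain: "open (fst c)" and open_chart_image: "open (snd c ` fst c)"
  using c by (auto simp: is_chart_def)

lemma inj_on_chart: "inj_on (snd c) (fst c)"
  using c unfolding is_chart_def homeomorphism_def by (metis inj_on_inverseI)

lemma chart_inv_chart: "x \<in> fst c \<Longrightarrow> chart_inv c (snd c x) = x"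
  using inj_on_chart by simp

lemma chart_chart_inv: "y \<in> snd c ` fst c \<Longrightarrow> snd c (chart_inv c y) = y"
  by (rule f_inv_into_f)

lemma chart_inv_in_domain: "y \<in> snd c ` fst c \<Longrightarrow> chart_inv c y \<in> fst c"
  by (rule inv_into_into)

lemma continuous_chart: "continuous_on (fst c) (snd c)"
  and continuous_chart_inv: "continuous_on (snd c ` fst c) (chart_inv c)"
  using c by (auto simp: is_chart_def homeomorphism_def)

lemma open_chart_image_Int: "open d \<Longrightarrow> open (snd c ` (fst c \<inter> d))"
proof -
  assume "open d"
  have "snd c ` (fst c \<inter> d) = snd c ` fst c \<inter> chart_inv c -` d"
    by (auto simp: chart_inv_chart)
  then show ?thesis
    using continuous_open_preimage[OF continuous_chart_inv open_chart_image \<open>open d\<close>] by simp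
qed

end

lemma smooth_structure_chart: "smooth_structure A \<Longrightarrow> c \<in> A \<Longrightarrow> is_chart c"
  by (simp add: smooth_structure_def)

lemma smooth_transition:
  "smooth_structure A \<Longrightarrow> c \<in> A \<Longrightarrow> d \<in> A \<Longrightarrow> smooth_on (transition c d) (snd c ` (fst c \<inter> fst d))"
  by (simp add: smooth_structure_def compatible_def)

section \<open>Smooth maps into the manifold and velocities of curves\<close>

lemma open_smooth_into_preimage:
  assumes "smooth_into A W g" "open W" "open U"
  shows "open {t \<in> W. g t \<in> U}"
proof -
  have "{t \<in> W. g t \<in> U} = W \<inter> g -` U" by auto
  then show ?thesis
    using continuous_open_preimage[OF _ assms(2,3)] assms(1) by (simp add: smooth_into_def)
qed

text \<open>In any other chart \<open>d\<close> the map reads \<open>transition c d\<close> after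
  \<open>x\<close>, which is smooth by compatibility of the charts.\<close>

lemma smooth_into_chart_inv:
  fixes c :: "('m::topological_space, 'e::euclidean_space) chart" and x :: "'a::real_normed_vector \<Rightarrow> 'e"
  assumes A: "smooth_structure A" and c: "c \<in> A" and W: "open W" and x: "smooth_on x W" "x ` W \<subseteq> snd c ` fst c"
  shows "smooth_into A W (\<lambda>t. chart_inv c (x t))"
  unfolding smooth_into_def
proof (intro conjI ballI)
  note ch = smooth_structure_chart[OF A c]
  show cont: "continuous_on W (\<lambda>t. chart_inv c (x t))"
    by (rule continuous_on_compose2[OF continuous_chart_inv[OF ch] smooth_on_imp_continuous[OF x(1)] x(2)])
  fix d assume d: "d \<in> A"
  let ?W = "{t \<in> W. chart_inv c (x t) \<in> fst d}"
  have eq: "?W = W \<inter> (\<lambda>t. chart_inv c (x t)) -` fst d" by auto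
  have oW: "open ?W"
    unfolding eq using continuous_open_preimage[OF cont W] open_chart_domain[OF smooth_structure_chart[OF A d]] .
  have "smooth_on (\<lambda>t. transition c d (x t)) ?W"
  proof (rule smooth_on_compose[OF oW _ smooth_transition[OF A c d] smooth_on_subset[OF x(1)]])
    show "open (snd c ` (fst c \<inter> fst d))"
      by (rule open_chart_image_Int[OF ch open_chart_domain[OF smooth_structure_chart[OF A d]]])
    show "x ` ?W \<subseteq> snd c ` (fst c \<inter> fst d)"
    proof clarify
      fix t assume t: "t \<in> W" "chart_inv c (x t) \<in> fst d"
      then have "x t \<in> snd c ` fst c" using x(2) by blast
      then show "x t \<in> snd c ` (fst c \<inter> fst d)"
        using t chart_chart_inv[OF ch] chart_inv_in_domain[OF ch] by (metis IntI imageI)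
    qed
  qed auto
  then show "smooth_on (snd d \<circ> (\<lambda>t. chart_inv c (x t))) ?W" by (simp add: transition_def o_def)
qed

lemma smooth_into_compose:
  fixes g :: "'b::euclidean_space \<Rightarrow> 'm::topological_space" and h :: "'a::real_normed_vector \<Rightarrow> 'b"
  assumes A: "smooth_structure A" and g: "smooth_into A W g" "open W" and J: "open J" and h: "smooth_on h J" "h ` J \<subseteq> W"
  shows "smooth_into A J (\<lambda>t. g (h t))"
  unfolding smooth_into_def
proof (intro conjI ballI)
  show cont: "continuous_on J (\<lambda>t. g (h t))"
    by (rule continuous_on_compose2[OF _ smooth_on_imp_continuous[OF h(1)] h(2)]) (use g in \<open>simp add: smooth_into_def\<close>)
  fix d assume d: "d \<in> A"
  have od: "open (fst d)" by (rule open_chart_domain[OF smooth_structure_chart[OF A d]])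
  have eq: "{t \<in> J. g (h t) \<in> fst d} = J \<inter> (\<lambda>t. g (h t)) -` fst d" by auto
  have "smooth_on (\<lambda>t. (snd d \<circ> g) (h t)) {t \<in> J. g (h t) \<in> fst d}"
  proof (rule smooth_on_compose[where f = "snd d \<circ> g" and g = h])
    show "open {t \<in> J. g (h t) \<in> fst d}" unfolding eq by (rule continuous_open_preimage[OF cont J od])
    show "open {t \<in> W. g t \<in> fst d}" by (rule open_smooth_into_preimage[OF g od])
    show "smooth_on (snd d \<circ> g) {t \<in> W. g t \<in> fst d}" using g d by (simp add: smooth_into_def)
  qed (use h in \<open>auto intro: smooth_on_subset\<close>)
  then show "smooth_on (snd d \<circ> (\<lambda>t. g (h t))) {t \<in> J. g (h t) \<in> fst d}" by (simp add: o_def)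
qed

lemma smooth_into_subset:
  "smooth_into A W g \<Longrightarrow> V \<subseteq> W \<Longrightarrow> smooth_into A V g"
  unfolding smooth_into_def by (auto intro: continuous_on_subset smooth_on_subset[of _ "{t \<in> W. _ t}"])

lemma smooth_into_cong:
  assumes "smooth_structure A" "smooth_into A W g" "open W" "\<And>t. t \<in> W \<Longrightarrow> g t = h t"
  shows "smooth_into A W h"
  unfolding smooth_into_def
proof (intro conjI ballI)
  show "continuous_on W h" using assms(2,4) by (simp add: smooth_into_def cong: continuous_on_cong)
  fix d assume d: "d \<in> A"
  have eq: "{t \<in> W. h t \<in> fst d} = {t \<in> W. g t \<in> fst d}" using assms(4) by auto
  have "smooth_on (snd d \<circ> g) {t \<in> W. g t \<in> fst d}" using assms(2) d by (simp add: smooth_into_def)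
  moreover have "open {t \<in> W. g t \<in> fst d}"
    by (rule open_smooth_into_preimage[OF assms(2,3) open_chart_domain[OF smooth_structure_chart[OF assms(1) d]]])
  ultimately show "smooth_on (snd d \<circ> h) {t \<in> W. h t \<in> fst d}"
    unfolding eq by (rule smooth_on_cong[THEN iffD1, rotated 2]) (use assms(4) in auto)
qed

lemma smooth_into_coord_derivative:
  fixes \<gamma> :: "real \<Rightarrow> 'm::topological_space" and c :: "('m, 'e::euclidean_space) chart"
  assumes "smooth_into A J \<gamma>" "c \<in> A" "t \<in> J" "\<gamma> t \<in> fst c"
  shows "((\<lambda>t. snd c (\<gamma> t)) has_vector_derivative snd (velocity A \<gamma> t) c) (at t)"
proof -
  have "smooth_on (snd c \<circ> \<gamma>) {t \<in> J. \<gamma> t \<in> fst c}" using assms by (simp add: smooth_into_def)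
  from smooth_on_vector_derivative[OF this, of t]
  have "((snd c \<circ> \<gamma>) has_vector_derivative vector_derivative (snd c \<circ> \<gamma>) (at t)) (at t)"
    using assms(3,4) by (metis (no_types, lifting) mem_Collect_eq vector_derivative_at)
  then show ?thesis using assms by (simp add: velocity_def o_def)
qed

lemma tangent_spaceI:
  assumes "fst v = x" "\<And>c. c \<notin> A \<or> x \<notin> fst c \<Longrightarrow> snd v c = 0"
    "\<And>c d. c \<in> A \<Longrightarrow> d \<in> A \<Longrightarrow> x \<in> fst c \<inter> fst d \<Longrightarrow>
      snd v d = frechet_derivative (transition c d) (at (snd c x)) (snd v c)"
  shows "v \<in> tangent_space A x"
  unfolding tangent_space_def using assms by blast

lemma tangent_spaceD:
  assumes "v \<in> tangent_space A x"
  shows "fst v = x" "c \<notin> A \<or> x \<notin> fst c \<Longrightarrow> snd v c = 0"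
    "c \<in> A \<Longrightarrow> d \<in> A \<Longrightarrow> x \<in> fst c \<inter> fst d \<Longrightarrow>
      snd v d = frechet_derivative (transition c d) (at (snd c x)) (snd v c)"
  using assms unfolding tangent_space_def by blast+

text \<open>Near \<open>t\<close> the curve in chart \<open>d\<close> is
  \<open>transition c d\<close> applied to the curve in chart \<open>c\<close>; the chain rule is
  the transformation law.\<close>

lemma velocity_in_tangent_space:
  fixes \<gamma> :: "real \<Rightarrow> 'm::topological_space" and A :: "('m, 'e::euclidean_space) chart set"
  assumes A: "smooth_structure A" and \<gamma>: "smooth_into A J \<gamma>" "open J" "t \<in> J"
  shows "velocity A \<gamma> t \<in> tangent_space A (\<gamma> t)"
proof (rule tangent_spaceI)
  let ?v = "velocity A \<gamma> t"
  show "fst ?v = \<gamma> t" by (simp add: velocity_def)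
  show "snd ?v c = 0" if "c \<notin> A \<or> \<gamma> t \<notin> fst c" for c using that by (auto simp: velocity_def)
  show "snd ?v d = frechet_derivative (transition c d) (at (snd c (\<gamma> t))) (snd ?v c)"
    if c: "c \<in> A" and d: "d \<in> A" and \<gamma>t: "\<gamma> t \<in> fst c \<inter> fst d" for c d
  proof -
    note ch = smooth_structure_chart[OF A c] and dh = smooth_structure_chart[OF A d]
    let ?U = "{s \<in> J. \<gamma> s \<in> fst c \<inter> fst d}"
    have U: "open ?U" by (rule open_smooth_into_preimage[OF \<gamma>(1,2)]) (intro open_Int open_chart_domain ch dh)
    have dc: "((\<lambda>s. snd c (\<gamma> s)) has_vector_derivative snd ?v c) (at t)"
      and dd: "((\<lambda>s. snd d (\<gamma> s)) has_vector_derivative snd ?v d) (at t)"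
      using smooth_into_coord_derivative[OF \<gamma>(1) _ \<gamma>(3)] c d \<gamma>t by auto
    let ?D = "frechet_derivative (transition c d) (at (snd c (\<gamma> t)))"
    have xt: "snd c (\<gamma> t) \<in> snd c ` (fst c \<inter> fst d)" using \<gamma>t by auto
    have tr: "(transition c d has_derivative ?D) (at (snd c (\<gamma> t)))"
      by (rule smooth_on_has_derivative[OF smooth_transition[OF A c d] xt])
    have "((\<lambda>s. transition c d (snd c (\<gamma> s))) has_derivative (\<lambda>h. ?D (h *\<^sub>R snd ?v c))) (at t)"
      using has_derivative_compose[OF dc[unfolded has_vector_derivative_def] tr] .
    then have "((\<lambda>s. transition c d (snd c (\<gamma> s))) has_vector_derivative ?D (snd ?v c)) (at t)"
      by (simp add: has_vector_derivative_def linear_scale[OF smooth_on_linear_derivative[OF smooth_transition[OF A c d] xt]])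
    then have "((\<lambda>s. snd d (\<gamma> s)) has_vector_derivative ?D (snd ?v c)) (at t)"
      by (rule has_vector_derivative_transform_within_open[OF _ U])
        (use \<gamma>t \<gamma>(3) chart_inv_chart[OF ch] in \<open>auto simp: transition_def\<close>)
    with dd show ?thesis by (rule vector_derivative_unique_at)
  qed
qed

section \<open>The tangent bundle: fibres, bundle charts and topology\<close>

context
  fixes A :: "('m::topological_space, 'e::euclidean_space) chart set"
  assumes A: "smooth_structure A"
begin

lemma linear_transition_derivative:
  "c \<in> A \<Longrightarrow> d \<in> A \<Longrightarrow> x \<in> fst c \<inter> fst d \<Longrightarrow> linear (frechet_derivative (transition c d) (at (snd c x)))"
  using smooth_on_linear_derivative[OF smooth_transition[OF A]] by blast

lemma tadd_in_tangent_space: "v \<in> tangent_space A x \<Longrightarrow> w \<in> tangent_space A x \<Longrightarrow> tadd v w \<in> tangent_space A x"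
  and tscale_in_tangent_space: "v \<in> tangent_space A x \<Longrightarrow> tscale r v \<in> tangent_space A x"
  and tzero_in_tangent_space: "tzero x \<in> tangent_space A x"
proof -
  note lin = linear_transition_derivative
  show "tadd v w \<in> tangent_space A x" if v: "v \<in> tangent_space A x" and w: "w \<in> tangent_space A x"
  proof (rule tangent_spaceI)
    show "snd (tadd v w) d = frechet_derivative (transition c d) (at (snd c x)) (snd (tadd v w) c)"
      if cd: "c \<in> A" "d \<in> A" "x \<in> fst c \<inter> fst d" for c d
      using linear_add[OF lin[OF cd]] tangent_spaceD(3)[OF v cd] tangent_spaceD(3)[OF w cd]
      by (simp only: tadd_def snd_conv)
  qed (use tangent_spaceD[OF v] tangent_spaceD[OF w] in \<open>simp_all add: tadd_def\<close>)
  show "tscale r v \<in> tangent_space A x" if v: "v \<in> tangent_space A x"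
  proof (rule tangent_spaceI)
    show "snd (tscale r v) d = frechet_derivative (transition c d) (at (snd c x)) (snd (tscale r v) c)"
      if cd: "c \<in> A" "d \<in> A" "x \<in> fst c \<inter> fst d" for c d
      using linear_scale[OF lin[OF cd]] tangent_spaceD(3)[OF v cd]
      by (simp only: tscale_def snd_conv)
  qed (use tangent_spaceD[OF v] in \<open>simp_all add: tscale_def\<close>)
  show "tzero x \<in> tangent_space A x"
    by (rule tangent_spaceI) (simp_all add: tzero_def linear_0[OF lin])
qed

lemma bundle_over_iff: "v \<in> bundle_over A c \<longleftrightarrow> v \<in> tangent_space A (fst v) \<and> fst v \<in> fst c"
  unfolding bundle_over_def tangent_bundle_def by (simp, metis tangent_spaceD(1))

text \<open>One component determines the others by the transformation law, and the values at all
  remaining indices are zero by convention.\<close>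

lemma tangent_space_eqI:
  assumes "v \<in> tangent_space A x" "w \<in> tangent_space A x" "c \<in> A" "x \<in> fst c" "snd v c = snd w c"
  shows "v = w"
proof (rule prod_eqI)
  show "fst v = fst w" using assms(1,2)[THEN tangent_spaceD(1)] by simp
  show "snd v = snd w"
  proof
    fix d show "snd v d = snd w d"
    proof (cases "d \<in> A \<and> x \<in> fst d")
      case True
      then have cd: "c \<in> A" "d \<in> A" "x \<in> fst c \<inter> fst d" using assms by auto
      show ?thesis using tangent_spaceD(3)[OF assms(1) cd] tangent_spaceD(3)[OF assms(2) cd] assms(5) by metis
    next
      case False
      then show ?thesis using assms(1,2)[THEN tangent_spaceD(2), of d] by auto
    qed
  qed
qed

lemma inj_on_bundle_chart:
  assumes c: "c \<in> A"
  shows "inj_on (bundle_chart c) (bundle_over A c)"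
proof (rule inj_onI)
  fix v w assume vw: "v \<in> bundle_over A c" "w \<in> bundle_over A c" "bundle_chart c v = bundle_chart c w"
  have "fst v = fst w"
    using vw inj_on_chart[OF smooth_structure_chart[OF A c]] by (auto simp: bundle_chart_def bundle_over_iff dest: inj_onD)
  then show "v = w"
    using vw c by (intro tangent_space_eqI[of v "fst v" w c]) (auto simp: bundle_over_iff bundle_chart_def)
qed

definition tvec_of :: "('m, 'e) chart \<Rightarrow> 'e \<times> 'e \<Rightarrow> ('m, 'e) tvec"
  where "tvec_of c = inv_into (bundle_over A c) (bundle_chart c)"

text \<open>Surjectivity of the bundle chart. The vector with coordinates \<open>(x, y)\<close> is
  realised as the velocity at 0 of the coordinate line \<open>x + t y\<close>, so that its
  transformation law comes from \<open>velocity_in_tangent_space\<close>.\<close>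

lemma
  assumes c: "c \<in> A" and x: "fst z \<in> snd c ` fst c"
  shows tvec_of_in_bundle: "tvec_of c z \<in> bundle_over A c"
    and bundle_chart_tvec_of: "bundle_chart c (tvec_of c z) = z"
proof -
  note ch = smooth_structure_chart[OF A c]
  let ?x = "\<lambda>t::real. fst z + t *\<^sub>R snd z"
  let ?J = "?x -` (snd c ` fst c)"
  let ?\<gamma> = "\<lambda>t. chart_inv c (?x t)"
  have J: "open ?J" by (rule open_vimage[OF open_chart_image[OF ch]]) (intro continuous_intros)
  have "smooth_on ?x ?J"
    by (intro smooth_on_add J smooth_on_const smooth_on_linear_id bounded_linear_scaleR_left)
  then have \<gamma>: "smooth_into A ?J ?\<gamma>" by (intro smooth_into_chart_inv A c J) auto
  have 0: "0 \<in> ?J" using x by simp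
  have \<gamma>0: "?\<gamma> 0 \<in> fst c" using x chart_inv_in_domain[OF ch] by simp
  have "velocity A ?\<gamma> 0 \<in> bundle_over A c"
    unfolding bundle_over_iff using velocity_in_tangent_space[OF A \<gamma> J 0] \<gamma>0 by (simp add: velocity_def)
  moreover have "snd (velocity A ?\<gamma> 0) c = snd z"
  proof -
    have "((\<lambda>t. snd c (?\<gamma> t)) has_vector_derivative snd (velocity A ?\<gamma> 0) c) (at 0)"
      by (rule smooth_into_coord_derivative[OF \<gamma> c 0 \<gamma>0])
    then have "(?x has_vector_derivative snd (velocity A ?\<gamma> 0) c) (at 0)"
      by (rule has_vector_derivative_transform_within_open[OF _ J 0]) (use chart_chart_inv[OF ch] in auto)
    moreover have "(?x has_vector_derivative snd z) (at 0)" by (auto intro!: derivative_eq_intros)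
    ultimately show ?thesis by (rule vector_derivative_unique_at)
  qed
  then have "bundle_chart c (velocity A ?\<gamma> 0) = z"
    using x chart_chart_inv[OF ch] by (simp add: bundle_chart_def velocity_def)
  ultimately have z: "z \<in> bundle_chart c ` bundle_over A c" by (metis imageI)
  show "tvec_of c z \<in> bundle_over A c" "bundle_chart c (tvec_of c z) = z"
    unfolding tvec_of_def using inv_into_into[OF z] f_inv_into_f[OF z] by auto
qed

lemma tvec_of_bundle_chart: "c \<in> A \<Longrightarrow> v \<in> bundle_over A c \<Longrightarrow> tvec_of c (bundle_chart c v) = v"
  unfolding tvec_of_def by (rule inv_into_f_f[OF inj_on_bundle_chart])

text \<open>It suffices to look at the generating sets: for each chart, components continuous on the
  open set of parameters whose base points it covers.\<close>

lemma continuous_into_bundle: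
  fixes h :: "'a::topological_space \<Rightarrow> ('m, 'e) tvec"
  assumes S: "open S" and h: "\<And>s. s \<in> S \<Longrightarrow> h s \<in> tangent_bundle A"
    and op: "\<And>d. d \<in> A \<Longrightarrow> open {s \<in> S. fst (h s) \<in> fst d}"
    and cont: "\<And>d. d \<in> A \<Longrightarrow> continuous_on {s \<in> S. fst (h s) \<in> fst d} (\<lambda>s. bundle_chart d (h s))"
  shows "continuous_map (top_of_set S) (bundle_topology A) h"
  unfolding bundle_topology_def
proof (rule continuous_on_generated_topo)
  fix U assume "U \<in> {{v \<in> bundle_over A c. bundle_chart c v \<in> W} | c W. c \<in> A \<and> open W}"
  then obtain d W where U: "U = {v \<in> bundle_over A d. bundle_chart d v \<in> W}" "d \<in> A" "open W" by blast
  have "h -` U \<inter> S = {s \<in> S. fst (h s) \<in> fst d} \<inter> (\<lambda>s. bundle_chart d (h s)) -` W"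
    using h by (auto simp: U(1) bundle_over_def)
  also have "open \<dots>" by (rule continuous_open_preimage[OF cont[OF U(2)] op[OF U(2)] U(3)])
  finally show "openin (top_of_set S) (h -` U \<inter> topspace (top_of_set S))"
    by (metis Int_lower2 open_subset topspace_euclidean_subtopology)
next
  let ?B = "{{v \<in> bundle_over A c. bundle_chart c v \<in> W} | c W. c \<in> A \<and> open W}"
  show "h ` topspace (top_of_set S) \<subseteq> \<Union> ?B"
  proof (rule image_subsetI)
    fix s assume "s \<in> topspace (top_of_set S)"
    then have s: "s \<in> S" by simp
    obtain d where d: "d \<in> A" "fst (h s) \<in> fst d" using A unfolding smooth_structure_def by blast
    have "h s \<in> {v \<in> bundle_over A d. bundle_chart d v \<in> UNIV}" using h[OF s] d by (simp add: bundle_over_def)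
    moreover have "{v \<in> bundle_over A d. bundle_chart d v \<in> UNIV} \<in> ?B" using d(1) open_UNIV by blast
    ultimately show "h s \<in> \<Union> ?B" by (rule UnionI[rotated])
  qed
qed

lemma continuous_velocity:
  fixes \<gamma> :: "real \<Rightarrow> 'm"
  assumes \<gamma>: "smooth_into A J \<gamma>" "open J"
  shows "continuous_map (top_of_set J) (bundle_topology A) (velocity A \<gamma>)"
proof (rule continuous_into_bundle[OF \<gamma>(2)])
  show "velocity A \<gamma> s \<in> tangent_bundle A" if "s \<in> J" for s
    using velocity_in_tangent_space[OF A \<gamma> that] by (auto simp: tangent_bundle_def)
  fix d assume d: "d \<in> A"
  let ?U = "{s \<in> J. \<gamma> s \<in> fst d}"
  have fst: "fst (velocity A \<gamma> s) = \<gamma> s" for s by (simp add: velocity_def)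
  show "open {s \<in> J. fst (velocity A \<gamma> s) \<in> fst d}"
    unfolding fst by (rule open_smooth_into_preimage[OF \<gamma> open_chart_domain[OF smooth_structure_chart[OF A d]]])
  have sm: "smooth_on (snd d \<circ> \<gamma>) ?U" using \<gamma>(1) d by (simp add: smooth_into_def)
  have "continuous_on ?U (\<lambda>s. ((snd d \<circ> \<gamma>) s, frechet_derivative (snd d \<circ> \<gamma>) (at s) 1))"
    by (intro continuous_on_Pair smooth_on_imp_continuous sm smooth_on_derivative)
  moreover have "((snd d \<circ> \<gamma>) s, frechet_derivative (snd d \<circ> \<gamma>) (at s) 1) = bundle_chart d (velocity A \<gamma> s)" if "s \<in> ?U" for s
    using vector_derivative_at[OF smooth_on_vector_derivative[OF sm that]] that d
    by (simp add: bundle_chart_def velocity_def)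
  ultimately show "continuous_on {s \<in> J. fst (velocity A \<gamma> s) \<in> fst d} (\<lambda>s. bundle_chart d (velocity A \<gamma> s))"
    unfolding fst by (rule continuous_on_eq)
qed

text \<open>In another chart the components are the transition map and its derivative applied to the
  vector. This makes \<open>F\<close> in coordinates continuous up to the zero section.\<close>

lemma continuous_tvec_of:
  assumes c: "c \<in> A"
  shows "continuous_map (top_of_set (snd c ` fst c \<times> UNIV)) (bundle_topology A) (tvec_of c)"
proof (rule continuous_into_bundle)
  note ch = smooth_structure_chart[OF A c]
  let ?S = "snd c ` fst c \<times> (UNIV :: 'e set)"
  show S: "open ?S" by (intro open_Times open_chart_image ch open_UNIV)
  have tv: "tvec_of c z \<in> bundle_over A c" "bundle_chart c (tvec_of c z) = z" if "z \<in> ?S" for z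
    using that tvec_of_in_bundle[OF c, of z] bundle_chart_tvec_of[OF c, of z] by auto
  show "tvec_of c z \<in> tangent_bundle A" if "z \<in> ?S" for z using tv[OF that] by (simp add: bundle_over_def)
  have fst: "fst (tvec_of c z) = chart_inv c (fst z)" if "z \<in> ?S" for z
    using tv[OF that] chart_inv_chart[OF ch, of "fst (tvec_of c z)"]
    by (auto simp: bundle_chart_def bundle_over_def dest!: arg_cong[of _ _ fst])
  fix d assume d: "d \<in> A"
  note dh = smooth_structure_chart[OF A d]
  let ?I = "snd c ` (fst c \<inter> fst d)"
  have oI: "open ?I" by (rule open_chart_image_Int[OF ch open_chart_domain[OF dh]])
  have mem: "chart_inv c x \<in> fst d \<longleftrightarrow> x \<in> ?I" if "x \<in> snd c ` fst c" for x
    using that chart_inv_chart[OF ch] by auto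
  have eq: "{z \<in> ?S. fst (tvec_of c z) \<in> fst d} = ?I \<times> UNIV"
    using fst mem by fastforce
  show "open {z \<in> ?S. fst (tvec_of c z) \<in> fst d}" unfolding eq by (intro open_Times oI open_UNIV)
  note tr = smooth_transition[OF A c d]
  have "continuous_on (?I \<times> UNIV) (\<lambda>z. (transition c d (fst z), (\<lambda>(x, v). frechet_derivative (transition c d) (at x) v) z))"
    by (intro continuous_on_Pair smooth_on_continuous_derivative[OF oI tr]
        continuous_on_compose2[OF smooth_on_imp_continuous[OF tr] continuous_on_fst[OF continuous_on_id]]) auto
  moreover have "(transition c d (fst z), (\<lambda>(x, v). frechet_derivative (transition c d) (at x) v) z) = bundle_chart d (tvec_of c z)"
    if z: "z \<in> ?I \<times> UNIV" for z
  proof -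
    have zS: "z \<in> ?S" and f: "fst (tvec_of c z) \<in> fst c \<inter> fst d"
      using z eq tv(1) by (auto simp: bundle_over_def)
    have ts: "tvec_of c z \<in> tangent_space A (fst (tvec_of c z))" using tv(1)[OF zS] by (simp add: bundle_over_iff)
    have "snd (tvec_of c z) d = frechet_derivative (transition c d) (at (snd c (fst (tvec_of c z)))) (snd (tvec_of c z) c)"
      by (rule tangent_spaceD(3)[OF ts c d f])
    moreover have "snd c (fst (tvec_of c z)) = fst z" "snd (tvec_of c z) c = snd z"
      using tv(2)[OF zS] by (auto simp: bundle_chart_def dest: arg_cong[of _ _ fst] arg_cong[of _ _ snd])
    ultimately show ?thesis by (simp add: bundle_chart_def transition_def fst[OF zS] case_prod_unfold)
  qed
  ultimately show "continuous_on {z \<in> ?S. fst (tvec_of c z) \<in> fst d} (\<lambda>z. bundle_chart d (tvec_of c z))"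
    unfolding eq by (rule continuous_on_eq)
qed

end

section \<open>A Finsler manifold in a chart\<close>

locale finsler_coord =
  fixes A :: "('m::{t2_space,second_countable_topology}, 'e::euclidean_space) chart set"
    and F :: "('m, 'e) tvec \<Rightarrow> real" and c :: "('m, 'e) chart"
  assumes finsler: "finsler_manifold A F" and c: "c \<in> A"
begin

definition D :: "'e set" where "D = snd c ` fst c"

definition f :: "'e \<times> 'e \<Rightarrow> real" where "f = F \<circ> inv_into (bundle_over A c) (bundle_chart c)"

lemma smooth_structure: "smooth_structure A"
  using finsler by (simp add: finsler_manifold_def smooth_manifold_def)

lemma metric: "finsler_metric A F"
  using finsler by (simp add: finsler_manifold_def)

lemma chart: "is_chart c"
  by (rule smooth_structure_chart[OF smooth_structure c])

lemma f_eq: "f z = F (tvec_of A c z)"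
  by (simp add: f_def tvec_of_def[OF smooth_structure])

lemma F_eq: "v \<in> bundle_over A c \<Longrightarrow> F v = f (bundle_chart c v)"
  by (simp add: f_eq tvec_of_bundle_chart[OF smooth_structure c])

lemma tvec_of_coords:
  assumes "x \<in> D"
  shows "tvec_of A c (x, y) \<in> tangent_space A (chart_inv c x)" "snd (tvec_of A c (x, y)) c = y"
    "tvec_of A c (x, y) \<in> bundle_over A c" "bundle_chart c (tvec_of A c (x, y)) = (x, y)"
proof -
  show 1: "tvec_of A c (x, y) \<in> bundle_over A c" and 2: "bundle_chart c (tvec_of A c (x, y)) = (x, y)"
    using tvec_of_in_bundle[OF smooth_structure c, of "(x, y)"] bundle_chart_tvec_of[OF smooth_structure c, of "(x, y)"]
      assms by (auto simp: D_def)
  then show "snd (tvec_of A c (x, y)) c = y" by (simp add: bundle_chart_def)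
  have "fst (tvec_of A c (x, y)) = chart_inv c x"
    using 1 2 chart_inv_chart[OF chart, of "fst (tvec_of A c (x, y))"] by (auto simp: bundle_chart_def bundle_over_def)
  then show "tvec_of A c (x, y) \<in> tangent_space A (chart_inv c x)"
    using 1 by (simp add: bundle_over_iff[OF smooth_structure])
qed

lemma tvec_of_eqI:
  assumes "v \<in> tangent_space A (chart_inv c x)" "x \<in> D" "snd v c = y"
  shows "v = tvec_of A c (x, y)"
  using tangent_space_eqI[OF smooth_structure assms(1) tvec_of_coords(1)[OF assms(2)] c] assms
    tvec_of_coords(2)[OF assms(2)] chart_inv_in_domain[OF chart, of x] by (auto simp: D_def)

lemma tscale_tvec_of: "x \<in> D \<Longrightarrow> tscale r (tvec_of A c (x, y)) = tvec_of A c (x, r *\<^sub>R y)"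
  by (rule tvec_of_eqI[OF tscale_in_tangent_space[OF smooth_structure tvec_of_coords(1)]])
    (simp_all add: tscale_def tvec_of_coords(2))

lemma tadd_tvec_of: "x \<in> D \<Longrightarrow> tadd (tvec_of A c (x, y)) (tvec_of A c (x, w)) = tvec_of A c (x, y + w)"
  by (rule tvec_of_eqI[OF tadd_in_tangent_space[OF smooth_structure tvec_of_coords(1) tvec_of_coords(1)]])
    (simp_all add: tadd_def tvec_of_coords(2))

lemma tvec_of_zero: "x \<in> D \<Longrightarrow> tvec_of A c (x, 0) = tzero (chart_inv c x)"
  by (rule tvec_of_eqI[symmetric, OF tzero_in_tangent_space[OF smooth_structure]]) (simp_all add: tzero_def)

lemma tvec_of_nonzero: "x \<in> D \<Longrightarrow> y \<noteq> 0 \<Longrightarrow> tvec_of A c (x, y) \<in> tangent_space A (chart_inv c x) - {tzero (chart_inv c x)}"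
  using tvec_of_coords[of x y] by (auto simp: tzero_def)

lemma fundamental_tensor_tvec_of:
  "x \<in> D \<Longrightarrow> fundamental_tensor F (tvec_of A c (x, y)) (tvec_of A c (x, a)) (tvec_of A c (x, b)) =
    (1/2) * deriv (\<lambda>s1. deriv (\<lambda>s2. (f (x, y + s1 *\<^sub>R a + s2 *\<^sub>R b))\<^sup>2) 0) 0"
  by (simp add: fundamental_tensor_def tscale_tvec_of tadd_tvec_of f_eq)

sublocale finsler_chart D f
proof
  show "open D" unfolding D_def by (rule open_chart_image[OF chart])
  show "smooth_on f (D \<times> - {0})"
    using metric c unfolding finsler_metric_def D_def f_def by blast
  have "continuous_map (top_of_set (snd c ` fst c \<times> UNIV)) euclideanreal (F \<circ> tvec_of A c)"
    using metric by (intro continuous_map_compose[OF continuous_tvec_of[OF smooth_structure c]]) (simp add: finsler_metric_def)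
  then show cont: "continuous_on (D \<times> UNIV) f"
    by (simp add: D_def f_eq[abs_def] o_def)
  show "0 \<le> f (x, y)" if "x \<in> D" for x y
    using metric tvec_of_coords(3)[OF that, of y] by (auto simp: f_eq finsler_metric_def bundle_over_def)
  show scale: "f (x, r *\<^sub>R y) = r * f (x, y)" if "x \<in> D" "y \<noteq> 0" "r > 0" for x y r
    using metric tvec_of_nonzero[OF that(1,2)] that
    unfolding f_eq tscale_tvec_of[OF that(1), symmetric] finsler_metric_def by blast
  show "0 < deriv (\<lambda>s1. deriv (\<lambda>s2. (f (x, y + s1 *\<^sub>R w + s2 *\<^sub>R w))\<^sup>2) 0) 0"
    if "x \<in> D" "y \<noteq> 0" "w \<noteq> 0" for x y w
  proof -
    have "fundamental_tensor F (tvec_of A c (x, y)) (tvec_of A c (x, w)) (tvec_of A c (x, w)) > 0"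
      using metric tvec_of_nonzero[OF that(1,2)] tvec_of_nonzero[OF that(1,3)] unfolding finsler_metric_def by blast
    then show ?thesis unfolding fundamental_tensor_tvec_of[OF that(1)] by simp
  qed
  show "f (x, 0) = 0" if x: "x \<in> D" for x
  proof -
    \<comment> \<open>Homogeneity is available for nonzero vectors and positive factors, so the
      value at zero is found as a limit along the ray through \<open>b\<close>.\<close>
    obtain b :: 'e where b: "b \<in> Basis" using nonempty_Basis by blast
    have "continuous_on UNIV (\<lambda>r::real. f (x, r *\<^sub>R b))"
      by (rule continuous_on_compose2[OF cont]) (use x in \<open>auto intro!: continuous_intros\<close>)
    then have "isCont (\<lambda>r::real. f (x, r *\<^sub>R b)) 0" by (simp add: continuous_on_eq_continuous_at)
    then have "((\<lambda>r. f (x, r *\<^sub>R b)) \<longlongrightarrow> f (x, 0)) (at_right 0)"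
      by (auto simp: isCont_def intro: tendsto_within_subset)
    moreover have "((\<lambda>r. r * f (x, b)) \<longlongrightarrow> 0) (at_right 0)" by (auto intro!: tendsto_eq_intros)
    then have "((\<lambda>r. f (x, r *\<^sub>R b)) \<longlongrightarrow> 0) (at_right 0)"
    proof (rule tendsto_cong[THEN iffD1, rotated])
      show "\<forall>\<^sub>F r in at_right 0. r * f (x, b) = f (x, r *\<^sub>R b)"
        using eventually_at_right_less[of 0] by eventually_elim (use scale[OF x] b in \<open>auto simp: nonzero_Basis\<close>)
    qed
    ultimately show ?thesis using tendsto_unique[OF trivial_limit_at_right_real] by blast
  qed
qed

lemma fundamental_tensor_coord:
  "x \<in> D \<Longrightarrow> y \<noteq> 0 \<Longrightarrow> fundamental_tensor F (tvec_of A c (x, y)) (tvec_of A c (x, a)) (tvec_of A c (x, b)) =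
    Dp (x, y) (0, a) \<bullet> b"
  by (simp add: fundamental_tensor_tvec_of fundamental_tensor_eq)

lemma bundle_chart_velocity:
  assumes "smooth_into A J \<gamma>" "open J" "t \<in> J" "\<gamma> t \<in> fst c"
    and "((\<lambda>t. snd c (\<gamma> t)) has_vector_derivative y) (at t)"
  shows "velocity A \<gamma> t \<in> bundle_over A c" "velocity A \<gamma> t = tvec_of A c (snd c (\<gamma> t), y)"
    "F (velocity A \<gamma> t) = f (snd c (\<gamma> t), y)"
proof -
  have ts: "velocity A \<gamma> t \<in> tangent_space A (\<gamma> t)" by (rule velocity_in_tangent_space[OF smooth_structure assms(1-3)])
  then show "velocity A \<gamma> t \<in> bundle_over A c"
    using assms(4) by (simp add: bundle_over_iff[OF smooth_structure] tangent_spaceD(1))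
  have "snd (velocity A \<gamma> t) c = y"
    using vector_derivative_unique_at[OF smooth_into_coord_derivative[OF assms(1) c assms(3,4)] assms(5)] .
  then show "velocity A \<gamma> t = tvec_of A c (snd c (\<gamma> t), y)"
    by (intro tvec_of_eqI) (use ts assms(4) chart_inv_chart[OF chart] in \<open>auto simp: D_def\<close>)
  then show "F (velocity A \<gamma> t) = f (snd c (\<gamma> t), y)" by (simp add: f_eq)
qed

end

section \<open>Geodesics in a chart\<close>

text \<open>\<open>p\<close> and \<open>q\<close> are homogeneous of degree 1 and 2, so the rescaled
  curve again satisfies the Euler-Lagrange equation, and unique solvability identifies its
  acceleration with \<open>G\<close>. This converts time \<open>T\<close> with initial vector
  \<open>v\<close> into time 1 with initial vector \<open>T v\<close>, as \<open>exp_map\<close>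
  requires.\<close>

lemma (in finsler_chart) spray_rescale:
  assumes z: "(z has_vector_derivative spray (z (r * t))) (at (r * t))" "z (r * t) \<in> slit" and r: "r > 0"
  defines "w \<equiv> \<lambda>t. (fst (z (r * t)), r *\<^sub>R snd (z (r * t)))"
  assumes ev: "\<forall>\<^sub>F s in nhds t. z (r * s) \<in> slit"
  shows "(w has_vector_derivative spray (w t)) (at t)"
proof -
  have lin: "((\<lambda>t. r * t) has_vector_derivative r) (at t)" by (auto intro!: derivative_eq_intros)
  have comp: "((\<lambda>t. h (r * t)) has_vector_derivative r *\<^sub>R d) (at t)"
    if "(h has_vector_derivative d) (at (r * t))" for h :: "real \<Rightarrow> 'e" and d
    using vector_diff_chain_at[OF lin that] by (simp add: o_def)
  have dx: "((\<lambda>t. fst (z (r * t))) has_vector_derivative r *\<^sub>R snd (z (r * t))) (at t)"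
    by (rule comp[OF spray_curve(1)[OF z(1)]])
  have dy: "((\<lambda>t. r *\<^sub>R snd (z (r * t))) has_vector_derivative r *\<^sub>R r *\<^sub>R G (z (r * t))) (at t)"
    by (rule bounded_linear.has_vector_derivative[OF bounded_linear_scaleR_right comp[OF spray_curve(2)[OF z(1)]]])
  have ws: "w t \<in> slit" using z(2) r by (cases "z (r * t)") (simp add: w_def)
  have sc: "p (w s) = r *\<^sub>R p (z (r * s))" "q (w s) = r\<^sup>2 *\<^sub>R q (z (r * s))" if "z (r * s) \<in> slit" for s
    using p_scale[of "fst (z (r * s))" "snd (z (r * s))" r] q_scale[of "fst (z (r * s))" "snd (z (r * s))" r] that r
    by (cases "z (r * s)", simp add: w_def)+
  have "((\<lambda>t. r *\<^sub>R p (z (r * t))) has_vector_derivative r *\<^sub>R r *\<^sub>R q (z (r * t))) (at t)"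
    by (rule bounded_linear.has_vector_derivative[OF bounded_linear_scaleR_right comp[OF spray_euler_lagrange[OF z]]])
  then have "((\<lambda>t. r *\<^sub>R p (z (r * t))) has_vector_derivative q (w t)) (at t)"
    using sc(2)[OF z(2)] by (simp add: power2_eq_square)
  moreover have "\<forall>\<^sub>F s in nhds t. r *\<^sub>R p (z (r * s)) = p (w s)"
    using ev by eventually_elim (simp add: sc)
  then obtain S where "open S" "t \<in> S" "\<And>s. s \<in> S \<Longrightarrow> r *\<^sub>R p (z (r * s)) = p (w s)"
    unfolding eventually_nhds by blast
  ultimately have "((\<lambda>s. p (w s)) has_vector_derivative q (w t)) (at t)"
    by (rule has_vector_derivative_transform_within_open)
  moreover have "((\<lambda>s. p (w s)) has_vector_derivative Dp (w t) (r *\<^sub>R snd (z (r * t)), r *\<^sub>R r *\<^sub>R G (z (r * t)))) (at t)"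
    using p_curve[OF dx dy] ws by (simp add: w_def)
  ultimately have "Dp (w t) (snd (w t), r *\<^sub>R r *\<^sub>R G (z (r * t))) = q (w t)"
    by (auto simp: w_def dest: vector_derivative_unique_at)
  then have "r *\<^sub>R r *\<^sub>R G (z (r * t)) = G (w t)" by (rule G_unique[OF ws])
  moreover have "(w has_vector_derivative (r *\<^sub>R snd (z (r * t)), r *\<^sub>R r *\<^sub>R G (z (r * t)))) (at t)"
    unfolding w_def using dx dy
    by (auto simp: has_vector_derivative_def intro!: has_derivative_eq_rhs[OF has_derivative_Pair])
  ultimately show ?thesis by (simp add: spray_def w_def)
qed

lemma continuous_on_eq_at_end:
  fixes g h :: "real \<Rightarrow> 'a::t2_space"
  assumes "a < b" "continuous_on {a..b} g" "continuous_on {a..b} h" "\<And>t. a \<le> t \<Longrightarrow> t < b \<Longrightarrow> g t = h t"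
  shows "g b = h b"
proof -
  have "(g \<longlongrightarrow> g b) (at b within {a..b})" "(h \<longlongrightarrow> h b) (at b within {a..b})"
    using assms(1-3) by (auto simp: continuous_on_def)
  moreover have "\<forall>\<^sub>F t in at b within {a..b}. g t = h t"
    unfolding eventually_at_filter using assms(4) by (intro always_eventually) auto
  ultimately have "(h \<longlongrightarrow> g b) (at b within {a..b})"
    using tendsto_cong[of g h "at b within {a..b}" "g b"] by blast
  moreover have "at b within {a..b} \<noteq> bot" using assms(1) by (simp add: trivial_limit_within islimpt_Icc)
  ultimately show ?thesis using tendsto_unique \<open>(h \<longlongrightarrow> h b) (at b within {a..b})\<close> by blast
qed

context finsler_coord
begin

lemma variation_domain:
  assumes \<Gamma>: "smooth_into A U \<Gamma>" "open U"
  defines "W \<equiv> {z \<in> U. \<Gamma> z \<in> fst c}"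
  shows "open W" "smooth_on (\<lambda>z. snd c (\<Gamma> z)) W" "z \<in> W \<Longrightarrow> snd c (\<Gamma> z) \<in> D"
proof -
  show "open W" unfolding W_def by (rule open_smooth_into_preimage[OF \<Gamma> open_chart_domain[OF chart]])
  show "smooth_on (\<lambda>z. snd c (\<Gamma> z)) W" using \<Gamma>(1) c by (simp add: smooth_into_def W_def o_def)
  show "z \<in> W \<Longrightarrow> snd c (\<Gamma> z) \<in> D" by (auto simp: W_def D_def)
qed

text \<open>In coordinates the energy is the integral of \<open>L\<close>, for \<open>s\<close> so
  small that the varied curve stays in the chart over \<open>{a..b}\<close>. Compactness provides
  such a range, and the derivative at \<open>s = 0\<close> sees nothing else.\<close>

lemma energy_variation:
  fixes \<Gamma> :: "real \<times> real \<Rightarrow> 'm"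
  defines "X \<equiv> \<lambda>z. snd c (\<Gamma> z)"
  defines "Xs \<equiv> \<lambda>z. frechet_derivative X (at z) (1, 0)" and "Xt \<equiv> \<lambda>z. frechet_derivative X (at z) (0, 1)"
  assumes \<delta>: "\<delta> > 0" and J: "open J" "{a..b} \<subseteq> J" "a \<le> b" and \<Gamma>: "smooth_into A ({-\<delta><..<\<delta>} \<times> J) \<Gamma>"
    and dom: "\<And>t. t \<in> {a..b} \<Longrightarrow> \<Gamma> (0, t) \<in> fst c"
    and nz: "\<And>t. t \<in> {a..b} \<Longrightarrow> Xt (0, t) \<noteq> 0"
  shows "((\<lambda>s. energy A F a b (\<lambda>t. \<Gamma> (s, t))) has_real_derivative
    integral {a..b} (\<lambda>t. q (X (0, t), Xt (0, t)) \<bullet> Xs (0, t)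
      + p (X (0, t), Xt (0, t)) \<bullet> frechet_derivative Xt (at (0, t)) (1, 0))) (at 0)"
proof -
  let ?U = "{-\<delta><..<\<delta>} \<times> J"
  define W where "W = {z \<in> ?U. \<Gamma> z \<in> fst c}"
  have U: "open ?U" by (intro open_Times J) auto
  have W: "open W" "smooth_on X W" "\<And>z. z \<in> W \<Longrightarrow> X z \<in> D"
    using variation_domain[OF \<Gamma> U] by (simp_all add: W_def X_def)
  have sub: "{0} \<times> {a..b} \<subseteq> W" using dom \<delta> J by (auto simp: W_def)
  have fv: "((\<lambda>s. integral {a..b} (\<lambda>t. L (X (s, t), Xt (s, t)))) has_real_derivative
    integral {a..b} (\<lambda>t. q (X (0, t), Xt (0, t)) \<bullet> Xs (0, t)
      + p (X (0, t), Xt (0, t)) \<bullet> frechet_derivative Xt (at (0, t)) (1, 0))) (at 0)"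
    unfolding Xs_def Xt_def by (rule first_variation[OF W(1,2) sub W(3)]) (use nz in \<open>auto simp: Xt_def\<close>)
  have "compact ({0::real} \<times> {a..b})" by (intro compact_Times) auto
  then obtain e where e: "e > 0" "(\<Union>x\<in>{0} \<times> {a..b}. cball x e) \<subseteq> W"
    using compact_subset_open_imp_cball_epsilon_subset[OF _ W(1) sub] by metis
  have box: "(s, t) \<in> W" if "s \<in> {-e<..<e}" "t \<in> {a..b}" for s t :: real
  proof -
    have "(s, t) \<in> cball (0, t) e" using that(1) by (auto simp: dist_Pair_Pair)
    then show ?thesis using e(2) that(2) by blast
  qed
  have "integral {a..b} (\<lambda>t. L (X (s, t), Xt (s, t))) = energy A F a b (\<lambda>t. \<Gamma> (s, t))" if s: "s \<in> {-e<..<e}" for s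
  proof -
    have s\<delta>: "s \<in> {-\<delta><..<\<delta>}" using box[OF s, of a] J(3) by (auto simp: W_def)
    have sm: "smooth_into A J (\<lambda>t. \<Gamma> (s, t))"
      by (rule smooth_into_compose[OF smooth_structure \<Gamma> U J(1)])
        (use s\<delta> smooth_on_Pair[OF J(1) smooth_on_const[OF J(1)] smooth_on_linear_id[OF J(1) bounded_linear_ident]] in auto)
    have "F (velocity A (\<lambda>t. \<Gamma> (s, t)) t) = f (X (s, t), Xt (s, t))" if t: "t \<in> {a..b}" for t
      unfolding X_def
    proof (rule bundle_chart_velocity(3)[OF sm J(1)])
      show "((\<lambda>t. snd c (\<Gamma> (s, t))) has_vector_derivative Xt (s, t)) (at t)"
        using smooth_on_partial_snd[OF W(2) box[OF s t]] by (simp add: X_def Xt_def)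
    qed (use J t box[OF s t] in \<open>auto simp: W_def\<close>)
    then have "integral {a..b} (\<lambda>t. (F (velocity A (\<lambda>t. \<Gamma> (s, t)) t))\<^sup>2) = integral {a..b} (\<lambda>t. (f (X (s, t), Xt (s, t)))\<^sup>2)"
      by (intro integral_cong) simp
    then show ?thesis unfolding energy_def L_def by simp
  qed
  then show ?thesis
    by (intro has_field_derivative_transform_within_open[OF fv open_greaterThanLessThan[of "-e" e]]) (use e in auto)
qed

section \<open>Geodesics and solutions of the spray\<close>

lemma slit_chart:
  assumes "w \<in> slit"
  shows "fst w \<in> snd c ` fst c" "chart_inv c (fst w) \<in> fst c" "snd c (chart_inv c (fst w)) = fst w"
proof -
  show *: "fst w \<in> snd c ` fst c" using assms unfolding slit_def by (auto simp: D_def)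
  show "chart_inv c (fst w) \<in> fst c" "snd c (chart_inv c (fst w)) = fst w"
    using chart_inv_in_domain[OF chart *] chart_chart_inv[OF chart *] by auto
qed

lemma spray_smooth_into:
  assumes z: "\<And>t. t \<in> {lo<..<hi} \<Longrightarrow> (z has_vector_derivative spray (z t)) (at t)"
    "\<And>t. t \<in> {lo<..<hi} \<Longrightarrow> z t \<in> slit"
  shows "smooth_into A {lo<..<hi} (\<lambda>t. chart_inv c (fst (z t)))"
proof (rule smooth_into_chart_inv[OF smooth_structure c open_greaterThanLessThan])
  show "smooth_on (\<lambda>t. fst (z t)) {lo<..<hi}"
    by (rule smooth_on_linear[OF open_greaterThanLessThan bounded_linear_fst ode_smooth[OF open_slit smooth_spray open_greaterThanLessThan z]])
  show "(\<lambda>t. fst (z t)) ` {lo<..<hi} \<subseteq> snd c ` fst c" using z(2) slit_chart(1) by blast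
qed

lemma spray_velocity:
  assumes z: "\<And>t. t \<in> {lo<..<hi} \<Longrightarrow> (z has_vector_derivative spray (z t)) (at t)"
    "\<And>t. t \<in> {lo<..<hi} \<Longrightarrow> z t \<in> slit" and t: "t \<in> {lo<..<hi}"
  shows "velocity A (\<lambda>t. chart_inv c (fst (z t))) t = tvec_of A c (z t)"
    "F (velocity A (\<lambda>t. chart_inv c (fst (z t))) t) = f (z t)"
proof -
  have "((\<lambda>t. snd c (chart_inv c (fst (z t)))) has_vector_derivative snd (z t)) (at t)"
    by (rule has_vector_derivative_transform_within_open[OF spray_curve(1)[OF z(1)[OF t]] open_greaterThanLessThan t])
      (simp add: slit_chart(3)[OF z(2)])
  from bundle_chart_velocity(2,3)[OF spray_smooth_into[OF z] open_greaterThanLessThan t _ this] slit_chart[OF z(2)[OF t]]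
  show "velocity A (\<lambda>t. chart_inv c (fst (z t))) t = tvec_of A c (z t)"
    "F (velocity A (\<lambda>t. chart_inv c (fst (z t))) t) = f (z t)" by auto
qed

text \<open>Every admissible variation is tested in the chart: fixed end points make the variation
  field vanish at \<open>a\<close> and \<open>b\<close>, and the first variation reduces to boundary
  terms.\<close>

lemma spray_geodesic:
  assumes z: "\<And>t. t \<in> {lo<..<hi} \<Longrightarrow> (z has_vector_derivative spray (z t)) (at t)"
    "\<And>t. t \<in> {lo<..<hi} \<Longrightarrow> z t \<in> slit"
  shows "geodesic A F {lo<..<hi} (\<lambda>t. chart_inv c (fst (z t)))"
  unfolding geodesic_def
proof (intro conjI allI impI)
  show "open {lo<..<hi}" "is_interval {lo<..<hi}" by auto
  show "smooth_into A {lo<..<hi} (\<lambda>t. chart_inv c (fst (z t)))" by (rule spray_smooth_into[OF z])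
  fix a b :: real assume ab: "a < b \<and> {a..b} \<subseteq> {lo<..<hi}"
  show "energy_critical A F a b (\<lambda>t. chart_inv c (fst (z t)))"
    unfolding energy_critical_def
  proof (intro allI impI, elim conjE)
    fix \<delta> :: real and J and \<Gamma> :: "real \<times> real \<Rightarrow> 'm"
    assume \<delta>: "0 < \<delta>" and J: "open J" "{a..b} \<subseteq> J" and \<Gamma>: "smooth_into A ({-\<delta><..<\<delta>} \<times> J) \<Gamma>"
      and \<Gamma>0: "\<forall>t\<in>{a..b}. \<Gamma> (0, t) = chart_inv c (fst (z t))"
      and ends: "\<forall>s\<in>{-\<delta><..<\<delta>}. \<Gamma> (s, a) = chart_inv c (fst (z a)) \<and> \<Gamma> (s, b) = chart_inv c (fst (z b))"
    have zab: "z t \<in> slit" "(z has_vector_derivative spray (z t)) (at t)" if "t \<in> {a..b}" for t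
      using z[of t] subsetD[OF conjunct2[OF ab] that] by auto
    let ?U = "{-\<delta><..<\<delta>} \<times> J"
    define X where "X z = snd c (\<Gamma> z)" for z
    define W where "W = {z \<in> ?U. \<Gamma> z \<in> fst c}"
    let ?Xs = "\<lambda>z. frechet_derivative X (at z) (1, 0)" and ?Xt = "\<lambda>z. frechet_derivative X (at z) (0, 1)"
    have U: "open ?U" by (intro open_Times J) auto
    note W = variation_domain[OF \<Gamma> U, folded W_def X_def]
    have dom: "\<Gamma> (0, t) \<in> fst c" "X (0, t) = fst (z t)" if "t \<in> {a..b}" for t
      using \<Gamma>0 that slit_chart[OF zab(1)[OF that]] by (auto simp: X_def)
    have sub: "{0} \<times> {a..b} \<subseteq> W" using dom \<delta> J by (auto simp: W_def)
    \<comment> \<open>The variation is the given curve on the closed interval only, so derivatives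
      are compared within \<open>{a..b}\<close>; at the end points one-sided derivatives are still
      unique.\<close>
    have Xt: "?Xt (0, t) = snd (z t)" if t: "t \<in> {a..b}" for t
    proof (rule vector_derivative_unique_within_closed_interval[where f = "\<lambda>t. X (0, t)" and x = t and a = a and b = b])
      show "((\<lambda>t. X (0, t)) has_vector_derivative ?Xt (0, t)) (at t within cbox a b)"
        by (rule has_vector_derivative_at_within[OF smooth_on_partial_snd[OF W(2)]]) (use sub t in auto)
      have "((\<lambda>t. fst (z t)) has_vector_derivative snd (z t)) (at t within cbox a b)"
        by (rule has_vector_derivative_at_within[OF spray_curve(1)[OF zab(2)[OF t]]])
      then show "((\<lambda>t. X (0, t)) has_vector_derivative snd (z t)) (at t within cbox a b)"
        by (rule has_vector_derivative_transform[rotated 2]) (use dom t in auto)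
    qed (use ab t in auto)
    have XZ: "(X (0, t), ?Xt (0, t)) = z t" if "t \<in> {a..b}" for t
      using dom[OF that] Xt[OF that] by simp
    have Xs0: "?Xs (0, u) = 0" if u: "u = a \<or> u = b" for u
    proof -
      have uW: "(0, u) \<in> W" using sub u ab by auto
      have "((\<lambda>s. X (0, u)) has_vector_derivative ?Xs (0, u)) (at 0)"
      proof (rule has_vector_derivative_transform_within_open[OF smooth_on_partial_fst[OF W(2) uW]])
        show "X (s, u) = X (0, u)" if "s \<in> {-\<delta><..<\<delta>}" for s
          using ends u that \<delta> by (auto simp: X_def)
      qed (use \<delta> in auto)
      then show ?thesis using vector_derivative_unique_at has_vector_derivative_const by blast
    qed
    have nz: "?Xt (0, t) \<noteq> 0" if "t \<in> {a..b}" for t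
      using Xt[OF that] zab(1)[OF that] by (cases "z t") auto
    have "integral {a..b} (\<lambda>t. q (X (0, t), ?Xt (0, t)) \<bullet> ?Xs (0, t)
      + p (X (0, t), ?Xt (0, t)) \<bullet> frechet_derivative ?Xt (at (0, t)) (1, 0)) = 0"
    proof (rule euler_lagrange_stationary[OF W(1,2) sub])
      fix t assume t: "t \<in> {a..b}"
      have "((\<lambda>t. p (z t)) has_vector_derivative q (z t)) (at t within {a..b})"
        by (rule has_vector_derivative_at_within[OF spray_euler_lagrange[OF zab(2,1)[OF t]]])
      then show "((\<lambda>t. p (X (0, t), ?Xt (0, t))) has_vector_derivative q (X (0, t), ?Xt (0, t))) (at t within {a..b})"
        unfolding XZ[OF t] by (rule has_vector_derivative_transform[rotated 2]) (use XZ t in auto)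
    qed (use ab Xs0 in auto)
    with energy_variation[OF \<delta> J _ \<Gamma> dom(1)] nz ab
    show "((\<lambda>s. energy A F a b (\<lambda>t. \<Gamma> (s, t))) has_real_derivative 0) (at 0)"
      by (simp add: X_def[abs_def])
  qed
qed

text \<open>A variation built in coordinates feeds \<open>stationary_imp_geodesic_equation\<close>.
  The work takes place on the open set \<open>J\<close> of times at which the curve is in the chart
  and its velocity nonzero.\<close>

lemma geodesic_spray:
  assumes g: "geodesic A F I \<gamma>" and t0: "t0 \<in> I" "\<gamma> t0 \<in> fst c" "snd (velocity A \<gamma> t0) c \<noteq> 0"
  shows "((\<lambda>t. (snd c (\<gamma> t), snd (velocity A \<gamma> t) c)) has_vector_derivative
    spray (snd c (\<gamma> t0), snd (velocity A \<gamma> t0) c)) (at t0)"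
proof -
  have I: "open I" and \<gamma>: "smooth_into A I \<gamma>" and crit: "\<And>a b. a < b \<Longrightarrow> {a..b} \<subseteq> I \<Longrightarrow> energy_critical A F a b \<gamma>"
    using g by (auto simp: geodesic_def)
  define x where "x t = snd c (\<gamma> t)" for t
  define y where "y t = snd (velocity A \<gamma> t) c" for t
  define I' where "I' = {t \<in> I. \<gamma> t \<in> fst c}"
  note I' = variation_domain[OF \<gamma> I, folded I'_def x_def]
  have xy: "(x has_vector_derivative y t) (at t)" if "t \<in> I'" for t
    unfolding x_def y_def by (rule smooth_into_coord_derivative[OF \<gamma> c]) (use that in \<open>auto simp: I'_def\<close>)
  have y_eq: "frechet_derivative x (at t) 1 = y t" if "t \<in> I'" for t
    by (rule vector_derivative_unique_at[OF smooth_on_vector_derivative[OF I'(2) that] xy[OF that]])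
  have smy: "smooth_on y I'"
    using smooth_on_cong[OF I'(1), of "\<lambda>t. frechet_derivative x (at t) 1" y] y_eq
      smooth_on_derivative[OF I'(2), of 1] by blast
  define J where "J = I' \<inter> y -` (- {0})"
  have J: "open J" unfolding J_def
    by (rule continuous_open_preimage[OF smooth_on_imp_continuous[OF smy] I'(1)]) auto
  have JI': "J \<subseteq> I'" by (auto simp: J_def)
  have "((\<lambda>t. (x t, y t)) has_vector_derivative spray (x t0, y t0)) (at t0)"
  proof (rule stationary_imp_geodesic_equation[OF J smooth_on_subset[OF I'(2) JI'] smooth_on_subset[OF smy JI']])
    show "t0 \<in> J" using t0 by (auto simp: J_def I'_def y_def)
    show "(x has_vector_derivative y t) (at t)" if "t \<in> J" for t using xy that by (auto simp: J_def)
    show "(x t, y t) \<in> slit" if "t \<in> J" for t using I'(3)[of t] that by (auto simp: J_def)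
    fix a b :: real and w :: 'e
    assume ab: "a < b" "{a..b} \<subseteq> J"
    \<comment> \<open>The test variation keeps the end points fixed for all \<open>s\<close> and has
      the variation field \<open>(t - a) (b - t) w\<close> at \<open>s = 0\<close>.\<close>
    define Y where "Y z = x (snd z) + (fst z * ((snd z - a) * (b - snd z))) *\<^sub>R w" for z :: "real \<times> real"
    have oUJ: "open ((UNIV :: real set) \<times> J)" by (intro open_Times J) auto
    have smY: "smooth_on Y (UNIV \<times> J)"
      unfolding Y_def
      by (intro smooth_on_add smooth_on_scaleR smooth_on_mult smooth_on_minus smooth_on_const oUJ
          smooth_on_linear_id bounded_linear_fst bounded_linear_snd
          smooth_on_compose[OF oUJ J smooth_on_subset[OF I'(2) JI']]) auto
    define W0 where "W0 = (UNIV \<times> J) \<inter> Y -` D"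
    have W0: "open W0" unfolding W0_def
      by (rule continuous_open_preimage[OF smooth_on_imp_continuous[OF smY] oUJ open_D])
    have W0ab: "{0} \<times> {a..b} \<subseteq> W0" using ab I'(3) by (auto simp: W0_def Y_def J_def)
    have "compact ({0::real} \<times> {a..b})" by (intro compact_Times) auto
    then obtain e where e: "e > 0" "(\<Union>x\<in>{0} \<times> {a..b}. cball x e) \<subseteq> W0"
      using compact_subset_open_imp_cball_epsilon_subset[OF _ W0 W0ab] by metis
    \<comment> \<open>Half of \<open>e\<close>, since the distance from \<open>(s, t)\<close> to the
      nearest \<open>(0, t')\<close> is bounded by the sum of the deviations in \<open>s\<close> and
      in \<open>t\<close>.\<close>
    define \<delta> where "\<delta> = e / 2"
    define J' where "J' = {a - \<delta><..<b + \<delta>}"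
    let ?U = "{-\<delta><..<\<delta>} \<times> J'"
    have \<delta>: "\<delta> > 0" using e by (simp add: \<delta>_def)
    have J': "open J'" "{a..b} \<subseteq> J'" using \<delta> by (auto simp: J'_def)
    have U: "open ?U" by (intro open_Times J') auto
    have UW0: "?U \<subseteq> W0"
    proof clarify
      fix s t assume s: "s \<in> {-\<delta><..<\<delta>}" and t: "t \<in> J'"
      define t' where "t' = max a (min b t)"
      have t': "t' \<in> {a..b}" using ab by (auto simp: t'_def)
      have "\<bar>t - t'\<bar> \<le> \<delta>" using t \<delta> by (auto simp: t'_def J'_def max_def min_def)
      moreover have "dist (0, t') (s, t) \<le> \<bar>s\<bar> + \<bar>t - t'\<bar>"
        using sqrt_sum_squares_le_sum_abs[of s "t - t'"] by (simp add: dist_Pair_Pair dist_real_def power2_abs power2_commute)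
      moreover have "\<bar>s\<bar> \<le> \<delta>" using s by auto
      ultimately have "dist (0, t') (s, t) \<le> \<delta> + \<delta>" by linarith
      then have "(s, t) \<in> cball (0, t') e" by (simp add: \<delta>_def)
      then show "(s, t) \<in> W0" using e(2) t' by blast
    qed
    define \<Gamma> where "\<Gamma> z = chart_inv c (Y z)" for z
    have YD: "Y z \<in> D" if "z \<in> ?U" for z using subsetD[OF UW0 that] by (simp add: W0_def)
    have smYU: "smooth_on Y ?U" by (rule smooth_on_subset[OF smY]) (use UW0 in \<open>auto simp: W0_def\<close>)
    have \<Gamma>: "smooth_into A ?U \<Gamma>"
      unfolding \<Gamma>_def by (rule smooth_into_chart_inv[OF smooth_structure c U smYU]) (use YD in \<open>auto simp: D_def\<close>)
    have \<Gamma>c: "\<Gamma> z \<in> fst c" "snd c (\<Gamma> z) = Y z" if "z \<in> ?U" for z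
      unfolding \<Gamma>_def using chart_inv_in_domain[OF chart, of "Y z"] chart_chart_inv[OF chart, of "Y z"] YD[OF that] by (auto simp: D_def)
    define X where "X z = snd c (\<Gamma> z)" for z
    have XY: "X z = Y z" if "z \<in> ?U" for z using \<Gamma>c that by (simp add: X_def)
    have smX: "smooth_on X ?U" by (rule smooth_on_cong[OF U XY, THEN iffD2, OF _ smYU])
    let ?Xs = "\<lambda>z. frechet_derivative X (at z) (1, 0)" and ?Xt = "\<lambda>z. frechet_derivative X (at z) (0, 1)"
    have J'I': "t \<in> I'" "t \<in> J" "(0, t) \<in> ?U" if "t \<in> J'" for t
      using subsetD[OF UW0, of "(0, t)"] that \<delta> JI' by (auto simp: W0_def)
    have X0: "X (0, t) = x t" if "t \<in> J'" for t using XY[OF J'I'(3)[OF that]] by (simp add: Y_def)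
    have Xt: "?Xt (0, t) = y t" if t: "t \<in> J'" for t
    proof (rule vector_derivative_unique_at)
      show "(x has_vector_derivative y t) (at t)" by (rule xy[OF J'I'(1)[OF t]])
      show "(x has_vector_derivative ?Xt (0, t)) (at t)"
        by (rule has_vector_derivative_transform_within_open[OF smooth_on_partial_snd[OF smX J'I'(3)[OF t]] J'(1) t X0])
    qed
    have Xs: "?Xs (0, t) = ((t - a) * (b - t)) *\<^sub>R w" if t: "t \<in> J'" for t
    proof (rule vector_derivative_unique_at)
      show "((\<lambda>s. X (s, t)) has_vector_derivative ?Xs (0, t)) (at 0)"
        by (rule smooth_on_partial_fst[OF smX J'I'(3)[OF t]])
      have "((\<lambda>s. Y (s, t)) has_vector_derivative ((t - a) * (b - t)) *\<^sub>R w) (at 0)"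
        unfolding Y_def by (auto intro!: derivative_eq_intros)
      then show "((\<lambda>s. X (s, t)) has_vector_derivative ((t - a) * (b - t)) *\<^sub>R w) (at 0)"
        by (rule has_vector_derivative_transform_within_open[OF _ open_greaterThanLessThan[of "-\<delta>" \<delta>]]) (use \<delta> t XY in auto)
    qed
    have Xst: "frechet_derivative ?Xt (at (0, t)) (1, 0) = (a + b - 2 * t) *\<^sub>R w" if t: "t \<in> J'" for t
    proof (rule vector_derivative_unique_at)
      have "((\<lambda>t. ?Xs (0, t)) has_vector_derivative frechet_derivative ?Xt (at (0, t)) (1, 0)) (at t)"
        by (rule mixed_partials[OF U smX J'I'(3)[OF t]])
      then show "((\<lambda>t. ((t - a) * (b - t)) *\<^sub>R w) has_vector_derivative frechet_derivative ?Xt (at (0, t)) (1, 0)) (at t)"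
        by (rule has_vector_derivative_transform_within_open[OF _ J'(1) t]) (rule Xs)
      have "((\<lambda>t. (t - a) * (b - t)) has_vector_derivative (a + b - 2 * t)) (at t)"
        by (auto intro!: derivative_eq_intros simp: algebra_simps)
      then show "((\<lambda>t. ((t - a) * (b - t)) *\<^sub>R w) has_vector_derivative (a + b - 2 * t) *\<^sub>R w) (at t)"
        by (rule bounded_linear.has_vector_derivative[OF bounded_linear_scaleR_left])
    qed
    have abJ': "t \<in> J'" if "t \<in> {a..b}" for t using J'(2) that by blast
    have \<Gamma>\<gamma>: "\<Gamma> (0, t) = \<gamma> t" if "t \<in> J'" for t
      using J'I'(1)[OF that] by (simp add: \<Gamma>_def Y_def x_def I'_def chart_inv_chart[OF chart])
    have \<Gamma>ends: "\<Gamma> (s, a) = \<gamma> a" "\<Gamma> (s, b) = \<gamma> b" for s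
      using \<Gamma>\<gamma>[OF abJ', of a] \<Gamma>\<gamma>[OF abJ', of b] ab(1) by (auto simp: \<Gamma>_def Y_def)
    have "{a..b} \<subseteq> I" using ab(2) by (auto simp: J_def I'_def)
    from crit[OF ab(1) this] have "((\<lambda>s. energy A F a b (\<lambda>t. \<Gamma> (s, t))) has_real_derivative 0) (at 0)"
      unfolding energy_critical_def using \<delta> J' \<Gamma> \<Gamma>\<gamma>[OF abJ'] \<Gamma>ends by blast
    moreover have "((\<lambda>s. energy A F a b (\<lambda>t. \<Gamma> (s, t))) has_real_derivative
      integral {a..b} (\<lambda>t. q (X (0, t), ?Xt (0, t)) \<bullet> ?Xs (0, t)
      + p (X (0, t), ?Xt (0, t)) \<bullet> frechet_derivative ?Xt (at (0, t)) (1, 0))) (at 0)"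
      unfolding X_def[abs_def]
    proof (rule energy_variation[OF \<delta> J' _ \<Gamma>])
      show "a \<le> b" using ab by simp
      fix t assume "t \<in> {a..b}"
      then have t: "t \<in> J'" by (rule abJ')
      show "\<Gamma> (0, t) \<in> fst c" by (rule \<Gamma>c(1)[OF J'I'(3)[OF t]])
      show "frechet_derivative (\<lambda>z. snd c (\<Gamma> z)) (at (0, t)) (0, 1) \<noteq> 0"
        using Xt[OF t] J'I'(2)[OF t] by (simp add: X_def[abs_def] J_def)
    qed
    ultimately have "integral {a..b} (\<lambda>t. q (X (0, t), ?Xt (0, t)) \<bullet> ?Xs (0, t)
      + p (X (0, t), ?Xt (0, t)) \<bullet> frechet_derivative ?Xt (at (0, t)) (1, 0)) = 0"
      by (rule DERIV_unique[rotated])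
    also have "integral {a..b} (\<lambda>t. q (X (0, t), ?Xt (0, t)) \<bullet> ?Xs (0, t)
      + p (X (0, t), ?Xt (0, t)) \<bullet> frechet_derivative ?Xt (at (0, t)) (1, 0)) =
      integral {a..b} (\<lambda>t. q (x t, y t) \<bullet> (((t - a) * (b - t)) *\<^sub>R w) + p (x t, y t) \<bullet> ((a + b - 2 * t) *\<^sub>R w))"
      by (rule integral_cong) (simp only: X0 Xt Xs Xst abJ')
    finally show "integral {a..b} (\<lambda>t. q (x t, y t) \<bullet> (((t - a) * (b - t)) *\<^sub>R w) + p (x t, y t) \<bullet> ((a + b - 2 * t) *\<^sub>R w)) = 0" .
  qed
  then show ?thesis by (simp add: x_def y_def)
qed

text \<open>A continuation argument. The curve \<open>\<gamma>\<close> is not assumed to stay in the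
  chart; agreement with \<open>z\<close> is what puts it there. The times up to which it is in the
  chart with state \<open>z\<close> are shown to fill \<open>{0..1}\<close>.\<close>

lemma spray_unique_geodesic:
  assumes z: "\<And>t. t \<in> {lo<..<hi} \<Longrightarrow> (z has_vector_derivative spray (z t)) (at t)"
    "\<And>t. t \<in> {lo<..<hi} \<Longrightarrow> z t \<in> slit" and lohi: "lo < 0" "1 < hi"
    and g: "geodesic A F I \<gamma>" "{0..1} \<subseteq> I" and v: "velocity A \<gamma> 0 = tvec_of A c (z 0)"
  shows "\<gamma> 1 = chart_inv c (fst (z 1))"
proof -
  have I: "open I" and \<gamma>: "smooth_into A I \<gamma>" using g by (auto simp: geodesic_def)
  define w where "w t = (snd c (\<gamma> t), snd (velocity A \<gamma> t) c)" for t
  define P where "P t \<longleftrightarrow> \<gamma> t \<in> fst c \<and> w t = z t" for t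
  define I' where "I' = {t \<in> I. \<gamma> t \<in> fst c}"
  note I' = variation_domain[OF \<gamma> I, folded I'_def]
  have zI: "t \<in> {lo<..<hi}" if "t \<in> {0..1}" for t using that lohi by auto
  have P_\<gamma>: "\<gamma> t = chart_inv c (fst (z t))" if "P t" for t
    using that chart_inv_chart[OF chart, of "\<gamma> t"] by (auto simp: P_def w_def dest!: arg_cong[of _ _ fst])
  have cz: "continuous_on {0..1} z"
    using zI by (intro continuous_at_imp_continuous_on ballI has_vector_derivative_continuous[OF z(1)]) auto
  have smw: "smooth_on w I'"
  proof -
    have "smooth_on (\<lambda>t. (snd c (\<gamma> t), frechet_derivative (\<lambda>t. snd c (\<gamma> t)) (at t) 1)) I'"
      by (intro smooth_on_Pair I' smooth_on_derivative)
    moreover have "(snd c (\<gamma> t), frechet_derivative (\<lambda>t. snd c (\<gamma> t)) (at t) 1) = w t" if "t \<in> I'" for t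
      using vector_derivative_unique_at[OF smooth_on_vector_derivative[OF I'(2) that] smooth_into_coord_derivative[OF \<gamma> c]] that
      by (simp add: w_def I'_def)
    ultimately show ?thesis
      using smooth_on_cong[OF I'(1), of "\<lambda>t. (snd c (\<gamma> t), frechet_derivative (\<lambda>t. snd c (\<gamma> t)) (at t) 1)" w] by blast
  qed
  have cw: "isCont w t" if "t \<in> I'" for t
    using smooth_on_imp_continuous[OF smw] I'(1) that by (simp add: continuous_on_eq_continuous_at)
  have c\<gamma>: "continuous_on {0..1} \<gamma>" using \<gamma> g(2) by (auto simp: smooth_into_def intro: continuous_on_subset)
  have P0: "P 0"
  proof -
    have 0: "0 \<in> {lo<..<hi}" using lohi by auto
    have "fst (z 0) \<in> D" using z(2)[OF 0] unfolding slit_def by auto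
    then have tv: "tvec_of A c (z 0) \<in> bundle_over A c" "bundle_chart c (tvec_of A c (z 0)) = z 0"
      using tvec_of_coords(3,4)[of "fst (z 0)" "snd (z 0)"] by auto
    have "fst (velocity A \<gamma> 0) = \<gamma> 0" by (simp add: velocity_def)
    then have "\<gamma> 0 \<in> fst c" using tv(1) v by (simp add: bundle_over_def)
    moreover have "w 0 = bundle_chart c (velocity A \<gamma> 0)" by (simp add: w_def bundle_chart_def velocity_def)
    ultimately show ?thesis using v tv(2) by (simp add: P_def)
  qed
  \<comment> \<open>Openness: agreement at \<open>t\<close> puts the state \<open>w t\<close> in the
    slit bundle, so the geodesic equation holds for \<open>\<gamma>\<close> near \<open>t\<close>
    and uniqueness applies.\<close>
  have step: "\<exists>d>0. t + d \<le> 1 \<and> (\<forall>s\<in>{t..t + d}. P s)" if t: "0 \<le> t" "t < 1" "P t" for t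
  proof -
    have tI: "t \<in> I" using g(2) t by auto
    have wslit: "w t \<in> slit" using t z(2)[OF zI] by (auto simp: P_def)
    have tI': "t \<in> I'" using tI t by (auto simp: I'_def P_def)
    have "open (I' \<inter> w -` slit)"
      by (rule continuous_open_preimage[OF smooth_on_imp_continuous[OF smw] I'(1) open_slit])
    then obtain e where e: "e > 0" "cball t e \<subseteq> I' \<inter> w -` slit"
      using tI' wslit open_contains_cball by (metis IntI vimageI)
    define b where "b = min (t + e) 1"
    have b: "t < b" "b \<le> 1" using t e by (auto simp: b_def)
    have sub: "s \<in> I' \<inter> w -` slit" if "s \<in> {t..b}" for s
      by (rule subsetD[OF e(2)]) (use that in \<open>auto simp: b_def dist_real_def\<close>)
    have dw: "(w has_vector_derivative spray (w s)) (at s)" if "s \<in> {t..b}" for s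
      using sub[OF that] geodesic_spray[OF g(1), of s] by (auto simp: w_def[abs_def] I'_def)
    have dz: "(z has_vector_derivative spray (z s)) (at s)" if "s \<in> {t..b}" for s
      using z(1)[OF zI] that t b by auto
    obtain d where d: "d > 0" "t + d \<le> b" "\<And>s. s \<in> {t..t + d} \<Longrightarrow> w s = z s"
      using ode_unique[OF open_slit smooth_spray b(1) dw dz _ wslit] t by (auto simp: P_def)
    have "P s" if "s \<in> {t..t + d}" for s
      using d sub[of s] that by (auto simp: P_def I'_def)
    then show ?thesis using d b by (intro exI[of _ d]) auto
  qed
  define S where "S = {t \<in> {0..1}. \<forall>s\<in>{0..t}. P s}"
  define T where "T = Sup S"
  have S0: "0 \<in> S" using P0 by (auto simp: S_def)
  have bdd: "bdd_above S" by (auto simp: S_def bdd_above_def)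
  have T01: "0 \<le> T" "T \<le> 1"
  proof -
    show "0 \<le> T" unfolding T_def by (rule cSup_upper[OF S0 bdd])
    show "T \<le> 1"
      unfolding T_def
    proof (rule cSup_least)
      show "S \<noteq> {}" using S0 by blast
    qed (auto simp: S_def)
  qed
  have PT: "P s" if s: "0 \<le> s" "s < T" for s
  proof -
    have "S \<noteq> {}" using S0 by blast
    then obtain t where "t \<in> S" "s < t" using less_cSupD[of S s] s(2) unfolding T_def by blast
    then show ?thesis using s(1) by (auto simp: S_def)
  qed
  have "P T"
  proof (cases "T = 0")
    case True then show ?thesis using P0 by simp
  next
    case False
    then have T0: "0 < T" using T01 by simp
    have cTz: "continuous_on {0..T} z" "continuous_on {0..T} \<gamma>"
      using cz c\<gamma> T01 by (auto intro: continuous_on_subset)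
    have zD: "fst (z t) \<in> snd c ` fst c" if "t \<in> {0..T}" for t
      using slit_chart(1)[OF z(2)[OF zI]] that T01 by auto
    \<comment> \<open>Closedness: by continuity in the Hausdorff manifold, \<open>\<gamma> T\<close>
      is the point with coordinates \<open>fst (z T)\<close>. Only this shows that it lies in the
      chart, after which the velocities are compared in the same way.\<close>
    have eq\<gamma>: "\<gamma> T = chart_inv c (fst (z T))"
    proof -
      have "continuous_on {0..T} (\<lambda>t. chart_inv c (fst (z t)))"
        by (rule continuous_on_compose2[OF continuous_chart_inv[OF chart] continuous_on_fst[OF cTz(1)]]) (use zD in auto)
      from continuous_on_eq_at_end[OF T0 cTz(2) this] show ?thesis using PT P_\<gamma> by blast
    qed
    have TI': "T \<in> I'"
      using eq\<gamma> chart_inv_in_domain[OF chart zD, of T] T01 g(2) by (auto simp: I'_def)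
    have "t \<in> I'" if "t \<in> {0..T}" for t
      using PT[of t] TI' that T01 g(2) by (cases "t = T") (auto simp: I'_def P_def)
    then have "continuous_on {0..T} w"
      by (intro continuous_on_subset[OF smooth_on_imp_continuous[OF smw]]) auto
    from continuous_on_eq_at_end[OF T0 this cTz(1)] have "w T = z T" using PT unfolding P_def by blast
    then show ?thesis using TI' by (simp add: P_def I'_def)
  qed
  have "T = 1"
  proof (rule ccontr)
    assume "T \<noteq> 1"
    then have "T < 1" using T01 by simp
    then obtain d where d: "d > 0" "T + d \<le> 1" "\<forall>s\<in>{T..T + d}. P s" using step[OF T01(1) _ \<open>P T\<close>] by blast
    have "P s" if "s \<in> {0..T + d}" for s using PT[of s] d(3) that by (cases "s < T") auto
    then have "T + d \<in> S" using T01 d by (auto simp: S_def)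
    then have "T + d \<le> T" unfolding T_def by (rule cSup_upper[OF _ bdd])
    then show False using d(1) by simp
  qed
  then show ?thesis using P_\<gamma>[OF \<open>P T\<close>] by simp
qed

text \<open>The definite description in \<open>exp_map\<close> needs a value and its uniqueness: the
  first comes from \<open>spray_geodesic\<close>, the second from
  \<open>spray_unique_geodesic\<close>.\<close>

lemma spray_exp_map:
  assumes z: "\<And>t. t \<in> {lo<..<hi} \<Longrightarrow> (z has_vector_derivative spray (z t)) (at t)"
    "\<And>t. t \<in> {lo<..<hi} \<Longrightarrow> z t \<in> slit" and lohi: "lo < 0" "1 < hi"
  shows "geodesic_end A F (tvec_of A c (z 0)) (chart_inv c (fst (z 1)))"
    "exp_map A F (tvec_of A c (z 0)) = chart_inv c (fst (z 1))"
proof -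
  have 0: "0 \<in> {lo<..<hi}" using lohi by auto
  show ge: "geodesic_end A F (tvec_of A c (z 0)) (chart_inv c (fst (z 1)))"
    unfolding geodesic_end_def
    by (rule exI[of _ "{lo<..<hi}"], rule exI[of _ "\<lambda>t. chart_inv c (fst (z t))"])
      (use spray_geodesic[OF z] spray_velocity(1)[OF z 0] lohi in auto)
  show "exp_map A F (tvec_of A c (z 0)) = chart_inv c (fst (z 1))"
    unfolding exp_map_def
  proof (rule the_equality)
    show "geodesic_end A F (tvec_of A c (z 0)) (chart_inv c (fst (z 1)))" by (rule ge)
    fix y assume "geodesic_end A F (tvec_of A c (z 0)) y"
    then obtain I \<gamma> where "geodesic A F I \<gamma>" "{0..1} \<subseteq> I" "velocity A \<gamma> 0 = tvec_of A c (z 0)" "\<gamma> 1 = y"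
      unfolding geodesic_end_def by blast
    then show "y = chart_inv c (fst (z 1))" using spray_unique_geodesic[OF z lohi] by blast
  qed
qed

end

section \<open>The distance from the submanifold\<close>

lemma velocity_cong:
  fixes A :: "('m::topological_space, 'e::euclidean_space) chart set"
  assumes "open U" "t \<in> U" "\<And>s. s \<in> U \<Longrightarrow> \<gamma> s = \<eta> s"
  shows "velocity A \<gamma> t = velocity A \<eta> t"
proof -
  have "((snd c \<circ> \<gamma>) has_vector_derivative d) (at t) \<longleftrightarrow> ((snd c \<circ> \<eta>) has_vector_derivative d) (at t)"
    for c :: "('m, 'e) chart" and d
    using has_vector_derivative_transform_within_open[of "snd c \<circ> \<gamma>" d t U "snd c \<circ> \<eta>"]
      has_vector_derivative_transform_within_open[of "snd c \<circ> \<eta>" d t U "snd c \<circ> \<gamma>"] assms by auto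
  then have "vector_derivative (snd c \<circ> \<gamma>) (at t) = vector_derivative (snd c \<circ> \<eta>) (at t)"
    for c :: "('m, 'e) chart"
    by (simp add: vector_derivative_def)
  then show ?thesis using assms(2,3) by (auto simp: velocity_def)
qed

lemma speed_continuous_nonneg:
  assumes fm: "finsler_manifold A F" and \<gamma>: "smooth_into A J \<gamma>" "open J"
  shows "continuous_on J (\<lambda>t. F (velocity A \<gamma> t))" and "t \<in> J \<Longrightarrow> 0 \<le> F (velocity A \<gamma> t)"
proof -
  have A: "smooth_structure A" and F: "finsler_metric A F"
    using fm by (auto simp: finsler_manifold_def smooth_manifold_def)
  have "continuous_map (top_of_set J) euclideanreal (F \<circ> velocity A \<gamma>)"
    using F by (intro continuous_map_compose[OF continuous_velocity[OF A \<gamma>]]) (simp add: finsler_metric_def)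
  then show "continuous_on J (\<lambda>t. F (velocity A \<gamma> t))" by (simp add: o_def)
  show "0 \<le> F (velocity A \<gamma> t)" if "t \<in> J"
    using F velocity_in_tangent_space[OF A \<gamma> that] by (auto simp: finsler_metric_def tangent_bundle_def)
qed

text \<open>The velocity at the break points of \<open>\<gamma>\<close> is meaningless, so the speed is redefined there.\<close>

lemma piecewise_smooth_speed:
  assumes fm: "finsler_manifold A F" and pw: "piecewise_smooth A a b \<gamma>" and "a < b"
  obtains E g where "finite E" "g integrable_on {a..b}" "integral {a..b} g = curve_length A F a b \<gamma>"
    "\<And>t. 0 \<le> g t"
    "\<And>t. t \<in> {a<..<b} - E \<Longrightarrow> isCont g t \<and> g t = F (velocity A \<gamma> t) \<and> (\<exists>J. open J \<and> t \<in> J \<and> smooth_into A J \<gamma>)"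
proof -
  have A: "smooth_structure A" using fm by (simp add: finsler_manifold_def smooth_manifold_def)
  obtain n \<tau> where \<tau>: "\<tau> 0 = a" "\<tau> n = b" and pieces: "\<And>i. i < n \<Longrightarrow> \<tau> i < \<tau> (Suc i) \<and>
      (\<exists>J \<eta>. open J \<and> {\<tau> i..\<tau> (Suc i)} \<subseteq> J \<and> smooth_into A J \<eta> \<and> (\<forall>t\<in>{\<tau> i..\<tau> (Suc i)}. \<eta> t = \<gamma> t))"
    using pw unfolding piecewise_smooth_def by metis
  let ?h = "\<lambda>t. F (velocity A \<gamma> t)"
  define E where "E = \<tau> ` {..n}"
  have E: "finite E" by (simp add: E_def)
  have piece: "smooth_into A {\<tau> i<..<\<tau> (Suc i)} \<gamma> \<and> ?h integrable_on {\<tau> i..\<tau> (Suc i)}" if i: "i < n" for i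
  proof -
    obtain J \<eta> where J: "open J" "{\<tau> i..\<tau> (Suc i)} \<subseteq> J" and \<eta>: "smooth_into A J \<eta>"
      and eq: "\<And>t. t \<in> {\<tau> i..\<tau> (Suc i)} \<Longrightarrow> \<eta> t = \<gamma> t" using pieces[OF i] by blast
    have "smooth_into A {\<tau> i<..<\<tau> (Suc i)} \<eta>"
      by (rule smooth_into_subset[OF \<eta>]) (use J(2) greaterThanLessThan_subseteq_atLeastAtMost_iff in \<open>blast intro: less_imp_le\<close>)
    then have "smooth_into A {\<tau> i<..<\<tau> (Suc i)} \<gamma>"
      by (rule smooth_into_cong[OF A _ open_greaterThanLessThan]) (use eq in auto)
    moreover have "?h integrable_on {\<tau> i..\<tau> (Suc i)}"
    proof (rule integrable_spike_finite[of "{\<tau> i, \<tau> (Suc i)}"])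
      show "(\<lambda>t. F (velocity A \<eta> t)) integrable_on {\<tau> i..\<tau> (Suc i)}"
        by (intro integrable_continuous_interval continuous_on_subset[OF speed_continuous_nonneg(1)[OF fm \<eta> J(1)] J(2)])
      fix t assume "t \<in> {\<tau> i..\<tau> (Suc i)} - {\<tau> i, \<tau> (Suc i)}"
      then have "t \<in> {\<tau> i<..<\<tau> (Suc i)}" by auto
      from velocity_cong[OF open_greaterThanLessThan this, of \<gamma> \<eta> A] eq
      show "?h t = F (velocity A \<eta> t)" by simp
    qed simp
    ultimately show ?thesis by blast
  qed
  have int: "\<tau> 0 \<le> \<tau> k \<and> ?h integrable_on {\<tau> 0..\<tau> k}" if "k \<le> n" for k
    using that
  proof (induction k)
    case 0
    then show ?case using integrable_on_refl[of ?h "\<tau> 0"] by simp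
  next
    case (Suc k)
    then have k: "k < n" by simp
    have "?h integrable_on {\<tau> 0..\<tau> (Suc k)}"
      by (rule Henstock_Kurzweil_Integration.integrable_combine[of "\<tau> 0" "\<tau> k" "\<tau> (Suc k)"]) (use Suc pieces[OF k] piece[OF k] in auto)
    then show ?case using Suc pieces[OF k] by auto
  qed
  have cover: "\<exists>i<n. t \<in> {\<tau> i<..<\<tau> (Suc i)}" if t: "t \<in> {a<..<b} - E" for t
  proof -
    have "\<exists>i<k. t \<in> {\<tau> i<..<\<tau> (Suc i)}" if "k \<le> n" "t < \<tau> k" for k
      using that
    proof (induction k)
      case 0
      then show ?case using t \<tau> by auto
    next
      case (Suc k)
      have "t \<noteq> \<tau> k" using t Suc.prems by (auto simp: E_def)
      then show ?case
        using Suc by (cases "t < \<tau> k") (auto simp: less_Suc_eq)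
    qed
    then show ?thesis using t \<tau>(2) by auto
  qed
  have smooth: "\<exists>J. open J \<and> t \<in> J \<and> smooth_into A J \<gamma>" if "t \<in> {a<..<b} - E" for t
    using cover[OF that] piece open_greaterThanLessThan by blast
  \<comment> \<open>The default value 0 keeps \<open>g\<close> nonnegative for every
    \<open>t\<close>.\<close>
  define g where "g t = (if t \<in> {a<..<b} - E then ?h t else 0)" for t
  have op: "open ({a<..<b} - E)" by (intro open_Diff finite_imp_closed E) auto
  have spike: "g t = ?h t" if "t \<in> {a..b} - (E \<union> {a, b})" for t using that by (auto simp: g_def)
  show ?thesis
  proof (rule that[OF E, of g])
    have hi: "?h integrable_on {a..b}" using int[of n] \<tau> by simp
    show "g integrable_on {a..b}"
    proof (rule integrable_spike_finite[of "E \<union> {a, b}" _ _ ?h])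
      show "finite (E \<union> {a, b})" using E by simp
      show "g t = ?h t" if "t \<in> {a..b} - (E \<union> {a, b})" for t by (rule spike[OF that])
    qed (rule hi)
    show "integral {a..b} g = curve_length A F a b \<gamma>"
      unfolding curve_length_def
    proof (rule integral_spike)
      show "negligible (E \<union> {a, b})" using E by (intro negligible_finite) simp
    qed (rule spike[symmetric])
    show "0 \<le> g t" for t
      using smooth speed_continuous_nonneg(2)[OF fm] by (auto simp: g_def)
    fix t assume t: "t \<in> {a<..<b} - E"
    obtain J where J: "open J" "t \<in> J" "smooth_into A J \<gamma>" using smooth[OF t] by blast
    have "isCont ?h t"
      using speed_continuous_nonneg(1)[OF fm J(3,1)] J by (simp add: continuous_on_eq_continuous_at)
    moreover have "\<forall>\<^sub>F s in nhds t. ?h s = g s"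
      using eventually_nhds_in_open[OF op t] by eventually_elim (simp add: g_def)
    ultimately have "isCont g t" using isCont_cong[of ?h g t] by simp
    then show "isCont g t \<and> g t = ?h t \<and> (\<exists>J. open J \<and> t \<in> J \<and> smooth_into A J \<gamma>)"
      using t smooth[OF t] by (simp add: g_def)
  qed
qed

context finsler_coord
begin

text \<open>A curve that leaves the ball is cut at the last time when it is on the sphere.\<close>

lemma curve_length_lower_bound:
  assumes \<rho>: "cball x0 \<rho> \<subseteq> D"
    and pw: "piecewise_smooth A a b \<gamma>" "a < b" and fin: "\<gamma> b \<in> fst c" "snd c (\<gamma> b) \<in> ball x0 \<rho>"
    and start: "\<gamma> a \<in> fst c \<Longrightarrow> P (snd c (\<gamma> a))"
    and min: "\<And>\<alpha> x g. speed_of \<alpha> b x g \<Longrightarrow> \<forall>t\<in>{\<alpha>..b}. x t \<in> cball x0 \<rho> \<Longrightarrow> x b = snd c (\<gamma> b) \<Longrightarrow>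
      P (x \<alpha>) \<or> norm (x \<alpha> - x0) = \<rho> \<Longrightarrow> T \<le> integral {\<alpha>..b} g"
  shows "T \<le> curve_length A F a b \<gamma>"
proof -
  obtain E g where E: "finite E" and gi: "g integrable_on {a..b}" and gl: "integral {a..b} g = curve_length A F a b \<gamma>"
    and g0: "\<And>t. 0 \<le> g t" and g: "\<And>t. t \<in> {a<..<b} - E \<Longrightarrow>
      isCont g t \<and> g t = F (velocity A \<gamma> t) \<and> (\<exists>J. open J \<and> t \<in> J \<and> smooth_into A J \<gamma>)"
    using piecewise_smooth_speed[OF finsler pw] by metis
  have c\<gamma>: "continuous_on {a..b} \<gamma>" using pw(1) by (simp add: piecewise_smooth_def)
  \<comment> \<open>\<open>B\<close> and \<open>K\<close> are the open and the closed coordinate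
    ball as subsets of the manifold. \<open>K\<close> is compact, hence closed in the Hausdorff
    manifold, so a limit of points of \<open>B\<close> cannot escape from the chart domain.\<close>
  define B where "B = {m \<in> fst c. snd c m \<in> ball x0 \<rho>}"
  define K where "K = chart_inv c ` cball x0 \<rho>"
  have "B = fst c \<inter> snd c -` ball x0 \<rho>" by (auto simp: B_def)
  then have B: "open B"
    using continuous_open_preimage[OF continuous_chart[OF chart] open_chart_domain[OF chart] open_ball] by simp
  have K: "closed K"
    unfolding K_def
    by (intro compact_imp_closed compact_continuous_image continuous_on_subset[OF continuous_chart_inv[OF chart]])
      (use \<rho> in \<open>auto simp: D_def\<close>)
  have Kc: "m \<in> fst c \<and> snd c m \<in> cball x0 \<rho>" if "m \<in> K" for m
    using that \<rho> chart_inv_in_domain[OF chart] chart_chart_inv[OF chart] by (auto simp: K_def D_def)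
  have BK: "B \<subseteq> K"
  proof
    fix m assume "m \<in> B"
    then have "m = chart_inv c (snd c m)" "snd c m \<in> cball x0 \<rho>"
      using chart_inv_chart[OF chart, of m] by (auto simp: B_def)
    then show "m \<in> K" unfolding K_def by (rule image_eqI)
  qed
  have bB: "\<gamma> b \<in> B" using fin by (simp add: B_def)
  \<comment> \<open>Dropping an initial piece of the curve can only decrease the length, since the
    speed is nonnegative.\<close>
  have main: "T \<le> curve_length A F a b \<gamma>"
    if \<alpha>: "a \<le> \<alpha>" "\<alpha> \<le> b" and inK: "\<And>t. t \<in> {\<alpha>..b} \<Longrightarrow> \<gamma> t \<in> K"
      and st: "P (snd c (\<gamma> \<alpha>)) \<or> norm (snd c (\<gamma> \<alpha>) - x0) = \<rho>" for \<alpha>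
  proof -
    have gi\<alpha>: "g integrable_on {\<alpha>..b}" by (rule integrable_subinterval_real[OF gi]) (use \<alpha> in auto)
    have "speed_of \<alpha> b (\<lambda>t. snd c (\<gamma> t)) g"
      unfolding speed_of_def
    proof (intro conjI ballI exI[of _ E])
      show "continuous_on {\<alpha>..b} (\<lambda>t. snd c (\<gamma> t))"
        by (rule continuous_on_compose2[OF continuous_chart[OF chart] continuous_on_subset[OF c\<gamma>]]) (use \<alpha> inK Kc in auto)
      fix t assume t: "t \<in> {\<alpha><..<b} - E"
      then have tab: "t \<in> {a<..<b} - E" using \<alpha> by auto
      show "isCont g t" using g[OF tab] by simp
      obtain J where J: "open J" "t \<in> J" "smooth_into A J \<gamma>" using g[OF tab] by blast
      have tc: "\<gamma> t \<in> fst c" using Kc[OF inK, of t] t by auto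
      note d = smooth_into_coord_derivative[OF J(3) c J(2) tc]
      show "\<exists>v. ((\<lambda>t. snd c (\<gamma> t)) has_vector_derivative v) (at t) \<and> g t = f (snd c (\<gamma> t), v)"
        using d bundle_chart_velocity(3)[OF J(3,1,2) tc d] g[OF tab] by auto
    qed (use \<alpha> gi\<alpha> g0 E in auto)
    then have "T \<le> integral {\<alpha>..b} g" by (rule min) (use inK Kc st in auto)
    also have "\<dots> \<le> integral {a..b} g"
      by (rule integral_subset_le) (use \<alpha> gi gi\<alpha> g0 in auto)
    finally show ?thesis by (simp add: gl)
  qed
  define S where "S = {a..b} \<inter> \<gamma> -` (- B)"
  have S: "closed S" unfolding S_def by (rule continuous_closed_preimage[OF c\<gamma>]) (use B in auto)
  show ?thesis
  proof (cases "S = {}")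
    case True
    then have inB: "\<gamma> t \<in> B" if "t \<in> {a..b}" for t using that by (auto simp: S_def)
    show ?thesis
      by (rule main[of a]) (use inB BK start pw(2) in \<open>auto simp: B_def\<close>)
  next
    case False
    have bdd: "bdd_above S" by (rule bdd_aboveI[of _ b]) (auto simp: S_def)
    \<comment> \<open>The last time outside the open ball. All later points are in \<open>B\<close>,
      so the point at \<open>\<sigma>\<close> is in \<open>K\<close> but not in \<open>B\<close>,
      that is, on the sphere.\<close>
    define \<sigma> where "\<sigma> = Sup S"
    have \<sigma>S: "\<sigma> \<in> S" unfolding \<sigma>_def by (rule closed_contains_Sup[OF False bdd S])
    have \<sigma>b: "a \<le> \<sigma>" "\<sigma> < b" using \<sigma>S bB by (auto simp: S_def less_le)
    have after: "\<gamma> t \<in> B" if "t \<in> {\<sigma><..b}" for t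
    proof (rule ccontr)
      assume "\<gamma> t \<notin> B"
      then have "t \<in> S" using that \<sigma>b by (auto simp: S_def)
      then show False using cSup_upper[OF _ bdd] that unfolding \<sigma>_def by fastforce
    qed
    have "closed ({\<sigma>..b} \<inter> \<gamma> -` K)"
      by (rule continuous_closed_preimage[OF continuous_on_subset[OF c\<gamma>] _ K]) (use \<sigma>b in auto)
    moreover have "{\<sigma><..b} \<subseteq> {\<sigma>..b} \<inter> \<gamma> -` K" using subsetD[OF BK after] by auto
    ultimately have "closure {\<sigma><..b} \<subseteq> {\<sigma>..b} \<inter> \<gamma> -` K" by (rule closure_minimal[rotated])
    then have inK: "\<gamma> t \<in> K" if "t \<in> {\<sigma>..b}" for t using that \<sigma>b by auto
    have "\<gamma> \<sigma> \<notin> B" using \<sigma>S by (simp add: S_def)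
    moreover have "\<gamma> \<sigma> \<in> fst c" "snd c (\<gamma> \<sigma>) \<in> cball x0 \<rho>" using Kc[OF inK, of \<sigma>] \<sigma>b by auto
    ultimately have "norm (snd c (\<gamma> \<sigma>) - x0) = \<rho>" by (auto simp: B_def dist_norm norm_minus_commute)
    then show ?thesis using main[of \<sigma>] \<sigma>b inK by auto
  qed
qed

section \<open>Unit normal vectors in a slice chart\<close>

lemma unit_normal_coord:
  assumes v: "v \<in> unit_normal_cone A F N" and base: "fst v \<in> fst c"
  shows "v \<in> normal_cone_at A F N (fst v)" "fst v \<in> N" "v \<in> bundle_over A c" "bundle_chart c v \<in> slit" "f (bundle_chart c v) = 1"
    "\<And>w. w \<in> submanifold_tangent_space A N (fst v) \<Longrightarrow> fundamental_tensor F v v w = 0"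
proof -
  obtain m where m: "m \<in> N" "v \<in> normal_cone_at A F N m" and F1: "F v = 1"
    using v by (auto simp: unit_normal_cone_def normal_cone_def)
  have vm: "fst v = m" using m(2) tangent_spaceD(1)[of v A m] by (auto simp: normal_cone_at_def tzero_def)
  have xD: "snd c (fst v) \<in> D" using base by (auto simp: D_def)
  \<comment> \<open>The normal cone contains the zero vector by definition; unit length excludes it,
    because \<open>F\<close> vanishes there.\<close>
  have "F (tzero (fst v)) = 0"
    using f_zero[OF xD] tvec_of_zero[OF xD] base chart_inv_chart[OF chart] by (simp add: f_eq)
  then have nz: "v \<noteq> tzero (fst v)" using F1 by auto
  then have vt: "v \<in> tangent_space A (fst v)"
    and orth: "\<And>w. w \<in> submanifold_tangent_space A N (fst v) \<Longrightarrow> fundamental_tensor F v v w = 0"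
    using m(2) vm by (auto simp: normal_cone_at_def)
  show "v \<in> normal_cone_at A F N (fst v)" "fst v \<in> N" using m vm by auto
  show vb: "v \<in> bundle_over A c" using vt base by (simp add: bundle_over_iff[OF smooth_structure])
  show "f (bundle_chart c v) = 1" using F_eq[OF vb] F1 by simp
  have "snd v c \<noteq> 0"
  proof
    assume "snd v c = 0"
    then have "v = tzero (fst v)"
      by (intro tangent_space_eqI[OF smooth_structure vt tzero_in_tangent_space[OF smooth_structure] c base]) (simp add: tzero_def)
    then show False using nz by simp
  qed
  then show "bundle_chart c v \<in> slit" using xD by (simp add: bundle_chart_def)
  show "fundamental_tensor F v v w = 0" if "w \<in> submanifold_tangent_space A N (fst v)" for w by (rule orth[OF that])
qed

lemma submanifold_tangent_coord:
  assumes "w \<in> submanifold_tangent_space A N m" "m \<in> fst c"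
  obtains y where "w = tvec_of A c (snd c m, y)"
proof -
  obtain \<gamma> \<delta> where w: "w = velocity A \<gamma> 0" "\<delta> > 0" "smooth_into A {-\<delta><..<\<delta>} \<gamma>" "\<gamma> 0 = m"
    using assms(1) by (auto simp: submanifold_tangent_space_def)
  have "w \<in> tangent_space A m"
    using velocity_in_tangent_space[OF smooth_structure w(3) open_greaterThanLessThan, of 0] w by simp
  then have "w = tvec_of A c (snd c m, snd w c)"
    by (intro tvec_of_eqI) (use assms(2) chart_inv_chart[OF chart] in \<open>auto simp: D_def\<close>)
  then show ?thesis by (rule that)
qed

text \<open>Each \<open>s\<close> in \<open>S\<close> is the velocity of the line
  \<open>x + t s\<close>, which stays in the slice and hence in \<open>N\<close> for small
  \<open>t\<close>. So the fundamental tensor at \<open>v\<close> annihilates it, and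
  \<open>g_v (v, s)\<close> is \<open>p \<bullet> s\<close> by homogeneity of
  \<open>p\<close>.\<close>

lemma unit_normal_orthogonal:
  assumes v: "v \<in> unit_normal_cone A F N" and base: "fst v \<in> fst c"
    and S: "subspace S" "snd c ` (fst c \<inter> N) = snd c ` fst c \<inter> S" and s: "s \<in> S"
  shows "p (bundle_chart c v) \<bullet> s = 0"
proof -
  note vn = unit_normal_coord[OF v base]
  define x y where "x = snd c (fst v)" and "y = snd v c"
  have u: "bundle_chart c v = (x, y)" by (simp add: bundle_chart_def x_def y_def)
  have xD: "x \<in> D" "y \<noteq> 0" using vn(4) u by auto
  have xS: "x \<in> S" using S(2) vn(2) base by (auto simp: x_def)
  let ?x = "\<lambda>t::real. x + t *\<^sub>R s"
  have "open (?x -` D)" by (rule open_vimage[OF open_D]) (intro continuous_intros)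
  moreover have "0 \<in> ?x -` D" using xD by simp
  ultimately obtain \<delta> where \<delta>: "\<delta> > 0" "ball 0 \<delta> \<subseteq> ?x -` D" by (meson open_contains_ball)
  let ?J = "{-\<delta><..<\<delta>}"
  have J: "?x t \<in> D" if "t \<in> ?J" for t using subsetD[OF \<delta>(2), of t] that by (auto simp: dist_real_def)
  let ?\<gamma> = "\<lambda>t. chart_inv c (?x t)"
  have "smooth_on ?x ?J"
    by (intro smooth_on_add smooth_on_const smooth_on_linear_id bounded_linear_scaleR_left open_greaterThanLessThan)
  then have \<gamma>: "smooth_into A ?J ?\<gamma>"
    by (intro smooth_into_chart_inv smooth_structure c open_greaterThanLessThan) (use J in \<open>auto simp: D_def\<close>)
  have \<gamma>N: "?\<gamma> ` ?J \<subseteq> N"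
  proof clarify
    fix t assume "t \<in> ?J"
    then have "?x t \<in> snd c ` fst c \<inter> S"
      using J xS s S(1) by (auto simp: D_def intro!: subspace_add subspace_scale)
    then obtain m where "m \<in> fst c \<inter> N" "?x t = snd c m" unfolding S(2)[symmetric] by blast
    then show "?\<gamma> t \<in> N" using chart_inv_chart[OF chart] by auto
  qed
  have \<gamma>0: "?\<gamma> 0 = fst v" using base chart_inv_chart[OF chart] by (simp add: x_def)
  have 0: "0 \<in> ?J" using \<delta> by auto
  have "velocity A ?\<gamma> 0 \<in> submanifold_tangent_space A N (fst v)"
    unfolding submanifold_tangent_space_def using \<delta>(1) \<gamma> \<gamma>N \<gamma>0 by blast
  moreover have "velocity A ?\<gamma> 0 = tvec_of A c (x, s)"
  proof -
    have "(?x has_vector_derivative s) (at 0)" by (auto intro!: derivative_eq_intros)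
    then have "((\<lambda>t. snd c (?\<gamma> t)) has_vector_derivative s) (at 0)"
      by (rule has_vector_derivative_transform_within_open[OF _ open_greaterThanLessThan 0])
        (use J chart_chart_inv[OF chart] in \<open>auto simp: D_def\<close>)
    from bundle_chart_velocity(2)[OF \<gamma> open_greaterThanLessThan 0 _ this] show ?thesis
      using \<gamma>0 base by (simp add: x_def)
  qed
  ultimately have "fundamental_tensor F v v (tvec_of A c (x, s)) = 0" using vn(6) by metis
  moreover have "v = tvec_of A c (x, y)" using tvec_of_bundle_chart[OF smooth_structure c vn(3)] u by simp
  ultimately have "Dp (x, y) (0, y) \<bullet> s = 0" using fundamental_tensor_coord[OF xD] by simp
  then show ?thesis using Dp_self[OF xD] u by simp
qed

text \<open>Normality of \<open>v\<close> is the condition that \<open>p\<close> annihilates tangent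
  vectors of \<open>N\<close>, and \<open>p\<close> is homogeneous of degree 1. The cut time demands
  that \<open>T v\<close>, not only \<open>v\<close>, lie in the normal cone.\<close>

lemma tscale_normal:
  assumes v: "v \<in> unit_normal_cone A F N" and base: "fst v \<in> fst c" and r: "r > 0"
  shows "tscale r v \<in> normal_cone A F N"
proof -
  note vn = unit_normal_coord[OF v base]
  define x y where "x = snd c (fst v)" and "y = snd v c"
  have u: "bundle_chart c v = (x, y)" by (simp add: bundle_chart_def x_def y_def)
  have xD: "x \<in> D" "y \<noteq> 0" using vn(4) u by auto
  have veq: "v = tvec_of A c (x, y)" using tvec_of_bundle_chart[OF smooth_structure c vn(3)] u by simp
  have inv: "chart_inv c x = fst v" using base chart_inv_chart[OF chart] by (simp add: x_def)
  have teq: "tscale r v = tvec_of A c (x, r *\<^sub>R y)" using tscale_tvec_of[OF xD(1)] veq by simp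
  have "tscale r v \<in> tangent_space A (fst v) - {tzero (fst v)}"
    unfolding teq inv[symmetric] by (rule tvec_of_nonzero[OF xD(1)]) (use xD r in auto)
  moreover have "fundamental_tensor F (tscale r v) (tscale r v) w = 0" if w: "w \<in> submanifold_tangent_space A N (fst v)" for w
  proof -
    obtain s where s: "w = tvec_of A c (x, s)" using submanifold_tangent_coord[OF w base] by (auto simp: x_def)
    have "Dp (x, y) (0, y) \<bullet> s = 0" using vn(6)[OF w] fundamental_tensor_coord[OF xD, of y s] s veq by simp
    then show ?thesis
      unfolding teq s using xD r by (simp add: fundamental_tensor_coord Dp_self p_scale)
  qed
  ultimately show ?thesis using vn(2) by (auto simp: normal_cone_def normal_cone_at_def)
qed

text \<open>The time \<open>T\<close> of \<open>local_minimality\<close> serves as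
  \<open>\<epsilon>\<close> for every unit normal whose coordinates lie in \<open>W\<close>: it
  belongs to the set whose supremum is the cut time.\<close>

lemma cut_time_locally_bounded_below:
  assumes n: "n \<in> unit_normal_cone A F N" and base: "fst n \<in> fst c"
    and S: "subspace S" "snd c ` (fst c \<inter> N) = snd c ` fst c \<inter> S"
  shows "\<exists>\<epsilon>::real. \<epsilon> > 0 \<and> (\<exists>V. openin (unit_normal_topology A F N) V \<and> n \<in> V \<and>
    (\<forall>v\<in>V. cut_time A F N v \<ge> ereal \<epsilon>))"
proof -
  obtain x0 y0 where xy0: "bundle_chart c n = (x0, y0)" by fastforce
  have "(x0, y0) \<in> slit" using unit_normal_coord(4)[OF n base] xy0 by simp
  then obtain \<rho> T \<tau> W where \<rho>: "0 < \<rho>" "cball x0 \<rho> \<subseteq> D" and T: "0 < T" "T < \<tau>"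
    and W: "open W" "(x0, y0) \<in> W" "W \<subseteq> slit" and sol: "\<And>u. u \<in> W \<Longrightarrow> fst u \<in> ball x0 \<rho> \<and> (\<exists>z. z 0 = u \<and>
      (\<forall>t\<in>{-\<tau><..<\<tau>}. (z has_vector_derivative spray (z t)) (at t) \<and> z t \<in> slit \<and> fst (z t) \<in> ball x0 \<rho>) \<and>
      (f u = 1 \<longrightarrow> (\<forall>a b c g. speed_of a b c g \<and> (\<forall>t\<in>{a..b}. c t \<in> cball x0 \<rho>) \<and> c b = fst (z T) \<and>
        (p u \<bullet> (c a - fst u) \<le> 0 \<or> norm (c a - x0) = \<rho>) \<longrightarrow> T \<le> integral {a..b} g)))"
    by (rule local_minimality) blast
  define V where "V = unit_normal_cone A F N \<inter> {v \<in> bundle_over A c. bundle_chart c v \<in> W}"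
  have bundle_open: "openin (bundle_topology A) {v \<in> bundle_over A c. bundle_chart c v \<in> U}" if "open U" for U
    unfolding bundle_topology_def by (rule topology_generated_by_Basis) (use that c in blast)
  have V: "openin (unit_normal_topology A F N) V"
    unfolding unit_normal_topology_def V_def using bundle_open[OF W(1)] openin_subtopology_Int2 by blast
  have nV: "n \<in> V" using n unit_normal_coord(3)[OF n base] xy0 W(2) by (simp add: V_def)
  \<comment> \<open>The solution run \<open>T\<close> times as fast: it starts at
    \<open>(fst u, T *\<^sub>R snd u)\<close> and reaches at time 1 the point that the original
    reaches at time \<open>T\<close>.\<close>
  have resc: "((\<lambda>t. (fst (z (T * t)), T *\<^sub>R snd (z (T * t)))) has_vector_derivative
        spray (fst (z (T * t)), T *\<^sub>R snd (z (T * t)))) (at t)" "(fst (z (T * t)), T *\<^sub>R snd (z (T * t))) \<in> slit"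
    if z: "\<forall>t\<in>{-\<tau><..<\<tau>}. (z has_vector_derivative spray (z t)) (at t) \<and> z t \<in> slit \<and> fst (z t) \<in> ball x0 \<rho>"
      and t: "t \<in> {-(\<tau>/T)<..<\<tau>/T}" for z t
  proof -
    have Tt: "T * s \<in> {-\<tau><..<\<tau>}" if "s \<in> {-(\<tau>/T)<..<\<tau>/T}" for s
      using that T(1) by (auto simp: field_simps)
    have "\<forall>\<^sub>F s in nhds t. z (T * s) \<in> slit"
      using eventually_nhds_in_open[OF open_greaterThanLessThan t] by eventually_elim (use z Tt in blast)
    then show "((\<lambda>t. (fst (z (T * t)), T *\<^sub>R snd (z (T * t)))) has_vector_derivative
        spray (fst (z (T * t)), T *\<^sub>R snd (z (T * t)))) (at t)"
      using z Tt[OF t] T(1) by (intro spray_rescale) auto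
    show "(fst (z (T * t)), T *\<^sub>R snd (z (T * t))) \<in> slit"
      using z Tt[OF t] T(1) by (cases "z (T * t)") fastforce
  qed
  have TT: "-(\<tau>/T) < 0" "1 < \<tau>/T" using T by (auto simp: field_simps)
  have exp: "geodesic_end A F (tvec_of A c (fst u, T *\<^sub>R snd u)) (chart_inv c (fst (z T)))"
    "exp_map A F (tvec_of A c (fst u, T *\<^sub>R snd u)) = chart_inv c (fst (z T))"
    if z: "\<forall>t\<in>{-\<tau><..<\<tau>}. (z has_vector_derivative spray (z t)) (at t) \<and> z t \<in> slit \<and> fst (z t) \<in> ball x0 \<rho>"
      "z 0 = u" for z u
    using spray_exp_map[OF resc[OF z(1)] TT] z(2) by auto
  have "ereal T \<le> cut_time A F N v" if v: "v \<in> V" for v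
  proof -
    define u where "u = bundle_chart c v"
    have vU: "v \<in> unit_normal_cone A F N" and vb: "v \<in> bundle_over A c" and uW: "u \<in> W" using v by (auto simp: V_def u_def)
    have vbase: "fst v \<in> fst c" using vb by (simp add: bundle_over_def)
    note vn = unit_normal_coord[OF vU vbase, folded u_def]
    obtain z where z0: "z 0 = u" and z: "\<forall>t\<in>{-\<tau><..<\<tau>}. (z has_vector_derivative spray (z t)) (at t) \<and> z t \<in> slit \<and> fst (z t) \<in> ball x0 \<rho>"
      and mini: "\<And>a b c g. speed_of a b c g \<Longrightarrow> \<forall>t\<in>{a..b}. c t \<in> cball x0 \<rho> \<Longrightarrow> c b = fst (z T) \<Longrightarrow>
        p u \<bullet> (c a - fst u) \<le> 0 \<or> norm (c a - x0) = \<rho> \<Longrightarrow> T \<le> integral {a..b} g"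
      using sol[OF uW] vn(5) by blast
    have zI: "(z has_vector_derivative spray (z t)) (at t)" "z t \<in> slit" if "t \<in> {-\<tau><..<\<tau>}" for t
      using z that by auto
    have u_fst: "fst u = snd c (fst v)" by (simp add: u_def bundle_chart_def)
    have uD: "fst u \<in> D" using vbase by (auto simp: u_fst D_def)
    have veq: "v = tvec_of A c u" using tvec_of_bundle_chart[OF smooth_structure c vb] by (simp add: u_def)
    have teq: "tscale T v = tvec_of A c (fst u, T *\<^sub>R snd u)"
      using tscale_tvec_of[OF uD, of T "snd u"] veq by simp
    define qT where "qT = chart_inv c (fst (z T))"
    have expT: "exp_map A F (tscale T v) = qT" unfolding teq qT_def by (rule exp(2)[OF z z0])
    have dom: "tscale T v \<in> exp_domain A F"
    proof -
      \<comment> \<open>The vectors \<open>(x, T y)\<close> with \<open>(x, y)\<close> in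
        \<open>W\<close>: an open set on which geodesics exist up to time 1. It places
        \<open>T v\<close> in the interior, as \<open>exp_domain\<close> demands.\<close>
      define W' where "W' = (\<lambda>w. (fst w, (1 / T) *\<^sub>R snd w)) -` W"
      have W': "open W'" unfolding W'_def by (rule open_vimage[OF W(1)]) (intro continuous_intros)
      let ?O = "{w \<in> bundle_over A c. bundle_chart c w \<in> W'}"
      have "?O \<subseteq> {v \<in> tangent_bundle A. \<exists>q. geodesic_end A F v q}"
      proof clarify
        fix m w assume w: "(m, w) \<in> bundle_over A c" "bundle_chart c (m, w) \<in> W'"
        define u' where "u' = (fst (bundle_chart c (m, w)), (1 / T) *\<^sub>R snd (bundle_chart c (m, w)))"
        have "u' \<in> W" using w(2) by (simp add: W'_def u'_def)
        then obtain z' where "z' 0 = u'" "\<forall>t\<in>{-\<tau><..<\<tau>}. (z' has_vector_derivative spray (z' t)) (at t) \<and> z' t \<in> slit \<and> fst (z' t) \<in> ball x0 \<rho>"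
          using sol by blast
        from exp(1)[OF this(2,1)] have "\<exists>q. geodesic_end A F (tvec_of A c (bundle_chart c (m, w))) q"
          using T(1) by (auto simp: u'_def)
        then show "(m, w) \<in> tangent_bundle A \<and> (\<exists>q. geodesic_end A F (m, w) q)"
          using w(1) tvec_of_bundle_chart[OF smooth_structure c w(1)] by (simp add: bundle_over_def)
      qed
      moreover have "tscale T v \<in> ?O"
        using tvec_of_coords(3,4)[OF uD, of "T *\<^sub>R snd u"] uW T(1) by (simp add: teq W'_def)
      ultimately show ?thesis
        unfolding exp_domain_def using interior_of_maximal[OF _ bundle_open[OF W']] by blast
    qed
    have I0: "0 \<in> {-\<tau><..<\<tau>}" "T \<in> {-\<tau><..<\<tau>}" using T by auto
    have zT: "qT \<in> fst c" "snd c qT = fst (z T)" using slit_chart[OF zI(2)[OF I0(2)]] by (auto simp: qT_def)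
    have "dist_from A F N qT = ereal T"
    proof (rule antisym)
      \<comment> \<open>Upper bound: the geodesic itself starts on \<open>N\<close>, has unit speed
        and therefore length \<open>T\<close>.\<close>
      let ?\<gamma> = "\<lambda>t. chart_inv c (fst (z t))"
      have sm: "smooth_into A {-\<tau><..<\<tau>} ?\<gamma>" by (rule spray_smooth_into[OF zI])
      have sub: "{0..T} \<subseteq> {-\<tau><..<\<tau>}" using T by auto
      have "piecewise_smooth A 0 T ?\<gamma>"
        unfolding piecewise_smooth_def
      proof (intro conjI exI[of _ "1::nat"] exI[of _ "\<lambda>i. if i = 0 then 0 else T"] allI impI)
        show "continuous_on {0..T} ?\<gamma>" using sm sub by (auto simp: smooth_into_def elim: continuous_on_subset)
        show "\<exists>J \<eta>. open J \<and> {(if i = 0 then 0 else T)..(if Suc i = 0 then 0 else T)} \<subseteq> J \<and> smooth_into A J \<eta> \<and>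
          (\<forall>t\<in>{(if i = 0 then 0 else T)..(if Suc i = 0 then 0 else T)}. \<eta> t = ?\<gamma> t)" if "i < 1" for i :: nat
          using that sm sub by (intro exI[of _ "{-\<tau><..<\<tau>}"] exI[of _ ?\<gamma>]) auto
      qed (use T in auto)
      moreover have "curve_length A F 0 T ?\<gamma> = T"
      proof -
        have "F (velocity A ?\<gamma> t) = 1" if "t \<in> {0..T}" for t
          using spray_velocity(2)[OF zI subsetD[OF sub that]]
            spray_speed_constant[OF zI subsetD[OF sub that] I0(1)] z0 vn(5) by simp
        then have "integral {0..T} (\<lambda>t. F (velocity A ?\<gamma> t)) = integral {0..T} (\<lambda>t. 1)" by (intro integral_cong) simp
        then show ?thesis using T by (simp add: curve_length_def)
      qed
      moreover have "?\<gamma> 0 \<in> N" using vn(2) vbase chart_inv_chart[OF chart] by (simp add: z0 u_fst)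
      ultimately show "dist_from A F N qT \<le> ereal T"
        unfolding dist_from_def qT_def using T(1) by (intro Inf_lower) force
      \<comment> \<open>Lower bound: a competitor anywhere on the manifold is reduced by
        \<open>curve_length_lower_bound\<close> to a curve in the closed coordinate ball.\<close>
      show "ereal T \<le> dist_from A F N qT"
        unfolding dist_from_def
      proof (rule Inf_greatest, clarsimp)
        fix a b \<gamma> assume ab: "a < b" and pw: "piecewise_smooth A a b \<gamma>" and \<gamma>a: "\<gamma> a \<in> N" and qb: "qT = \<gamma> b"
        show "T \<le> curve_length A F a b \<gamma>"
        proof (rule curve_length_lower_bound[OF \<rho>(2) pw ab, where P = "\<lambda>x. p u \<bullet> (x - fst u) \<le> 0"])
          show "\<gamma> b \<in> fst c" "snd c (\<gamma> b) \<in> ball x0 \<rho>" using zT z I0(2) qb by auto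
          show "p u \<bullet> (snd c (\<gamma> a) - fst u) \<le> 0" if "\<gamma> a \<in> fst c"
          proof -
            \<comment> \<open>The slice condition covers every point of \<open>N\<close> in the
              chart domain, not only those near the base point, so any starting point there differs
              from \<open>fst u\<close> by a vector of \<open>S\<close>.\<close>
            have "snd c (\<gamma> a) \<in> S" "fst u \<in> S" using S(2) that \<gamma>a vn(2) vbase u_fst by auto
            then have "snd c (\<gamma> a) - fst u \<in> S" by (rule subspace_diff[OF S(1)])
            then show ?thesis using unit_normal_orthogonal[OF vU vbase S] by (simp add: u_def)
          qed
          show "T \<le> integral {\<alpha>..b} g"
            if "speed_of \<alpha> b x g" "\<forall>t\<in>{\<alpha>..b}. x t \<in> cball x0 \<rho>" "x b = snd c (\<gamma> b)"
              "p u \<bullet> (x \<alpha> - fst u) \<le> 0 \<or> norm (x \<alpha> - x0) = \<rho>" for \<alpha> x g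
            using mini[OF that(1,2) _ that(4)] that(3) zT(2) qb by simp
        qed
      qed
    qed
    then show ?thesis
      unfolding cut_time_def
      using T(1) tscale_normal[OF vU vbase T(1)] dom expT by (intro Sup_upper) auto
  qed
  with T(1) V nV show ?thesis by blast
qed

end

theorem theorem3p8:
  fixes A :: "('m::{t2_space,second_countable_topology}, 'e::euclidean_space) chart set"
    and F :: "('m, 'e) tvec \<Rightarrow> real"
    and N :: "'m set"
  assumes "finsler_manifold A F"
    and "closed_submanifold A N"
  shows "(\<forall>v \<in> unit_normal_cone A F N. cut_time A F N v > 0) \<and>
    (\<forall>n \<in> unit_normal_cone A F N. \<exists>\<epsilon>::real. \<epsilon> > 0 \<and>
      (\<exists>V. openin (unit_normal_topology A F N) V \<and> n \<in> V \<and>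
        (\<forall>v\<in>V. cut_time A F N v \<ge> ereal \<epsilon>)))"
proof -
  have local: "\<exists>\<epsilon>::real. \<epsilon> > 0 \<and> (\<exists>V. openin (unit_normal_topology A F N) V \<and> n \<in> V \<and>
      (\<forall>v\<in>V. cut_time A F N v \<ge> ereal \<epsilon>))" if n: "n \<in> unit_normal_cone A F N" for n
  proof -
    obtain m where "m \<in> N" "n \<in> normal_cone_at A F N m"
      using n by (auto simp: unit_normal_cone_def normal_cone_def)
    then have "fst n \<in> N" by (auto simp: normal_cone_at_def tzero_def dest: tangent_spaceD(1))
    then obtain d S where d: "d \<in> A" "fst n \<in> fst d"
      and S: "subspace S" "snd d ` (fst d \<inter> N) = snd d ` fst d \<inter> S"
      using assms(2) unfolding closed_submanifold_def by blast
    interpret finsler_coord A F d using assms(1) d(1) by unfold_locales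
    show ?thesis by (rule cut_time_locally_bounded_below[OF n d(2) S])
  qed
  have "cut_time A F N v > 0" if v: "v \<in> unit_normal_cone A F N" for v
  proof -
    obtain \<epsilon> V where "\<epsilon> > 0" "v \<in> V" "\<forall>v\<in>V. cut_time A F N v \<ge> ereal \<epsilon>" using local[OF v] by blast
    then have "0 < ereal \<epsilon>" "ereal \<epsilon> \<le> cut_time A F N v" by auto
    then show ?thesis by (rule less_le_trans)
  qed
  with local show ?thesis by blast
qed

end
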